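(* There exists a minimizer of $\mathrm{TV}$ over $\mathrm{BV}_\diamond$ attaining exactly three values (one of which is zero) for which all level-sets corresponding to non-zero values are indecomposable.
   Context: Setting: $\Omega_s\subset\Omega\subset\mathbb{R}^2$ are bounded, open and strongly Lipschitz, $\partial\Omega_s\cap\partial\Omega=\emptyset$, and $\Omega_s$ has finitely many connected components. For $v\in L^1(\mathbb{R}^2)$, $\mathrm{TV}(v)$ denotes the total mass of the distributional gradient $\nabla v$ on $\mathbb{R}^2$ (total variation), and $$\mathrm{BV}_\diamond:=\Big\{v\in\mathrm{BV}(\mathbb{R}^2)\ :\ \int_\Omega v=0,\ \frac{1}{|\Omega_s|}\int_{\Omega_s}v=1,\ \nabla v=0\text{ on }\Omega_s,\ v=0\text{ on }\mathbb{R}^2\setminus\Omega\Big\}.$$ Functions are identified when equal almost everywhere, and the values attained are understood for a suitable representative. For a function $u$ with finitely many values, the level-set corresponding to the value $c$ is $\{u=c\}$. For a measurable set $B$ with $|B|<\infty$, $\mathrm{Per}(B):=\mathrm{TV}(1_B)$. A set of finite perimeter $A$ is called indecomposable if there are no two disjoint sets of finite perimeter $B,C$ such that $|B|>0$, $|C|>0$, $A=B\cup C$ and $\mathrm{Per}(A)=\mathrm{Per}(B)+\mathrm{Per}(C)$. *)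

theory Defs
  imports "HOL-Analysis.Analysis"
begin

primrec Ck :: "nat \<Rightarrow> ('a::euclidean_space \<Rightarrow> 'b::euclidean_space) \<Rightarrow> bool" where
  "Ck 0 f \<longleftrightarrow> continuous_on UNIV f"
| "Ck (Suc k) f \<longleftrightarrow>
     (\<forall>x. f differentiable (at x)) \<and> (\<forall>h. Ck k (\<lambda>x. frechet_derivative f (at x) h))"

definition test_fields :: "'a::euclidean_space set \<Rightarrow> ('a \<Rightarrow> 'a) set" where
  "test_fields U =
     {\<phi>. (\<forall>k. Ck k \<phi>) \<and> compact (closure {x. \<phi> x \<noteq> 0}) \<and> closure {x. \<phi> x \<noteq> 0} \<subseteq> U}"

definition divergence :: "('a::euclidean_space \<Rightarrow> 'a) \<Rightarrow> 'a \<Rightarrow> real" where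
  "divergence \<phi> x = (\<Sum>b\<in>Basis. frechet_derivative \<phi> (at x) b \<bullet> b)"

definition dist_grad :: "('a::euclidean_space \<Rightarrow> real) \<Rightarrow> ('a \<Rightarrow> 'a) \<Rightarrow> real" where
  "dist_grad v \<phi> = - (LINT x|lebesgue. v x * divergence \<phi> x)"

(* Mass on U of a vector-valued distribution T, as the dual norm with respect to the
   Euclidean supremum norm of test fields; it is infinite if T is not a finite measure on U. *)
definition total_mass :: "(('a::euclidean_space \<Rightarrow> 'a) \<Rightarrow> real) \<Rightarrow> 'a set \<Rightarrow> ereal" where
  "total_mass T U = (SUP \<phi>\<in>{\<phi>\<in>test_fields U. \<forall>x. norm (\<phi> x) \<le> 1}. ereal (T \<phi>))"

definition TV :: "('a::euclidean_space \<Rightarrow> real) \<Rightarrow> ereal" where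
  "TV v = total_mass (dist_grad v) UNIV"

definition BV :: "('a::euclidean_space \<Rightarrow> real) set" where
  "BV = {v. integrable lebesgue v \<and> TV v < \<infinity>}"

(* Elements are functions rather than classes modulo null sets; every condition is
   invariant under changes on a null set. *)
definition BV_diamond :: "(real^2) set \<Rightarrow> (real^2) set \<Rightarrow> (real^2 \<Rightarrow> real) set" where
  "BV_diamond \<Omega> \<Omega>\<^sub>s =
     {v \<in> BV. (LINT x:\<Omega>|lebesgue. v x) = 0
        \<and> 1 / measure lebesgue \<Omega>\<^sub>s * (LINT x:\<Omega>\<^sub>s|lebesgue. v x) = 1
        \<and> (\<forall>\<phi>\<in>test_fields \<Omega>\<^sub>s. dist_grad v \<phi> = 0)
        \<and> (AE x in lebesgue. x \<notin> \<Omega> \<longrightarrow> v x = 0)}"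

definition Per :: "'a::euclidean_space set \<Rightarrow> ereal" where
  "Per B = TV (indicator B :: 'a \<Rightarrow> real)"

definition finite_perimeter :: "'a::euclidean_space set \<Rightarrow> bool" where
  "finite_perimeter B \<longleftrightarrow> B \<in> lmeasurable \<and> Per B < \<infinity>"

definition indecomposable :: "'a::euclidean_space set \<Rightarrow> bool" where
  "indecomposable A \<longleftrightarrow> finite_perimeter A \<and>
     \<not> (\<exists>B C. finite_perimeter B \<and> finite_perimeter C \<and> B \<inter> C = {} \<and>
           measure lebesgue B > 0 \<and> measure lebesgue C > 0 \<and>
           A = B \<union> C \<and> Per A = Per B + Per C)"

(* Near each boundary point, S is the strict epigraph of a Lipschitz function in rotated
   orthonormal coordinates: n is the last coordinate direction, and x - (x \<bullet> n) n carries
   the remaining coordinates. *)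
definition strongly_Lipschitz :: "'a::euclidean_space set \<Rightarrow> bool" where
  "strongly_Lipschitz S \<longleftrightarrow>
     (\<forall>p\<in>frontier S. \<exists>r>0. \<exists>n L \<gamma>. norm n = 1 \<and> L-lipschitz_on {y. y \<bullet> n = 0} \<gamma> \<and>
        S \<inter> ball p r = {x \<in> ball p r. \<gamma> (x - (x \<bullet> n) *\<^sub>R n) < x \<bullet> n})"

end

theory Submission
  imports Defs "HOL-Complex_Analysis.Great_Picard"
begin

text \<open>
Write \<open>g E = |E \<inter> \<Omega>\<^sub>s| / |\<Omega>\<^sub>s|\<close>, and call a set \<open>E \<subseteq> \<Omega>\<close> of positive measure and finite
perimeter admissible if its indicator has no gradient on \<open>\<Omega>\<^sub>s\<close>.

A minimizer \<open>u\<close> of the total variation over \<open>BV_diamond \<Omega> \<Omega>\<^sub>s\<close> exists by the direct method: the class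
is not empty, the total variation is lower semicontinuous, and bounded sequences are compact in \<open>L\<^sup>1\<close>
(lemma \<open>BV_compactness\<close>). Let \<open>m > 0\<close> be the minimal value. For admissible \<open>E\<close> and \<open>F\<close> a suitable
combination \<open>a 1\<^sub>E - b 1\<^sub>F\<close> is a competitor, and comparing it with \<open>m\<close> gives
\<open>m (g E / |E| - g F / |F|) \<le> Per E / |E| + Per F / |F|\<close>. Hence there is a multiplier \<open>\<alpha>\<close> such that
the additive set function \<open>\<kappa> E = m g E + \<alpha> |E|\<close> satisfies \<open>\<kappa> E \<le> Per E\<close> and \<open>- \<kappa> F \<le> Per F\<close> for all
admissible sets. By the coarea inequality (lemma \<open>coarea_le\<close>) the perimeters of the level sets of \<open>u\<close>
integrate to at most \<open>m\<close>, while by the layer cake formula the values of \<open>\<kappa>\<close> on \<open>{u > t}\<close> for \<open>t > 0\<close>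
and of \<open>- \<kappa>\<close> on \<open>{u \<le> t}\<close> for \<open>t < 0\<close> integrate to exactly \<open>m\<close>. So there is equality for almost
every level, which gives disjoint sets \<open>E = {u > t}\<close>, \<open>F = {u \<le> r}\<close> with \<open>r < 0 < t\<close> on which the
perimeter equals \<open>\<kappa>\<close> and \<open>- \<kappa>\<close> respectively. Equality in both bounds makes the combination
\<open>a 1\<^sub>E - b 1\<^sub>F\<close> a minimizer with exactly three values.

To obtain indecomposable sets, note that if \<open>E\<close> with \<open>Per E = \<kappa> E\<close> splits into \<open>B\<close> and \<open>C\<close> with
\<open>Per E = Per B + Per C\<close>, then \<open>B\<close> and \<open>C\<close> are again admissible (lemma \<open>gradient_free_summand\<close>)
and again attain the bound. Sets attaining the bound have perimeter at most a constant times their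
measure, and therefore measure at least some positive constant (lemma \<open>measure_lower_bound\<close>). A set
attaining the bound whose measure is less than twice the infimum of such measures cannot split.

The analytic tool throughout is convolution with smooth kernels. The derivative of a convolution is
the distributional gradient tested against a translate of the kernel (lemma
\<open>conv_deriv_eq_dist_grad\<close>). This yields the estimate
\<open>\<integral> |v (x + h) - v x| dx \<le> |h| TV v\<close> (lemma \<open>translation_estimate\<close>), from which the convergence of
mollifications, compactness, the Poincare inequality and the lower bound for measures follow.
\<close>

section \<open>Smooth functions and test functions\<close>

text \<open>Infinitely often differentiable functions, in terms of the iterated directional derivatives.\<close>

definition smooth :: "('a::euclidean_space \<Rightarrow> 'b::euclidean_space) \<Rightarrow> bool" where
  "smooth f \<longleftrightarrow> (\<forall>k. Ck k f)"

text \<open>Smooth functions with compact support. The target type is arbitrary, so that scalar kernels and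
vector fields are covered at once.\<close>

definition test_fun :: "('a::euclidean_space \<Rightarrow> 'b::euclidean_space) \<Rightarrow> bool" where
  "test_fun f \<longleftrightarrow> smooth f \<and> compact (closure {x. f x \<noteq> 0})"

lemma test_fields_iff: "\<phi> \<in> test_fields U \<longleftrightarrow> test_fun \<phi> \<and> closure {x. \<phi> x \<noteq> 0} \<subseteq> U"
  by (auto simp: test_fields_def test_fun_def smooth_def)

text \<open>An introduction rule in terms of an arbitrary derivative instead of the chosen one.\<close>

lemma CkI_Suc:
  assumes "\<And>x. (f has_derivative f' x) (at x)" "\<And>h. Ck k (\<lambda>x. f' x h)"
  shows "Ck (Suc k) f"
proof -
  have "frechet_derivative f (at x) = f' x" for x
    using frechet_derivative_at[OF assms(1)] by simp
  then show ?thesis using assms by (auto simp: differentiable_def)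
qed

lemma Ck_Suc_deriv: "Ck (Suc k) f \<Longrightarrow> (f has_derivative frechet_derivative f (at x)) (at x)"
  by (auto simp: frechet_derivative_works[symmetric])

lemma Ck_Suc_dir: "Ck (Suc k) f \<Longrightarrow> Ck k (\<lambda>x. frechet_derivative f (at x) h)"
  by simp

lemma Ck_SucD: "Ck (Suc k) f \<Longrightarrow> Ck k f"
proof (induction k arbitrary: f)
  case 0
  then show ?case
    by (auto simp: continuous_on_eq_continuous_at intro: differentiable_imp_continuous_within)
next
  case (Suc k)
  have "(f has_derivative frechet_derivative f (at x)) (at x)" for x
    using Suc.prems by (rule Ck_Suc_deriv)
  moreover have "Ck k (\<lambda>x. frechet_derivative f (at x) h)" for h
    using Suc.prems by (intro Suc.IH) simp
  ultimately show ?case by (rule CkI_Suc)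
qed

lemma Ck_const: "Ck k (\<lambda>x. c)"
proof (induction k arbitrary: c)
  case (Suc k)
  show ?case by (rule CkI_Suc[where f'="\<lambda>_ _. 0"]) (auto intro: derivative_intros Suc)
qed auto

lemma Ck_add: "Ck k f \<Longrightarrow> Ck k g \<Longrightarrow> Ck k (\<lambda>x. f x + g x)"
proof (induction k arbitrary: f g)
  case (Suc k)
  have "((\<lambda>x. f x + g x) has_derivative
     (\<lambda>h. frechet_derivative f (at x) h + frechet_derivative g (at x) h)) (at x)" for x
    by (intro derivative_intros Ck_Suc_deriv[OF Suc.prems(1)] Ck_Suc_deriv[OF Suc.prems(2)])
  then show ?case
    by (rule CkI_Suc) (use Suc in auto)
qed (auto intro: continuous_intros)

lemma Ck_bounded_linear:
  assumes "bounded_linear L" shows "Ck k L"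
proof (cases k)
  case (Suc j)
  show ?thesis unfolding Suc
    by (rule CkI_Suc[where f'="\<lambda>_. L"])
      (auto intro: Ck_const bounded_linear_imp_has_derivative assms)
qed (use assms in \<open>auto intro: linear_continuous_on\<close>)

lemma Ck_bilinear:
  assumes "bounded_bilinear p"
  shows "Ck k f \<Longrightarrow> Ck k g \<Longrightarrow> Ck k (\<lambda>x. p (f x) (g x))"
proof (induction k arbitrary: f g)
  case 0
  then show ?case by (auto intro: bounded_bilinear.continuous_on[OF assms])
next
  case (Suc k)
  have d: "((\<lambda>x. p (f x) (g x)) has_derivative
     (\<lambda>h. p (f x) (frechet_derivative g (at x) h) + p (frechet_derivative f (at x) h) (g x))) (at x)" for x
    by (rule bounded_bilinear.FDERIV[OF assms])
      (intro Ck_Suc_deriv[OF Suc.prems(1)] Ck_Suc_deriv[OF Suc.prems(2)])+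
  show ?case
    by (rule CkI_Suc[OF d], rule Ck_add; rule Suc.IH)
      (rule Ck_SucD Ck_Suc_dir, rule Suc.prems)+
qed

lemma Ck_compose_affine:
  fixes f :: "'a::euclidean_space \<Rightarrow> 'b::euclidean_space"
  shows "Ck k f \<Longrightarrow> Ck k (\<lambda>x. f (a + c *\<^sub>R x))"
proof (induction k arbitrary: f)
  case 0
  then show ?case
    by (auto intro!: continuous_on_compose2[of UNIV f] continuous_intros)
next
  case (Suc k)
  have d: "((\<lambda>x. f (a + c *\<^sub>R x)) has_derivative
      (\<lambda>h. frechet_derivative f (at (a + c *\<^sub>R x)) (c *\<^sub>R h))) (at x)" for x
    by (rule has_derivative_compose[OF _ Ck_Suc_deriv[OF Suc.prems]])
      (auto intro!: derivative_eq_intros)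
  show ?case
    by (rule CkI_Suc[OF d], rule Suc.IH) (use Suc.prems in auto)
qed

lemma Ck_compose_real:
  fixes f :: "real \<Rightarrow> real" and g :: "'a::euclidean_space \<Rightarrow> real"
  shows "Ck k f \<Longrightarrow> Ck k g \<Longrightarrow> Ck k (\<lambda>x. f (g x))"
proof (induction k arbitrary: f)
  case 0
  then show ?case
    by (auto intro!: continuous_on_compose2[of UNIV f] continuous_intros)
next
  case (Suc k)
  have d: "((\<lambda>x. f (g x)) has_derivative
      (\<lambda>h. frechet_derivative g (at x) h * frechet_derivative f (at (g x)) 1)) (at x)" for x
  proof -
    have "((\<lambda>x. f (g x)) has_derivative
      (\<lambda>h. frechet_derivative f (at (g x)) (frechet_derivative g (at x) h))) (at x)"
      by (rule has_derivative_compose[OF Ck_Suc_deriv[OF Suc.prems(2)] Ck_Suc_deriv[OF Suc.prems(1)]])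
    moreover have "linear (frechet_derivative f (at (g x)))"
      using Ck_Suc_deriv[OF Suc.prems(1)] by (rule has_derivative_linear)
    then have "frechet_derivative f (at (g x)) y = y * frechet_derivative f (at (g x)) 1" for y
      using linear_scale[of "frechet_derivative f (at (g x))" y 1] by simp
    then have "(\<lambda>h. frechet_derivative f (at (g x)) (frechet_derivative g (at x) h)) =
      (\<lambda>h. frechet_derivative g (at x) h * frechet_derivative f (at (g x)) 1)"
      by (intro ext)
    ultimately show ?thesis by (simp only:)
  qed
  have "Ck k (\<lambda>x. frechet_derivative f (at (g x)) 1)"
    using Suc.IH[OF Ck_Suc_dir[OF Suc.prems(1)] Ck_SucD[OF Suc.prems(2)]] .
  then have e: "Ck k (\<lambda>x. frechet_derivative g (at x) h * frechet_derivative f (at (g x)) 1)" for h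
    by (rule Ck_bilinear[OF bounded_bilinear_mult Ck_Suc_dir[OF Suc.prems(2)]])
  show ?case
    by (rule CkI_Suc[OF d e])
qed

lemma smooth_const [intro]: "smooth (\<lambda>x. c')"
  and smooth_add: "smooth f \<Longrightarrow> smooth g \<Longrightarrow> smooth (\<lambda>x. f x + g x)"
  and smooth_bilinear: "bounded_bilinear p \<Longrightarrow> smooth f \<Longrightarrow> smooth g' \<Longrightarrow> smooth (\<lambda>x. p (f x) (g' x))"
  and smooth_bounded_linear: "bounded_linear L \<Longrightarrow> smooth L"
  and smooth_compose_affine: "smooth f \<Longrightarrow> smooth (\<lambda>x. f (a + c *\<^sub>R x))"
  by (auto simp: smooth_def Ck_const Ck_add Ck_bilinear Ck_bounded_linear Ck_compose_affine)

lemma smooth_compose_real: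
  fixes f :: "real \<Rightarrow> real" and g :: "'a::euclidean_space \<Rightarrow> real"
  shows "smooth f \<Longrightarrow> smooth g \<Longrightarrow> smooth (\<lambda>x. f (g x))"
  by (auto simp: smooth_def Ck_compose_real)

lemmas smooth_scaleR = smooth_bilinear[OF bounded_bilinear_scaleR]
lemmas smooth_mult = smooth_bilinear[OF bounded_bilinear_mult]
lemmas smooth_inner = smooth_bilinear[OF bounded_bilinear_inner]

lemma smooth_sum: "finite I \<Longrightarrow> (\<And>i. i \<in> I \<Longrightarrow> smooth (f i)) \<Longrightarrow> smooth (\<lambda>x. \<Sum>i\<in>I. f i x)"
  by (induction I rule: finite_induct) (auto intro: smooth_add)

lemma smooth_deriv: "smooth f \<Longrightarrow> (f has_derivative frechet_derivative f (at x)) (at x)"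
  by (rule Ck_Suc_deriv[of 0]) (simp only: smooth_def)

lemma smooth_continuous: "smooth f \<Longrightarrow> continuous_on S f"
  by (metis Ck.simps(1) continuous_on_subset smooth_def subset_UNIV)

lemma smooth_frechet_derivative: "smooth f \<Longrightarrow> smooth (\<lambda>x. frechet_derivative f (at x) h)"
  unfolding smooth_def by (metis Ck.simps(2))

subsection \<open>A bump function\<close>

text \<open>The function \<open>P(1/s) exp(-1/s)\<close> for \<open>s > 0\<close>, continued by zero. For polynomials \<open>P\<close> this family is
closed under differentiation, whence its members are smooth.\<close>

definition flat_exp :: "real poly \<Rightarrow> real \<Rightarrow> real" where
  "flat_exp P s = (if s > 0 then poly P (1/s) * exp (- (1/s)) else 0)"

lemma poly_exp_tendsto_0: "((\<lambda>y. poly P y * exp (- y)) \<longlongrightarrow> (0::real)) at_top"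
proof -
  have "((\<lambda>y. \<Sum>i\<le>degree P. coeff P i * (y ^ i / exp y)) \<longlongrightarrow> (\<Sum>i\<le>degree P. coeff P i * 0)) at_top"
    by (intro tendsto_intros tendsto_power_div_exp_0)
  then show ?thesis
    by (simp add: poly_altdef sum_distrib_right exp_minus divide_inverse mult.assoc)
qed

lemma flat_exp_deriv:
  "(flat_exp P has_field_derivative flat_exp (monom 1 2 * (P - pderiv P)) s) (at s)"
proof -
  consider "s > 0" | "s < 0" | "s = 0" by linarith
  then show ?thesis
  proof cases
    case 1
    have "((\<lambda>s. poly P (1/s) * exp (- (1/s))) has_field_derivative
        flat_exp (monom 1 2 * (P - pderiv P)) s) (at s)"
      using 1 by (auto intro!: derivative_eq_intros DERIV_chain2[OF poly_DERIV]
          simp: flat_exp_def poly_monom field_simps power2_eq_square)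
    then show ?thesis
      by (rule has_field_derivative_transform_within_open[of _ _ _ "{0<..}"])
         (use 1 in \<open>auto simp: flat_exp_def\<close>)
  next
    case 2
    have "((\<lambda>s. 0) has_field_derivative flat_exp (monom 1 2 * (P - pderiv P)) s) (at s)"
      using 2 by (auto simp: flat_exp_def)
    then show ?thesis
      by (rule has_field_derivative_transform_within_open[of _ _ _ "{..<0}"])
         (use 2 in \<open>auto simp: flat_exp_def\<close>)
  next
    case 3
    have "((\<lambda>h. flat_exp P h / h) \<longlongrightarrow> 0) (at_right 0)"
    proof -
      have "((\<lambda>h::real. poly (P * monom 1 1) (inverse h) * exp (- inverse h)) \<longlongrightarrow> 0) (at_right 0)"
        by (rule filterlim_compose[OF poly_exp_tendsto_0 filterlim_inverse_at_top_right])
      then show ?thesis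
        by (rule Lim_transform_eventually)
          (auto simp: eventually_at_right_field flat_exp_def poly_monom field_simps intro!: exI[of _ 1])
    qed
    moreover have "((\<lambda>h. flat_exp P h / h) \<longlongrightarrow> 0) (at_left 0)"
      by (rule Lim_transform_eventually[OF tendsto_const])
        (auto simp: eventually_at_left_field flat_exp_def intro!: exI[of _ "-1"])
    ultimately have "((\<lambda>h. flat_exp P h / h) \<longlongrightarrow> 0) (at 0)"
      by (simp add: filterlim_split_at)
    then show ?thesis using 3 by (simp add: DERIV_def flat_exp_def)
  qed
qed

lemma smooth_flat_exp: "smooth (flat_exp P)"
proof -
  have "Ck k (flat_exp P)" for k
  proof (induction k arbitrary: P)
    case 0
    show ?case by (simp, rule DERIV_continuous_on[OF has_field_derivative_at_within[OF flat_exp_deriv]])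
  next
    case (Suc k)
    show ?case
      by (rule CkI_Suc[OF flat_exp_deriv[unfolded has_field_derivative_def]])
        (intro Ck_bilinear[OF bounded_bilinear_mult] Suc Ck_const)
  qed
  then show ?thesis by (simp add: smooth_def)
qed

text \<open>The standard bump function supported in the closed unit ball, normalised to the value 1 at the origin.\<close>

definition bump :: "'a::euclidean_space \<Rightarrow> real" where
  "bump x = exp 1 * flat_exp 1 (1 - x \<bullet> x)"

lemma bump_props:
  shows smooth_bump: "smooth (bump :: 'a::euclidean_space \<Rightarrow> real)"
    and bump_nonneg: "0 \<le> bump (x::'a)"
    and bump_le_1: "bump (x::'a) \<le> 1"
    and bump_0: "bump (0::'a) = 1"
    and bump_nz_iff: "bump (x::'a) \<noteq> 0 \<longleftrightarrow> norm x < 1"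
proof -
  have "smooth (\<lambda>x::'a. 1 + (- 1) * (x \<bullet> x))"
    by (intro smooth_add smooth_mult smooth_inner smooth_const smooth_bounded_linear bounded_linear_ident)
  then have "smooth (\<lambda>x::'a. 1 - x \<bullet> x)" by simp
  then show "smooth (bump :: 'a \<Rightarrow> real)"
    unfolding bump_def[abs_def]
    by (intro smooth_mult smooth_const smooth_compose_real[OF smooth_flat_exp])
  show "0 \<le> bump x" by (simp add: bump_def flat_exp_def)
  show "bump x \<le> 1"
  proof (cases "x \<bullet> x < 1")
    case True
    then have "1 \<le> 1 / (1 - x \<bullet> x)" by (simp add: field_simps)
    then have "exp (1 + - (1 / (1 - x \<bullet> x))) \<le> 1" by simp
    moreover have "bump x = exp (1 + - (1 / (1 - x \<bullet> x)))"
      using True by (simp add: bump_def flat_exp_def exp_add[symmetric])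
    ultimately show ?thesis by simp
  qed (simp add: bump_def flat_exp_def)
  show "bump (0::'a) = 1" by (simp add: bump_def flat_exp_def exp_minus)
  show "bump x \<noteq> 0 \<longleftrightarrow> norm x < 1"
    by (auto simp: bump_def flat_exp_def norm_eq_sqrt_inner)
qed

lemma test_funI:
  assumes "smooth f" "\<And>x. f x \<noteq> 0 \<Longrightarrow> x \<in> K" "bounded K"
  shows "test_fun f"
  unfolding test_fun_def using assms
  by (meson bounded_subset compact_closure mem_Collect_eq subsetI)

lemma smooth_polynomial_function:
  fixes f :: "'a::euclidean_space \<Rightarrow> 'b::euclidean_space"
  assumes "polynomial_function f" shows "smooth f"
proof -
  have r: "smooth p" if "real_polynomial_function p" for p :: "'a \<Rightarrow> real"
    using that by induction (auto intro: smooth_bounded_linear smooth_add smooth_mult)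
  have "smooth (\<lambda>x. \<Sum>b\<in>Basis. (f x \<bullet> b) *\<^sub>R b)"
    using assms
    by (intro smooth_sum smooth_scaleR smooth_const r) (auto simp: polynomial_function_iff_Basis_inner)
  then show ?thesis by (simp add: euclidean_representation)
qed

text \<open>Every measurable function with values in the unit ball is an almost everywhere limit of test
functions with values in the unit ball: approximate it by continuous functions, these by
polynomials on large balls (Stone--Weierstrass), and multiply by wide bump functions.\<close>

lemma test_fun_dense:
  fixes g :: "'a::euclidean_space \<Rightarrow> 'b::euclidean_space"
  assumes g: "g \<in> borel_measurable borel" and g1: "\<And>x. norm (g x) \<le> 1"
  obtains \<psi> where "\<And>n::nat. test_fun (\<psi> n)" "\<And>n x. norm (\<psi> n x) \<le> 1"
    "AE x in lborel. (\<lambda>n. \<psi> n x) \<longlonglongrightarrow> g x"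
proof -
  have "g \<in> borel_measurable (lebesgue_on UNIV)"
    using g by (simp add: borel_measurable_if_D measurable_completion)
  then have "g measurable_on UNIV" by (simp add: measurable_on_iff_borel_measurable)
  then obtain N h where N: "negligible N" and hc: "\<And>n. continuous_on UNIV (h n)"
    and hl: "\<And>x. x \<notin> N \<Longrightarrow> (\<lambda>n::nat. h n x) \<longlonglongrightarrow> g x"
    unfolding measurable_on_def by auto
  have nz: "max 1 (norm y) \<noteq> 0" for y :: 'b using max.cobounded1[of 1 "norm y"] by linarith
  \<comment> \<open>Clip the continuous approximants to the unit ball.\<close>
  define h' where "h' n x = h n x /\<^sub>R max 1 (norm (h n x))" for n x
  have h'c: "continuous_on UNIV (h' n)" for n
    unfolding h'_def[abs_def] by (intro continuous_on_scaleR continuous_on_inverse continuous_on_max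
        continuous_on_const continuous_on_norm hc) (simp add: nz)
  have h'1: "norm (h' n x) \<le> 1" for n x
  proof -
    have "norm (h' n x) = norm (h n x) / max 1 (norm (h n x))"
      by (simp add: h'_def divide_inverse mult.commute max_def)
    also have "\<dots> \<le> 1" by (subst divide_le_eq_1_pos) auto
    finally show ?thesis .
  qed
  have h'l: "(\<lambda>n. h' n x) \<longlonglongrightarrow> g x" if "x \<notin> N" for x
  proof -
    have "(\<lambda>n. h' n x) \<longlonglongrightarrow> g x /\<^sub>R max 1 (norm (g x))"
      unfolding h'_def by (intro tendsto_scaleR tendsto_inverse tendsto_max tendsto_const tendsto_norm hl that nz)
    then show ?thesis using g1[of x] by (simp add: max_def split: if_splits)
  qed
  have "\<exists>p. polynomial_function p \<and> (\<forall>x\<in>cball 0 (real n + 1). norm (h' n x - p x) < 1 / (real n + 1))" for n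
    using continuous_on_subset[OF h'c]
    by (intro Stone_Weierstrass_polynomial_function) auto
  then obtain p where pp: "\<And>n. polynomial_function (p n)"
    and pa: "\<And>n x. norm x \<le> real n + 1 \<Longrightarrow> norm (h' n x - p n x) < 1 / (real n + 1)"
    by (metis mem_cball_0)
  \<comment> \<open>The factor \<open>1 + 1 / (n + 1)\<close> compensates the error of the polynomial approximation.\<close>
  define \<psi> where "\<psi> n x = (bump (0 + (1 / (real n + 1)) *\<^sub>R x) / (1 + 1 / (real n + 1))) *\<^sub>R p n x" for n x
  have t: "test_fun (\<psi> n)" for n
  proof (rule test_funI[where K="ball 0 (real n + 1)"])
    have "smooth (\<lambda>x. (inverse (1 + 1 / (real n + 1)) * bump (0 + (1 / (real n + 1)) *\<^sub>R x)) *\<^sub>R p n x)"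
      by (intro smooth_scaleR smooth_mult smooth_const smooth_compose_affine smooth_bump
          smooth_polynomial_function pp)
    then show "smooth (\<psi> n)" by (simp add: \<psi>_def[abs_def] divide_inverse mult.commute)
    show "x \<in> ball 0 (real n + 1)" if "\<psi> n x \<noteq> 0" for x
      using that bump_nz_iff[of "0 + (1 / (real n + 1)) *\<^sub>R x"] by (auto simp: \<psi>_def divide_simps)
  qed simp
  have b: "norm (\<psi> n x) \<le> 1" for n x
  proof (cases "bump (0 + (1 / (real n + 1)) *\<^sub>R x) = 0")
    case False
    then have "norm x \<le> real n + 1"
      using bump_nz_iff[of "0 + (1 / (real n + 1)) *\<^sub>R x"] by (auto simp: divide_simps)
    from pa[OF this] have p: "norm (p n x) \<le> 1 + 1 / (real n + 1)"
      using h'1[of n x] norm_triangle_ineq2[of "p n x" "h' n x"] by (simp add: norm_minus_commute)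
    have "norm (\<psi> n x) = bump (0 + (1 / (real n + 1)) *\<^sub>R x) * (norm (p n x) / (1 + 1 / (real n + 1)))"
      using bump_nonneg[of "0 + (1 / (real n + 1)) *\<^sub>R x"] by (simp add: \<psi>_def)
    also have "\<dots> \<le> 1 * 1"
    proof (intro mult_mono bump_le_1)
      show "norm (p n x) / (1 + 1 / (real n + 1)) \<le> 1"
        using p by (subst divide_le_eq_1_pos) (auto intro: add_pos_nonneg)
    qed auto
    finally show ?thesis by simp
  qed (simp add: \<psi>_def)
  have l: "(\<lambda>n. \<psi> n x) \<longlonglongrightarrow> g x" if "x \<notin> N" for x
  proof -
    have i: "(\<lambda>n. 1 / (real n + 1)) \<longlonglongrightarrow> 0"
      using LIMSEQ_inverse_real_of_nat by (simp add: divide_inverse add.commute)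
    have "(\<lambda>n. p n x) \<longlonglongrightarrow> g x"
    proof (rule Lim_transform[OF h'l[OF that]])
      have "\<forall>\<^sub>F n in sequentially. norm (p n x - h' n x) \<le> 1 / (real n + 1)"
      proof -
        have "\<forall>\<^sub>F n in sequentially. norm x \<le> real n + 1"
          by (rule eventually_sequentiallyI[of "nat \<lceil>norm x\<rceil>"]) linarith
        then show ?thesis by (rule eventually_mono) (use pa in \<open>simp add: norm_minus_commute less_imp_le\<close>)
      qed
      then show "(\<lambda>n. p n x - h' n x) \<longlonglongrightarrow> 0"
        by (rule tendsto_norm_zero_cancel[OF tendsto_sandwich[OF _ _ tendsto_const i], rotated]) auto
    qed
    moreover have "(\<lambda>n. bump (0 + (1 / (real n + 1)) *\<^sub>R x)) \<longlonglongrightarrow> bump (0 + 0 *\<^sub>R x)"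
      by (intro isCont_tendsto_compose[of _ bump] tendsto_intros i)
        (use smooth_continuous[OF smooth_bump, of UNIV] in \<open>auto simp: continuous_on_eq_continuous_at\<close>)
    ultimately have "(\<lambda>n. \<psi> n x) \<longlonglongrightarrow> (bump (0 + 0 *\<^sub>R x) / (1 + 0)) *\<^sub>R g x"
      unfolding \<psi>_def
      by (intro tendsto_scaleR tendsto_divide tendsto_add tendsto_const i) auto
    then show ?thesis by (simp add: bump_0)
  qed
  have "AE x in lborel. (\<lambda>n. \<psi> n x) \<longlonglongrightarrow> g x"
  proof -
    have "AE x in lebesgue. x \<notin> N"
      using N unfolding negligible_iff_null_sets by (rule AE_not_in)
    then have "AE x in lborel. x \<notin> N" by (simp add: AE_completion_iff)
    then show ?thesis by (rule AE_mp) (use l in auto)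
  qed
  with t b show ?thesis by (rule that)
qed

section \<open>Calculus of test functions\<close>

lemma test_fun_smooth: "test_fun f \<Longrightarrow> smooth f" by (simp add: test_fun_def)

lemma test_fun_support:
  assumes "test_fun f"
  obtains K where "compact K" "\<And>x. x \<notin> K \<Longrightarrow> f x = 0"
proof (rule that)
  show "compact (closure {x. f x \<noteq> 0})" using assms by (simp add: test_fun_def)
  show "\<And>x. x \<notin> closure {x. f x \<noteq> 0} \<Longrightarrow> f x = 0"
    using closure_subset[of "{x. f x \<noteq> 0}"] by (metis (mono_tags) mem_Collect_eq subsetD)
qed

lemma test_fun_subset:
  assumes "test_fun f" "smooth g" "\<And>x. f x = 0 \<Longrightarrow> g x = 0" shows "test_fun g"
proof -
  obtain K where "compact K" "\<And>x. x \<notin> K \<Longrightarrow> f x = 0" by (rule test_fun_support[OF assms(1)]) blast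
  then show ?thesis using assms by (intro test_funI[of g K]) (auto intro: compact_imp_bounded)
qed

lemma test_fun_continuous: "test_fun f \<Longrightarrow> continuous_on S f"
  by (simp add: smooth_continuous test_fun_smooth)

lemma test_fun_borel: "test_fun f \<Longrightarrow> f \<in> borel_measurable borel"
  by (simp add: borel_measurable_continuous_onI test_fun_continuous)

lemma compact_support_bounded:
  fixes f :: "'a::euclidean_space \<Rightarrow> 'b::euclidean_space"
  assumes "continuous_on UNIV f" "compact K" "\<And>x. x \<notin> K \<Longrightarrow> f x = 0"
  obtains B where "B \<ge> 0" "\<And>x. norm (f x) \<le> B"
proof -
  have "bounded (f ` K)"
    using assms by (intro compact_imp_bounded compact_continuous_image) (auto intro: continuous_on_subset)
  then obtain B where B: "B > 0" "\<And>x. x \<in> K \<Longrightarrow> norm (f x) \<le> B"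
    unfolding bounded_pos by auto
  have "norm (f x) \<le> B" for x
    using assms(3) B by (cases "x \<in> K") (auto intro: less_imp_le)
  with B that show thesis by (meson less_imp_le)
qed

lemma test_fun_bounded:
  assumes "test_fun f"
  obtains B where "B \<ge> 0" "\<And>x. norm (f x) \<le> B"
proof -
  obtain K where K: "compact K" "\<And>x. x \<notin> K \<Longrightarrow> f x = 0" by (rule test_fun_support[OF assms]) blast
  show thesis
    by (rule compact_support_bounded[OF test_fun_continuous[OF assms] K]) (use that in blast)+
qed

lemma compact_support_integrable:
  fixes f :: "'a::euclidean_space \<Rightarrow> 'b::euclidean_space"
  assumes "continuous_on UNIV f" "compact K" "\<And>x. x \<notin> K \<Longrightarrow> f x = 0"
  shows "integrable lborel f"
proof -
  have "integrable lborel (\<lambda>x. indicator K x *\<^sub>R f x)"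
    using assms by (intro borel_integrable_compact) (auto intro: continuous_on_subset)
  moreover have "(\<lambda>x. indicator K x *\<^sub>R f x) = f" using assms(3) by (auto simp: indicator_def)
  ultimately show ?thesis by simp
qed

lemma test_fun_integrable: "test_fun f \<Longrightarrow> integrable lborel f"
  by (rule test_fun_support, assumption)
    (rule compact_support_integrable[OF test_fun_continuous], blast+)

lemma test_fun_deriv:
  assumes "test_fun f"
  shows "test_fun (\<lambda>x. frechet_derivative f (at x) h)"
proof -
  obtain K where K: "compact K" "\<And>x. x \<notin> K \<Longrightarrow> f x = 0" by (rule test_fun_support[OF assms(1)]) blast
  have "frechet_derivative f (at x) h = 0" if "x \<notin> K" for x
  proof -
    have "(f has_derivative (\<lambda>h. 0)) (at x)"
      by (rule has_derivative_transform_within_open[OF has_derivative_const, of "- K"])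
        (use K that in \<open>auto intro: compact_imp_closed\<close>)
    from frechet_derivative_at[OF this] show ?thesis by metis
  qed
  then show ?thesis
    using assms K by (intro test_funI[of _ K])
      (auto intro: smooth_frechet_derivative test_fun_smooth compact_imp_bounded)
qed

lemma test_fun_deriv_at: "test_fun f \<Longrightarrow> (f has_derivative frechet_derivative f (at x)) (at x)"
  by (simp add: smooth_deriv test_fun_smooth)

lemma test_fun_scaleR: "test_fun f \<Longrightarrow> test_fun (\<lambda>x. c *\<^sub>R f x)"
  by (rule test_fun_subset, assumption) (auto intro: smooth_scaleR test_fun_smooth)

lemma test_fun_minus: "test_fun f \<Longrightarrow> test_fun (\<lambda>x. - f x)"
  using test_fun_scaleR[of f "-1"] by simp

lemma test_fun_add:
  assumes "test_fun f" "test_fun g" shows "test_fun (\<lambda>x. f x + g x)"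
proof -
  obtain K where K: "compact K" "\<And>x. x \<notin> K \<Longrightarrow> f x = 0" by (rule test_fun_support[OF assms(1)]) blast
  obtain L where L: "compact L" "\<And>x. x \<notin> L \<Longrightarrow> g x = 0" by (rule test_fun_support[OF assms(2)]) blast
  show ?thesis
  proof (rule test_funI[of _ "K \<union> L"])
    show "smooth (\<lambda>x. f x + g x)" by (intro smooth_add test_fun_smooth assms)
    show "x \<in> K \<union> L" if "f x + g x \<noteq> 0" for x
    proof (rule ccontr)
      assume "x \<notin> K \<union> L"
      then have "f x = 0" "g x = 0" using K(2) L(2) by auto
      then show False using that by simp
    qed
    show "bounded (K \<union> L)" using K(1) L(1) by (simp add: compact_imp_bounded)
  qed
qed

lemma test_fun_scaleR_const:
  "test_fun \<rho> \<Longrightarrow> test_fun (\<lambda>x. \<rho> x *\<^sub>R (h::'b::euclidean_space))"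
  by (rule test_fun_subset, assumption) (auto intro: smooth_scaleR test_fun_smooth)

lemma test_fun_inner_const: "test_fun f \<Longrightarrow> test_fun (\<lambda>x. f x \<bullet> b)"
  by (rule test_fun_subset, assumption) (auto intro: smooth_inner test_fun_smooth)

lemma test_fun_affine:
  assumes "test_fun f" "c \<noteq> 0" shows "test_fun (\<lambda>x. f (a + c *\<^sub>R x))"
proof -
  obtain K where K: "compact K" "\<And>x. x \<notin> K \<Longrightarrow> f x = 0" by (rule test_fun_support[OF assms(1)]) blast
  have "x \<in> (\<lambda>y. (1/c) *\<^sub>R (y - a)) ` K" if "f (a + c *\<^sub>R x) \<noteq> 0" for x
  proof (rule image_eqI[of _ _ "a + c *\<^sub>R x"])
    show "x = (1/c) *\<^sub>R (a + c *\<^sub>R x - a)" using assms by simp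
  qed (use K that in blast)
  moreover have "compact ((\<lambda>y. (1/c) *\<^sub>R (y - a)) ` K)"
    by (intro compact_continuous_image continuous_intros K)
  ultimately show ?thesis
    using assms by (intro test_funI[of _ "(\<lambda>y. (1/c) *\<^sub>R (y - a)) ` K"])
      (auto intro: smooth_compose_affine test_fun_smooth compact_imp_bounded)
qed

lemma test_fun_shift: "test_fun f \<Longrightarrow> test_fun (\<lambda>x. f (x + a))"
  and test_fun_reflect: "test_fun f \<Longrightarrow> test_fun (\<lambda>x. f (a - x))"
  using test_fun_affine[of f 1 a] test_fun_affine[of f "-1" a] by (simp_all add: add.commute)

lemma test_fun_0: "test_fun (\<lambda>x. 0)"
  by (rule test_funI[of _ "{}"]) auto

lemma test_fun_deriv_bound:
  fixes f :: "'a::euclidean_space \<Rightarrow> 'b::euclidean_space"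
  assumes "test_fun f"
  obtains M where "M \<ge> 0" "\<And>z h. norm (frechet_derivative f (at z) h) \<le> M * norm h"
    "\<And>x y. norm (f x - f y) \<le> M * norm (x - y)"
proof -
  have "\<exists>B\<ge>0. \<forall>x. norm (frechet_derivative f (at x) b) \<le> B" for b
    by (rule test_fun_bounded[OF test_fun_deriv[OF assms, of b]]) auto
  then obtain B where B: "\<And>b. B b \<ge> 0" "\<And>b x. norm (frechet_derivative f (at x) b) \<le> B b" by metis
  define M where "M = (\<Sum>b\<in>Basis. B b)"
  have M0: "M \<ge> 0" by (simp add: M_def B sum_nonneg)
  have M: "norm (frechet_derivative f (at z) h) \<le> M * norm h" for z h
  proof -
    interpret linear "frechet_derivative f (at z)"
      using has_derivative_linear[OF test_fun_deriv_at[OF assms]] .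
    have "frechet_derivative f (at z) h = (\<Sum>b\<in>Basis. (h \<bullet> b) *\<^sub>R frechet_derivative f (at z) b)"
      by (subst (1) euclidean_representation[of h, symmetric]) (simp only: sum scale)
    also have "norm \<dots> \<le> (\<Sum>b\<in>Basis. norm h * B b)"
      by (rule sum_norm_le) (auto intro!: mult_mono B Basis_le_norm)
    finally show ?thesis by (simp add: M_def sum_distrib_left mult.commute)
  qed
  have "norm (f x - f y) \<le> M * norm (x - y)" for x y
    by (rule differentiable_bound[of UNIV f "\<lambda>x. frechet_derivative f (at x)"])
      (auto intro!: onorm_le M test_fun_deriv_at[OF assms])
  with M0 M show thesis by (rule that)
qed

subsection \<open>Integration by parts\<close>

lemma lborel_integral_shift:
  fixes f :: "'a::euclidean_space \<Rightarrow> 'b::euclidean_space"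
  assumes [measurable]: "f \<in> borel_measurable borel"
  shows "(\<integral>x. f (x + a) \<partial>lborel) = (\<integral>x. f x \<partial>lborel)"
proof -
  have "(\<integral>x. f x \<partial>lborel) = (\<integral>x. f x \<partial>distr lborel borel ((+) a))" by (simp add: lborel_distr_plus)
  also have "\<dots> = (\<integral>x. f (a + x) \<partial>lborel)" by (rule integral_distr) auto
  finally show ?thesis by (simp add: add.commute)
qed

lemma lborel_integrable_shift:
  fixes f :: "'a::euclidean_space \<Rightarrow> 'b::euclidean_space"
  assumes "integrable lborel f"
  shows "integrable lborel (\<lambda>x. f (x + a))"
proof -
  have "integrable (distr lborel borel ((+) a)) f" using assms by (simp add: lborel_distr_plus)
  then have "integrable lborel (\<lambda>x. f (a + x))" by (rule integrable_distr[rotated]) auto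
  then show ?thesis by (simp add: add.commute)
qed

lemma lborel_distr_reflect: "distr lborel borel (\<lambda>x. a - x) = (lborel :: 'a::euclidean_space measure)"
proof -
  have "lborel = density (distr lborel borel (\<lambda>x::'a. a + (-1) *\<^sub>R x)) (\<lambda>_. ennreal (\<bar>-1\<bar> ^ DIM('a)))"
    by (rule lborel_affine) simp
  then show ?thesis by (simp add: density_1)
qed

lemma lborel_integral_reflect:
  fixes f :: "'a::euclidean_space \<Rightarrow> 'b::euclidean_space"
  assumes [measurable]: "f \<in> borel_measurable borel"
  shows "(\<integral>x. f (a - x) \<partial>lborel) = (\<integral>x. f x \<partial>lborel)"
proof -
  have "(\<integral>x. f x \<partial>lborel) = (\<integral>x. f x \<partial>distr lborel borel (\<lambda>x. a - x))"
    by (simp add: lborel_distr_reflect)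
  also have "\<dots> = (\<integral>x. f (a - x) \<partial>lborel)" by (rule integral_distr) auto
  finally show ?thesis by simp
qed

text \<open>The integral of the difference quotients vanishes by translation invariance of Lebesgue measure;
pass to the limit by dominated convergence.\<close>

lemma integral_directional_derivative_eq_0:
  fixes g :: "'a::euclidean_space \<Rightarrow> real"
  assumes d: "\<And>x. (g has_derivative g' x) (at x)"
    and c: "continuous_on UNIV (\<lambda>x. g' x b)"
    and K: "compact K" "\<And>x. x \<notin> K \<Longrightarrow> g x = 0"
  shows "(\<integral>x. g' x b \<partial>lborel) = 0"
proof -
  have g'0: "g' x b = 0" if "x \<notin> K" for x
  proof -
    have "(g has_derivative (\<lambda>h. 0)) (at x)"
      by (rule has_derivative_transform_within_open[OF has_derivative_const, of "- K"])
        (use K that in \<open>auto intro: compact_imp_closed\<close>)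
    then have "g' x = (\<lambda>h. 0)" using d has_derivative_unique by blast
    then show ?thesis by simp
  qed
  obtain M where M: "M \<ge> 0" "\<And>x. norm (g' x b) \<le> M"
    by (rule compact_support_bounded[OF c K(1) g'0]) blast+
  have gc: "continuous_on UNIV g"
    using d by (meson continuous_at_imp_continuous_on has_derivative_continuous)
  have gi: "integrable lborel g" by (rule compact_support_integrable[OF gc K])
  have [measurable]: "g \<in> borel_measurable borel" using gc by (rule borel_measurable_continuous_onI)
  have g'm[measurable]: "(\<lambda>x. g' x b) \<in> borel_measurable borel" using c by (rule borel_measurable_continuous_onI)
  define D where "D n x = (g (x + (1 / real (Suc n)) *\<^sub>R b) - g x) * real (Suc n)" for n x
  have line: "((\<lambda>s. g (x + s *\<^sub>R b)) has_real_derivative g' (x + s *\<^sub>R b) b) (at s)" for x s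
  proof -
    have "((\<lambda>s. g (x + s *\<^sub>R b)) has_derivative (\<lambda>h. g' (x + s *\<^sub>R b) (h *\<^sub>R b))) (at s)"
      by (rule has_derivative_compose[OF _ d]) (auto intro!: derivative_eq_intros)
    moreover have "linear (g' (x + s *\<^sub>R b))" using d by (rule has_derivative_linear)
    then have "(\<lambda>h. g' (x + s *\<^sub>R b) (h *\<^sub>R b)) = (*) (g' (x + s *\<^sub>R b) b)"
      by (auto simp: linear_scale)
    ultimately show ?thesis unfolding has_field_derivative_def by simp
  qed
  have lim: "(\<lambda>n. D n x) \<longlonglongrightarrow> g' x b" for x
  proof -
    have "((\<lambda>h. (g (x + h *\<^sub>R b) - g x) / h) \<longlongrightarrow> g' x b) (at 0)"
      using line[of x 0] by (simp add: DERIV_def)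
    moreover have "filterlim (\<lambda>n. 1 / real (Suc n)) (at 0) sequentially"
      using LIMSEQ_inverse_real_of_nat by (intro filterlim_atI) (auto simp: inverse_eq_divide)
    ultimately have "(\<lambda>n. (g (x + (1 / real (Suc n)) *\<^sub>R b) - g x) / (1 / real (Suc n))) \<longlonglongrightarrow> g' x b"
      by (rule filterlim_compose)
    then show ?thesis by (simp add: D_def)
  qed
  define K' where "K' = {x + y |x y. x \<in> K \<and> y \<in> cball 0 (norm b)}"
  have K': "compact K'" unfolding K'_def by (intro compact_sums K compact_cball)
  have bound: "norm (D n x) \<le> indicator K' x * M" for n x
  proof (cases "x \<in> K'")
    case True
    have "\<exists>z>0. z < 1 / real (Suc n) \<and> g (x + (1 / real (Suc n)) *\<^sub>R b) - g (x + 0 *\<^sub>R b)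
       = (1 / real (Suc n) - 0) * g' (x + z *\<^sub>R b) b"
      by (rule MVT2) (auto intro: line)
    then obtain z where "g (x + (1 / real (Suc n)) *\<^sub>R b) - g x = (1 / real (Suc n)) * g' (x + z *\<^sub>R b) b"
      by auto
    then have "D n x = g' (x + z *\<^sub>R b) b" by (simp add: D_def)
    then show ?thesis using M True by simp
  next
    case False
    have "x \<notin> K" using False unfolding K'_def by (force intro: exI[of _ x] exI[of _ 0])
    moreover have "x + (1 / real (Suc n)) *\<^sub>R b \<notin> K"
    proof
      assume "x + (1 / real (Suc n)) *\<^sub>R b \<in> K"
      moreover have "norm (- ((1 / real (Suc n)) *\<^sub>R b)) \<le> norm b"
        by (simp add: mult_left_le_one_le field_simps)
      ultimately have "(x + (1 / real (Suc n)) *\<^sub>R b) + - ((1 / real (Suc n)) *\<^sub>R b) \<in> K'"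
        unfolding K'_def mem_cball_0 by blast
      then show False using False by simp
    qed
    ultimately show ?thesis using False K by (simp add: D_def)
  qed
  have "(\<lambda>n. \<integral>x. D n x \<partial>lborel) \<longlonglongrightarrow> (\<integral>x. g' x b \<partial>lborel)"
  proof (rule integral_dominated_convergence[where w="\<lambda>x. indicator K' x * M"])
    show "integrable lborel (\<lambda>x. indicator K' x * M)"
      using borel_integrable_compact[OF K', of "\<lambda>x. M"] by simp
  qed (use lim bound in \<open>auto simp: D_def[abs_def]\<close>)
  moreover have "(\<integral>x. D n x \<partial>lborel) = 0" for n
    using gi lborel_integral_shift[of g] lborel_integrable_shift[OF gi] by (simp add: D_def)
  ultimately show ?thesis by (simp add: LIMSEQ_const_iff)
qed

lemma divergence_alt:
  "divergence \<phi> = (\<lambda>x. \<Sum>b\<in>Basis. frechet_derivative \<phi> (at x) b \<bullet> b)"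
  by (simp add: divergence_def[abs_def])

lemma test_fun_sum:
  "finite I \<Longrightarrow> (\<And>i. i \<in> I \<Longrightarrow> test_fun (f i)) \<Longrightarrow> test_fun (\<lambda>x. \<Sum>i\<in>I. f i x)"
  by (induction I rule: finite_induct) (auto intro: test_fun_add test_fun_0)

lemma test_fun_divergence: "test_fun \<phi> \<Longrightarrow> test_fun (divergence \<phi>)"
  unfolding divergence_alt by (intro test_fun_sum test_fun_inner_const test_fun_deriv) auto

lemma integral_by_parts:
  fixes f :: "'a::euclidean_space \<Rightarrow> real" and \<phi> :: "'a \<Rightarrow> 'a"
  assumes d: "\<And>x. (f has_derivative f' x) (at x)"
    and c: "\<And>b. continuous_on UNIV (\<lambda>x. f' x b)"
    and t: "test_fun \<phi>"
  shows "(\<integral>x. f x * divergence \<phi> x \<partial>lborel) = - (\<integral>x. f' x (\<phi> x) \<partial>lborel)"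
proof -
  obtain K where K: "compact K" "\<And>x. x \<notin> K \<Longrightarrow> \<phi> x = 0" by (rule test_fun_support[OF t]) blast
  obtain L where L: "compact L" "\<And>b x. x \<notin> L \<Longrightarrow> frechet_derivative \<phi> (at x) b = 0"
  proof -
    have "frechet_derivative \<phi> (at x) b = 0" if "x \<notin> K" for x b
    proof -
      have "(\<phi> has_derivative (\<lambda>h. 0)) (at x)"
        by (rule has_derivative_transform_within_open[OF has_derivative_const, of "- K"])
          (use K that in \<open>auto intro: compact_imp_closed\<close>)
      from frechet_derivative_at[OF this] show ?thesis by metis
    qed
    with K that show thesis by blast
  qed
  have fc: "continuous_on UNIV f"
    using d by (meson continuous_at_imp_continuous_on has_derivative_continuous)
  have p: "((\<lambda>x. f x * (\<phi> x \<bullet> b)) has_derivative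
      (\<lambda>h. f x * (frechet_derivative \<phi> (at x) h \<bullet> b) + f' x h * (\<phi> x \<bullet> b))) (at x)" for x b
    by (intro has_derivative_mult d has_derivative_inner_left test_fun_deriv_at t)
  have c1: "continuous_on UNIV (\<lambda>x. f x * (frechet_derivative \<phi> (at x) b \<bullet> b))" for b
    by (intro continuous_intros fc test_fun_continuous test_fun_deriv t)
  have c2: "continuous_on UNIV (\<lambda>x. f' x b * (\<phi> x \<bullet> b))" for b
    by (intro continuous_intros c test_fun_continuous t)
  have i1: "integrable lborel (\<lambda>x. f x * (frechet_derivative \<phi> (at x) b \<bullet> b))" for b
    by (rule compact_support_integrable[OF c1 L(1)]) (simp add: L)
  have i2: "integrable lborel (\<lambda>x. f' x b * (\<phi> x \<bullet> b))" for b
    by (rule compact_support_integrable[OF c2 K(1)]) (simp add: K)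
  have z: "(\<integral>x. f x * (frechet_derivative \<phi> (at x) b \<bullet> b) \<partial>lborel) = - (\<integral>x. f' x b * (\<phi> x \<bullet> b) \<partial>lborel)" for b
  proof -
    have "(\<integral>x. (f x * (frechet_derivative \<phi> (at x) b \<bullet> b) + f' x b * (\<phi> x \<bullet> b)) \<partial>lborel) = 0"
      by (rule integral_directional_derivative_eq_0[OF p, where K=K])
         (use c1 c2 K in \<open>auto intro: continuous_on_add\<close>)
    then show ?thesis using i1[of b] i2[of b] by simp
  qed
  have "f' x (\<phi> x) = (\<Sum>b\<in>Basis. f' x b * (\<phi> x \<bullet> b))" for x
  proof -
    interpret linear "f' x" using has_derivative_linear[OF d] .
    show ?thesis
      by (subst (1) euclidean_representation[of "\<phi> x", symmetric]) (simp only: sum scale real_scaleR_def mult.commute)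
  qed
  then show ?thesis
    using i1 i2 z by (simp add: divergence_def sum_distrib_left sum_negf)
qed

lemma integral_divergence_eq_0: "test_fun \<phi> \<Longrightarrow> (\<integral>x. divergence \<phi> x \<partial>lborel) = 0"
  using integral_by_parts[of "\<lambda>_. 1" "\<lambda>_ _. 0" \<phi>] by simp

section \<open>Distributional gradients and total variation\<close>

text \<open>The distributional gradient is defined with \<open>lebesgue\<close>; for Borel functions \<open>lborel\<close> gives the same values and
supports Fubini's theorem.\<close>

lemma dist_grad_lborel:
  assumes [measurable]: "v \<in> borel_measurable borel" and "test_fun \<phi>"
  shows "dist_grad v \<phi> = - (\<integral>x. v x * divergence \<phi> x \<partial>lborel)"
proof -
  have [measurable]: "divergence \<phi> \<in> borel_measurable borel"
    by (intro test_fun_borel test_fun_divergence assms)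
  show ?thesis unfolding dist_grad_def by (subst integral_completion) auto
qed

lemma dist_grad_cong_AE:
  assumes "AE x in lebesgue. v x = w x" and [measurable]: "v \<in> borel_measurable lebesgue" "w \<in> borel_measurable lebesgue"
    and "test_fun \<phi>"
  shows "dist_grad v \<phi> = dist_grad w \<phi>"
proof -
  have [measurable]: "divergence \<phi> \<in> borel_measurable lebesgue"
    by (intro measurable_completion) (simp add: test_fun_borel test_fun_divergence assms)
  have "(LINT x|lebesgue. v x * divergence \<phi> x) = (LINT x|lebesgue. w x * divergence \<phi> x)"
    by (rule integral_cong_AE) (use assms(1) in \<open>auto elim!: eventually_mono\<close>)
  then show ?thesis by (simp add: dist_grad_def)
qed

lemma TV_leI:
  assumes "\<And>\<phi>. test_fun \<phi> \<Longrightarrow> (\<And>x. norm (\<phi> x) \<le> 1) \<Longrightarrow> ereal (dist_grad v \<phi>) \<le> T"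
  shows "TV v \<le> T"
  unfolding TV_def total_mass_def by (rule SUP_least) (auto simp: test_fields_iff intro!: assms)

lemma dist_grad_le_TV:
  assumes "test_fun \<phi>" "\<And>x. norm (\<phi> x) \<le> 1" shows "ereal (dist_grad v \<phi>) \<le> TV v"
  unfolding TV_def total_mass_def by (rule SUP_upper) (use assms in \<open>auto simp: test_fields_iff\<close>)

lemma TV_cong_AE:
  assumes "AE x in lebesgue. v x = w x" "v \<in> borel_measurable lebesgue" "w \<in> borel_measurable lebesgue"
  shows "TV v = TV w"
proof (rule antisym)
  show "TV v \<le> TV w"
    by (rule TV_leI) (use dist_grad_cong_AE[OF assms] dist_grad_le_TV[of _ w] in auto)
  show "TV w \<le> TV v"
    by (rule TV_leI) (use dist_grad_cong_AE[OF assms, symmetric] dist_grad_le_TV[of _ v] in auto)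
qed

lemma divergence_scaleR:
  "test_fun \<phi> \<Longrightarrow> divergence (\<lambda>x. c *\<^sub>R \<phi> x) x = c * divergence \<phi> x"
proof -
  assume t: "test_fun \<phi>"
  have "((\<lambda>x. c *\<^sub>R \<phi> x) has_derivative (\<lambda>h. c *\<^sub>R frechet_derivative \<phi> (at x) h)) (at x)"
    by (intro derivative_intros test_fun_deriv_at t)
  from frechet_derivative_at[OF this, symmetric] show ?thesis
    by (simp add: divergence_def sum_distrib_left)
qed

lemma divergence_add:
  assumes "test_fun \<phi>" "test_fun \<psi>"
  shows "divergence (\<lambda>x. \<phi> x + \<psi> x) x = divergence \<phi> x + divergence \<psi> x"
proof -
  have "((\<lambda>x. \<phi> x + \<psi> x) has_derivative
      (\<lambda>h. frechet_derivative \<phi> (at x) h + frechet_derivative \<psi> (at x) h)) (at x)"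
    by (intro derivative_intros test_fun_deriv_at assms)
  from frechet_derivative_at[OF this, symmetric] show ?thesis
    by (simp add: divergence_def inner_add_left sum.distrib)
qed

lemma divergence_shift:
  assumes "test_fun \<phi>" shows "divergence (\<lambda>x. \<phi> (x + a)) x = divergence \<phi> (x + a)"
proof -
  have "((\<lambda>x. \<phi> (x + a)) has_derivative frechet_derivative \<phi> (at (x + a))) (at x)"
    by (rule has_derivative_compose[OF _ test_fun_deriv_at[OF assms]])
      (auto intro!: derivative_eq_intros)
  from frechet_derivative_at[OF this, symmetric] show ?thesis by (simp add: divergence_def)
qed

lemma dist_grad_scaleR: "test_fun \<phi> \<Longrightarrow> dist_grad v (\<lambda>x. c *\<^sub>R \<phi> x) = c * dist_grad v \<phi>"
  by (simp add: dist_grad_def divergence_scaleR mult.left_commute)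

lemma dist_grad_minus: "test_fun \<phi> \<Longrightarrow> dist_grad v (\<lambda>x. - \<phi> x) = - dist_grad v \<phi>"
  using dist_grad_scaleR[of \<phi> v "-1"] by simp

lemma dist_grad_0: "dist_grad v (\<lambda>x. 0) = 0"
  using dist_grad_scaleR[OF test_fun_0, of v 0] by simp

lemma TV_nonneg: "TV v \<ge> 0"
  using dist_grad_le_TV[OF test_fun_0, of v] by (simp add: dist_grad_0 zero_ereal_def)

lemma dist_grad_bound:
  assumes TV: "TV v \<le> ereal T" and t: "test_fun \<phi>" and c: "c \<ge> 0" "\<And>x. norm (\<phi> x) \<le> c"
  shows "\<bar>dist_grad v \<phi>\<bar> \<le> c * T"
proof -
  have *: "dist_grad v \<psi> \<le> c * T" if "test_fun \<psi>" "\<And>x. norm (\<psi> x) \<le> c" for \<psi>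
  proof (cases "c = 0")
    case True
    then have "\<psi> = (\<lambda>x. 0)" using that by auto
    then show ?thesis using True by (simp add: dist_grad_0)
  next
    case False
    have "ereal (dist_grad v (\<lambda>x. (1/c) *\<^sub>R \<psi> x)) \<le> TV v"
      using that False c by (intro dist_grad_le_TV test_fun_scaleR) (auto simp: field_simps)
    also note TV
    finally have "(1/c) * dist_grad v \<psi> \<le> T" by (simp add: dist_grad_scaleR that)
    then show ?thesis using False c by (simp add: field_simps)
  qed
  from *[of \<phi>] *[of "\<lambda>x. - \<phi> x"] show ?thesis
    using t c by (auto simp: dist_grad_minus test_fun_minus)
qed

lemma integrable_mult_bounded:
  fixes v \<psi> :: "'a::euclidean_space \<Rightarrow> real"
  assumes "integrable M v" "\<psi> \<in> borel_measurable M" "\<And>x. \<bar>\<psi> x\<bar> \<le> B"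
  shows "integrable M (\<lambda>x. v x * \<psi> x)"
proof (rule Bochner_Integration.integrable_bound[where f="\<lambda>x. B * v x"])
  show "AE x in M. norm (v x * \<psi> x) \<le> norm (B * v x)"
  proof (rule AE_I2)
    fix x
    have "\<bar>v x\<bar> * \<bar>\<psi> x\<bar> \<le> \<bar>v x\<bar> * \<bar>B\<bar>" using assms(3)[of x] by (intro mult_left_mono) auto
    then show "norm (v x * \<psi> x) \<le> norm (B * v x)" by (simp add: abs_mult mult.commute)
  qed
qed (use assms in auto)

lemma integrable_mult_test:
  fixes v \<psi> :: "'a::euclidean_space \<Rightarrow> real"
  assumes "integrable lborel v" "test_fun \<psi>"
  shows "integrable lborel (\<lambda>x. v x * \<psi> x)"
proof -
  obtain B where B: "B \<ge> 0" "\<And>x. norm (\<psi> x) \<le> B" by (rule test_fun_bounded[OF assms(2)]) blast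
  show ?thesis by (rule integrable_mult_bounded[of _ _ _ B]) (use assms B test_fun_borel in auto)
qed

lemma integrable_mult_test_leb:
  fixes v \<psi> :: "'a::euclidean_space \<Rightarrow> real"
  assumes "integrable lebesgue v" "test_fun \<psi>"
  shows "integrable lebesgue (\<lambda>x. v x * \<psi> x)"
proof -
  obtain B where B: "B \<ge> 0" "\<And>x. norm (\<psi> x) \<le> B" by (rule test_fun_bounded[OF assms(2)]) blast
  have "\<psi> \<in> borel_measurable lebesgue"
    by (intro measurable_completion) (simp add: test_fun_borel assms)
  then show ?thesis by (intro integrable_mult_bounded[of _ _ _ B]) (use assms B in auto)
qed

lemma dist_grad_add_field:
  assumes "integrable lebesgue v" "test_fun \<phi>" "test_fun \<psi>"
  shows "dist_grad v (\<lambda>x. \<phi> x + \<psi> x) = dist_grad v \<phi> + dist_grad v \<psi>"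
  using integrable_mult_test_leb[OF assms(1) test_fun_divergence[OF assms(2)]]
    integrable_mult_test_leb[OF assms(1) test_fun_divergence[OF assms(3)]]
  by (simp add: dist_grad_def divergence_add assms distrib_left)

lemma dist_grad_add:
  assumes "integrable lebesgue v" "integrable lebesgue w" "test_fun \<phi>"
  shows "dist_grad (\<lambda>x. v x + w x) \<phi> = dist_grad v \<phi> + dist_grad w \<phi>"
  using integrable_mult_test_leb[OF assms(1) test_fun_divergence[OF assms(3)]]
    integrable_mult_test_leb[OF assms(2) test_fun_divergence[OF assms(3)]]
  by (simp add: dist_grad_def assms distrib_right)

lemma dist_grad_cmult: "dist_grad (\<lambda>x. c * v x) \<phi> = c * dist_grad v \<phi>"
  by (simp add: dist_grad_def mult.assoc)

subsection \<open>Convolution with test functions\<close>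

text \<open>Convolution of a function with a kernel.\<close>

definition conv :: "('a::euclidean_space \<Rightarrow> real) \<Rightarrow> ('a \<Rightarrow> real) \<Rightarrow> 'a \<Rightarrow> real" where
  "conv v \<rho> x = (\<integral>y. v y * \<rho> (x - y) \<partial>lborel)"

lemma conv_integrable:
  fixes v \<rho> :: "'a::euclidean_space \<Rightarrow> real"
  assumes "integrable lborel v" "test_fun \<rho>"
  shows "integrable lborel (\<lambda>y. v y * \<rho> (x - y))"
  using integrable_mult_test[OF assms(1) test_fun_reflect[OF assms(2), of x]] .

lemma conv_has_derivative:
  fixes v \<rho> :: "'a::euclidean_space \<Rightarrow> real"
  assumes v: "integrable lborel v" and \<rho>: "test_fun \<rho>"
  shows "(conv v \<rho> has_derivative (\<lambda>h. conv v (\<lambda>z. frechet_derivative \<rho> (at z) h) x)) (at x)"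
proof -
  let ?D = "\<lambda>z. frechet_derivative \<rho> (at z)"
  obtain M where M: "M \<ge> 0" "\<And>z h. norm (?D z h) \<le> M * norm h"
    "\<And>x y. norm (\<rho> x - \<rho> y) \<le> M * norm (x - y)"
    by (rule test_fun_deriv_bound[OF \<rho>]) blast
  have lin: "linear (?D z)" for z by (rule has_derivative_linear[OF test_fun_deriv_at[OF \<rho>]])
  have i1: "integrable lborel (\<lambda>y. v y * \<rho> (z - y))" for z by (rule conv_integrable[OF v \<rho>])
  have i2: "integrable lborel (\<lambda>y. v y * ?D (z - y) h)" for z h
    by (rule conv_integrable[OF v test_fun_deriv[OF \<rho>]])
  have bl: "bounded_linear (\<lambda>h. conv v (\<lambda>z. ?D z h) x)"
  proof (rule bounded_linear_intro[where K="(\<integral>y. \<bar>v y\<bar> \<partial>lborel) * M"])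
    show "conv v (\<lambda>z. ?D z (g + h)) x = conv v (\<lambda>z. ?D z g) x + conv v (\<lambda>z. ?D z h) x" for g h
      using i2[of x] by (simp add: conv_def linear_add[OF lin] distrib_left)
    show "conv v (\<lambda>z. ?D z (c *\<^sub>R h)) x = c *\<^sub>R conv v (\<lambda>z. ?D z h) x" for c h
      by (simp add: conv_def linear_scale[OF lin] mult.left_commute)
    show "norm (conv v (\<lambda>z. ?D z h) x) \<le> norm h * ((\<integral>y. \<bar>v y\<bar> \<partial>lborel) * M)" for h
    proof -
      have "norm (conv v (\<lambda>z. ?D z h) x) \<le> (\<integral>y. \<bar>v y * ?D (x - y) h\<bar> \<partial>lborel)"
        unfolding conv_def real_norm_def by (rule integral_abs_bound)
      also have "\<dots> \<le> (\<integral>y. \<bar>v y\<bar> * (M * norm h) \<partial>lborel)"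
        using integrable_abs[OF i2[of x h]] v M(2)
        by (intro integral_mono) (auto simp: abs_mult intro!: mult_left_mono)
      finally show ?thesis by (simp add: mult_ac)
    qed
  qed
  have "((\<lambda>x'. norm (conv v \<rho> x' - conv v \<rho> x - conv v (\<lambda>z. ?D z (x' - x)) x) / norm (x' - x)) \<longlongrightarrow> 0) (at x)"
    unfolding tendsto_at_iff_sequentially comp_def
  proof (intro allI impI)
    fix X :: "nat \<Rightarrow> 'a" assume X: "\<forall>i. X i \<in> UNIV - {x}" and Xl: "X \<longlonglongrightarrow> x"
    define s where "s i y = v y * ((\<rho> (X i - y) - \<rho> (x - y) - ?D (x - y) (X i - x)) / norm (X i - x))" for i y
    have eq: "norm (conv v \<rho> (X i) - conv v \<rho> x - conv v (\<lambda>z. ?D z (X i - x)) x) / norm (X i - x)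
        = \<bar>\<integral>y. s i y \<partial>lborel\<bar>" for i
    proof -
      have "(\<integral>y. s i y \<partial>lborel) = (\<integral>y. (v y * \<rho> (X i - y) - v y * \<rho> (x - y) - v y * ?D (x - y) (X i - x)) / norm (X i - x) \<partial>lborel)"
        by (simp add: s_def algebra_simps)
      also have "\<dots> = (conv v \<rho> (X i) - conv v \<rho> x - conv v (\<lambda>z. ?D z (X i - x)) x) / norm (X i - x)"
        using i1 i2 by (simp add: conv_def)
      finally show ?thesis by simp
    qed
    have "(\<lambda>i. \<integral>y. s i y \<partial>lborel) \<longlonglongrightarrow> (\<integral>y. 0 \<partial>(lborel::'a measure))"
    proof (rule integral_dominated_convergence[where w="\<lambda>y. \<bar>v y\<bar> * (2 * M)"])
      show "AE y in lborel. (\<lambda>i. s i y) \<longlonglongrightarrow> 0"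
      proof (rule AE_I2)
        fix y
        have "((\<lambda>z. (\<rho> z - \<rho> (x - y) - ?D (x - y) (z - (x - y))) /\<^sub>R norm (z - (x - y))) \<longlongrightarrow> 0) (at (x - y))"
          using test_fun_deriv_at[OF \<rho>, of "x - y"] by (simp add: has_derivative_at_within)
        moreover have "filterlim (\<lambda>i. X i - y) (at (x - y)) sequentially"
          using X by (intro filterlim_atI tendsto_intros Xl) (auto intro!: always_eventually)
        ultimately have "(\<lambda>i. (\<rho> (X i - y) - \<rho> (x - y) - ?D (x - y) ((X i - y) - (x - y))) /\<^sub>R norm ((X i - y) - (x - y))) \<longlonglongrightarrow> 0"
          by (rule filterlim_compose)
        from tendsto_mult[OF tendsto_const[of "v y"] this] show "(\<lambda>i. s i y) \<longlonglongrightarrow> 0"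
          by (simp add: s_def divide_inverse mult.commute)
      qed
      show "AE y in lborel. norm (s i y) \<le> \<bar>v y\<bar> * (2 * M)" for i
      proof (rule AE_I2)
        fix y
        have "\<bar>\<rho> (X i - y) - \<rho> (x - y) - ?D (x - y) (X i - x)\<bar> \<le> 2 * M * norm (X i - x)"
          using M(2)[of "x - y" "X i - x"] M(3)[of "X i - y" "x - y"] by simp
        then have "\<bar>(\<rho> (X i - y) - \<rho> (x - y) - ?D (x - y) (X i - x)) / norm (X i - x)\<bar> \<le> 2 * M"
          using X by (simp add: field_simps)
        then show "norm (s i y) \<le> \<bar>v y\<bar> * (2 * M)"
          unfolding s_def real_norm_def abs_mult[of "v y"] by (intro mult_left_mono) auto
      qed
      have e: "s i = (\<lambda>y. (v y * \<rho> (X i - y) - v y * \<rho> (x - y) - v y * ?D (x - y) (X i - x)) / norm (X i - x))" for i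
        by (auto simp: s_def algebra_simps)
      show "s i \<in> borel_measurable lborel" for i
        unfolding e using i1 i2
        by (intro borel_measurable_divide borel_measurable_diff borel_measurable_integrable) auto
    qed (use v in auto)
    then show "(\<lambda>i. norm (conv v \<rho> (X i) - conv v \<rho> x - conv v (\<lambda>z. ?D z (X i - x)) x) / norm (X i - x)) \<longlonglongrightarrow> 0"
      unfolding eq by (simp add: tendsto_rabs_zero)
  qed
  with bl show ?thesis by (simp add: has_derivative_iff_norm)
qed

lemma conv_continuous:
  fixes v \<rho> :: "'a::euclidean_space \<Rightarrow> real"
  assumes v: "integrable lborel v" and \<rho>: "test_fun \<rho>"
  shows "continuous_on S (conv v \<rho>)"
  using conv_has_derivative[OF assms]
  by (meson continuous_at_imp_continuous_on has_derivative_continuous)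

lemma divergence_reflect_scaleR:
  fixes \<rho> :: "'a::euclidean_space \<Rightarrow> real"
  assumes "test_fun \<rho>"
  shows "divergence (\<lambda>y. \<rho> (x - y) *\<^sub>R h) y = - frechet_derivative \<rho> (at (x - y)) h"
proof -
  interpret linear "frechet_derivative \<rho> (at (x - y))"
    using has_derivative_linear[OF test_fun_deriv_at[OF assms]] .
  have "((\<lambda>y. \<rho> (x - y)) has_derivative (\<lambda>k. frechet_derivative \<rho> (at (x - y)) (- k))) (at y)"
    by (rule has_derivative_compose[OF _ test_fun_deriv_at[OF assms]])
      (auto intro!: derivative_eq_intros)
  then have "((\<lambda>y. \<rho> (x - y) *\<^sub>R h) has_derivative
      (\<lambda>k. frechet_derivative \<rho> (at (x - y)) (- k) *\<^sub>R h)) (at y)"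
    by (rule has_derivative_scaleR_left)
  from frechet_derivative_at[OF this, symmetric]
  have "divergence (\<lambda>y. \<rho> (x - y) *\<^sub>R h) y
      = - (\<Sum>b\<in>Basis. (h \<bullet> b) * frechet_derivative \<rho> (at (x - y)) b)"
    by (simp add: divergence_def neg sum_negf mult.commute)
  also have "(\<Sum>b\<in>Basis. (h \<bullet> b) * frechet_derivative \<rho> (at (x - y)) b) = frechet_derivative \<rho> (at (x - y)) h"
  proof -
    have "frechet_derivative \<rho> (at (x - y)) (\<Sum>b\<in>Basis. (h \<bullet> b) *\<^sub>R b)
        = (\<Sum>b\<in>Basis. (h \<bullet> b) * frechet_derivative \<rho> (at (x - y)) b)"
      by (simp only: sum scale real_scaleR_def)
    then show ?thesis by (simp only: euclidean_representation)
  qed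
  finally show ?thesis .
qed

text \<open>The derivative of a convolution in direction \<open>h\<close> is the distributional gradient tested against a
reflected translate of the kernel.\<close>

lemma conv_deriv_eq_dist_grad:
  fixes v \<rho> :: "'a::euclidean_space \<Rightarrow> real"
  assumes "v \<in> borel_measurable borel" "test_fun \<rho>"
  shows "conv v (\<lambda>z. frechet_derivative \<rho> (at z) h) x = dist_grad v (\<lambda>y. \<rho> (x - y) *\<^sub>R h)"
  using assms by (simp add: dist_grad_lborel test_fun_scaleR_const test_fun_reflect
      divergence_reflect_scaleR conv_def)

text \<open>Duality between \<open>L\<^sup>1\<close> and test functions bounded by 1.\<close>

lemma test_fun_integral_dual:
  fixes G :: "'a::euclidean_space \<Rightarrow> 'b::euclidean_space"
  assumes G: "integrable lborel G"
    and le: "\<And>\<psi>. test_fun \<psi> \<Longrightarrow> (\<And>x. norm (\<psi> x) \<le> 1) \<Longrightarrow> (\<integral>x. G x \<bullet> \<psi> x \<partial>lborel) \<le> C"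
  shows "(\<integral>x. norm (G x) \<partial>lborel) \<le> C"
proof -
  have [measurable]: "G \<in> borel_measurable borel" using G by auto
  have m: "(\<lambda>x. inverse (norm (G x)) *\<^sub>R G x) \<in> borel_measurable borel" by measurable
  obtain \<psi> where \<psi>: "\<And>n::nat. test_fun (\<psi> n)" "\<And>n x. norm (\<psi> n x) \<le> 1"
    "AE x in lborel. (\<lambda>n. \<psi> n x) \<longlonglongrightarrow> inverse (norm (G x)) *\<^sub>R G x"
    by (rule test_fun_dense[OF m]) (auto simp: field_simps split: if_splits)
  have [measurable]: "\<psi> n \<in> borel_measurable borel" for n by (rule test_fun_borel[OF \<psi>(1)])
  have "(\<lambda>n. \<integral>x. G x \<bullet> \<psi> n x \<partial>lborel) \<longlonglongrightarrow> (\<integral>x. norm (G x) \<partial>lborel)"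
  proof (rule integral_dominated_convergence[where w="\<lambda>x. norm (G x)"])
    show "AE x in lborel. (\<lambda>n. G x \<bullet> \<psi> n x) \<longlonglongrightarrow> norm (G x)"
      using \<psi>(3)
    proof eventually_elim
      case (elim x)
      have "(\<lambda>n. G x \<bullet> \<psi> n x) \<longlonglongrightarrow> G x \<bullet> (inverse (norm (G x)) *\<^sub>R G x)"
        by (intro tendsto_intros elim)
      moreover have "G x \<bullet> (inverse (norm (G x)) *\<^sub>R G x) = norm (G x)"
        by (cases "G x = 0") (auto simp: dot_square_norm power2_eq_square)
      ultimately show ?case by simp
    qed
    show "AE x in lborel. norm (G x \<bullet> \<psi> n x) \<le> norm (G x)" for n
    proof (rule AE_I2)
      fix x
      have "\<bar>G x \<bullet> \<psi> n x\<bar> \<le> norm (G x) * norm (\<psi> n x)" by (rule Cauchy_Schwarz_ineq2)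
      also have "\<dots> \<le> norm (G x) * 1" using \<psi>(2) by (intro mult_left_mono) auto
      finally show "norm (G x \<bullet> \<psi> n x) \<le> norm (G x)" by simp
    qed
  qed (use G in auto)
  then show ?thesis by (rule LIMSEQ_le_const2) (use le \<psi> in auto)
qed

text \<open>Translations move a function of bounded variation at most linearly in \<open>L\<^sup>1\<close>. Tested against \<open>\<psi>\<close>, the
difference is an increment of a convolution along the segment from 0 to \<open>h\<close>, to which the mean
value theorem applies.\<close>

lemma translation_estimate:
  fixes v :: "'a::euclidean_space \<Rightarrow> real"
  assumes v: "integrable lborel v" and TV: "TV v \<le> ereal T"
  shows "(\<integral>x. \<bar>v (x + h) - v x\<bar> \<partial>lborel) \<le> norm h * T"
proof -
  have [measurable]: "v \<in> borel_measurable borel" using v by auto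
  have vh: "integrable lborel (\<lambda>x. v (x + h))" by (rule lborel_integrable_shift[OF v])
  have "(\<integral>x. norm (v (x + h) - v x) \<partial>lborel) \<le> norm h * T"
  proof (rule test_fun_integral_dual)
    fix \<psi> :: "'a \<Rightarrow> real" assume \<psi>: "test_fun \<psi>" "\<And>x. norm (\<psi> x) \<le> 1"
    have [measurable]: "\<psi> \<in> borel_measurable borel" by (rule test_fun_borel[OF \<psi>(1)])
    define \<rho> where "\<rho> x = \<psi> (- x)" for x
    have \<rho>: "test_fun \<rho>" using test_fun_reflect[OF \<psi>(1), of 0] by (simp add: \<rho>_def[abs_def])
    let ?D = "\<lambda>s. conv v (\<lambda>z. frechet_derivative \<rho> (at z) h) (s *\<^sub>R h)"
    have d: "((\<lambda>s. conv v \<rho> (s *\<^sub>R h)) has_real_derivative ?D s) (at s)" for s :: real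
    proof -
      have "((\<lambda>s. conv v \<rho> (s *\<^sub>R h)) has_derivative
          (\<lambda>r. conv v (\<lambda>z. frechet_derivative \<rho> (at z) (r *\<^sub>R h)) (s *\<^sub>R h))) (at s)"
        by (rule has_derivative_compose[OF _ conv_has_derivative[OF v \<rho>]])
          (auto intro!: derivative_eq_intros)
      moreover have "(\<lambda>r. conv v (\<lambda>z. frechet_derivative \<rho> (at z) (r *\<^sub>R h)) (s *\<^sub>R h)) = (*) (?D s)"
        using linear_scale[OF has_derivative_linear[OF conv_has_derivative[OF v \<rho>, of "s *\<^sub>R h"]], of _ h]
        by (auto simp: mult.commute)
      ultimately show ?thesis by (simp add: has_field_derivative_def)
    qed
    have "\<exists>z>0. z < 1 \<and> conv v \<rho> (1 *\<^sub>R h) - conv v \<rho> (0 *\<^sub>R h) = (1 - 0) * ?D z"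
      by (rule MVT2) (auto intro: d)
    then obtain z where z: "conv v \<rho> h - conv v \<rho> 0 = ?D z" by auto
    have "?D z = dist_grad v (\<lambda>y. \<rho> (z *\<^sub>R h - y) *\<^sub>R h)"
      by (rule conv_deriv_eq_dist_grad) (use \<rho> in auto)
    also have "\<bar>\<dots>\<bar> \<le> norm h * T"
    proof (rule dist_grad_bound[OF TV])
      show "test_fun (\<lambda>y. \<rho> (z *\<^sub>R h - y) *\<^sub>R h)" by (intro test_fun_scaleR_const test_fun_reflect \<rho>)
      show "norm (\<rho> (z *\<^sub>R h - x) *\<^sub>R h) \<le> norm h" for x
        using mult_right_mono[OF \<psi>(2), of "norm h"] by (simp add: \<rho>_def)
    qed simp
    finally have le: "conv v \<rho> h - conv v \<rho> 0 \<le> norm h * T" using z by simp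
    have "(\<integral>x. v (x + h) * \<psi> x \<partial>lborel) = (\<integral>x. v ((x - h) + h) * \<psi> (x - h) \<partial>lborel)"
      using lborel_integral_shift[of "\<lambda>x. v (x + h) * \<psi> x" "- h"] by simp
    then have "conv v \<rho> h = (\<integral>x. v (x + h) * \<psi> x \<partial>lborel)"
      by (simp add: conv_def \<rho>_def)
    moreover have "conv v \<rho> 0 = (\<integral>x. v x * \<psi> x \<partial>lborel)" by (simp add: conv_def \<rho>_def)
    ultimately show "(\<integral>x. (v (x + h) - v x) \<bullet> \<psi> x \<partial>lborel) \<le> norm h * T"
      using le integrable_mult_test[OF v \<psi>(1)] integrable_mult_test[OF vh \<psi>(1)]
      by (simp add: left_diff_distrib)
  qed (use v vh in auto)
  then show ?thesis by simp
qed

section \<open>Mollification\<close>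

lemma conv_alt:
  fixes v \<rho> :: "'a::euclidean_space \<Rightarrow> real"
  assumes [measurable]: "v \<in> borel_measurable borel" and "test_fun \<rho>"
  shows "conv v \<rho> x = (\<integral>z. \<rho> z * v (x - z) \<partial>lborel)"
proof -
  have [measurable]: "\<rho> \<in> borel_measurable borel" by (rule test_fun_borel[OF assms(2)])
  show ?thesis
    using lborel_integral_reflect[of "\<lambda>y. v y * \<rho> (x - y)" x] by (simp add: conv_def mult.commute)
qed

lemma conv_kernel_integrable:
  fixes v \<rho> :: "'a::euclidean_space \<Rightarrow> real"
  assumes v: "integrable lborel v" and \<rho>: "test_fun \<rho>"
  shows "integrable (lborel \<Otimes>\<^sub>M lborel) (\<lambda>(z, x). \<rho> z * v (x - z))"
proof (rule lborel_pair.Fubini_integrable)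
  have [measurable]: "v \<in> borel_measurable borel" using v by auto
  have [measurable]: "\<rho> \<in> borel_measurable borel" by (rule test_fun_borel[OF \<rho>])
  show "(\<lambda>(z, x). \<rho> z * v (x - z)) \<in> borel_measurable (lborel \<Otimes>\<^sub>M lborel)" by measurable
  have s: "integrable lborel (\<lambda>x. v (x - z))" for z using lborel_integrable_shift[OF v, of "- z"] by simp
  then show "AE z in lborel. integrable lborel (\<lambda>x. case (z, x) of (z, x) \<Rightarrow> \<rho> z * v (x - z))" by simp
  have "(\<integral>x. norm (\<rho> z * v (x - z)) \<partial>lborel) = \<bar>\<rho> z\<bar> * (\<integral>x. \<bar>v x\<bar> \<partial>lborel)" for z
    using lborel_integral_shift[of "\<lambda>x. \<bar>v x\<bar>" "- z"] by (simp add: abs_mult)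
  then show "integrable lborel (\<lambda>z. \<integral>x. norm (case (z, x) of (z, x) \<Rightarrow> \<rho> z * v (x - z)) \<partial>lborel)"
    using test_fun_integrable[OF \<rho>] by simp
qed

lemma conv_integrable_lborel:
  fixes v \<rho> :: "'a::euclidean_space \<Rightarrow> real"
  assumes v: "integrable lborel v" and \<rho>: "test_fun \<rho>"
  shows "integrable lborel (conv v \<rho>)"
proof -
  have "v \<in> borel_measurable borel" using v by auto
  then have "conv v \<rho> = (\<lambda>x. \<integral>z. \<rho> z * v (x - z) \<partial>lborel)" using conv_alt \<rho> by blast
  then show ?thesis using lborel_pair.integrable_snd[OF conv_kernel_integrable[OF assms]] by simp
qed

text \<open>The gradient of the convolution \<open>conv v \<rho>\<close>, see lemma \<open>conv_deriv_grad\<close>.\<close>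

definition conv_grad :: "('a::euclidean_space \<Rightarrow> real) \<Rightarrow> ('a \<Rightarrow> real) \<Rightarrow> 'a \<Rightarrow> 'a" where
  "conv_grad v \<rho> x = (\<Sum>b\<in>Basis. conv v (\<lambda>z. frechet_derivative \<rho> (at z) b) x *\<^sub>R b)"

lemma conv_grad_inner:
  fixes v \<rho> :: "'a::euclidean_space \<Rightarrow> real"
  assumes "integrable lborel v" "test_fun \<rho>"
  shows "conv_grad v \<rho> x \<bullet> h = conv v (\<lambda>z. frechet_derivative \<rho> (at z) h) x"
proof -
  interpret linear "\<lambda>h. conv v (\<lambda>z. frechet_derivative \<rho> (at z) h) x"
    using has_derivative_linear[OF conv_has_derivative[OF assms]] .
  have "conv_grad v \<rho> x \<bullet> h = (\<Sum>b\<in>Basis. (h \<bullet> b) * conv v (\<lambda>z. frechet_derivative \<rho> (at z) b) x)"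
    by (simp add: conv_grad_def inner_sum_left inner_commute[of h] mult.commute)
  also have "\<dots> = conv v (\<lambda>z. frechet_derivative \<rho> (at z) (\<Sum>b\<in>Basis. (h \<bullet> b) *\<^sub>R b)) x"
    by (simp only: sum scale real_scaleR_def)
  finally show ?thesis by (simp only: euclidean_representation)
qed

lemma conv_grad_continuous:
  fixes v \<rho> :: "'a::euclidean_space \<Rightarrow> real"
  assumes "integrable lborel v" "test_fun \<rho>"
  shows "continuous_on S (conv_grad v \<rho>)"
  unfolding conv_grad_def by (intro continuous_intros conv_continuous test_fun_deriv assms)

lemma conv_grad_integrable:
  fixes v \<rho> :: "'a::euclidean_space \<Rightarrow> real"
  assumes "integrable lborel v" "test_fun \<rho>"
  shows "integrable lborel (conv_grad v \<rho>)"
  unfolding conv_grad_def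
  by (intro Bochner_Integration.integrable_sum integrable_scaleR_left conv_integrable_lborel test_fun_deriv assms)

lemma conv_deriv_grad:
  fixes v \<rho> :: "'a::euclidean_space \<Rightarrow> real"
  assumes "integrable lborel v" "test_fun \<rho>"
  shows "(conv v \<rho> has_derivative (\<lambda>h. conv_grad v \<rho> x \<bullet> h)) (at x)"
  unfolding conv_grad_inner[OF assms] by (rule conv_has_derivative[OF assms])

text \<open>Mollification does not increase the total variation: tested against a field, the gradient of the
mollification is an average of \<open>dist_grad v\<close> tested against translated fields.\<close>

lemma conv_grad_norm_le:
  fixes v \<rho> :: "'a::euclidean_space \<Rightarrow> real"
  assumes v: "integrable lborel v" and \<rho>: "test_fun \<rho>" "\<And>x. \<rho> x \<ge> 0" "(\<integral>x. \<rho> x \<partial>lborel) = 1"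
    and TV: "TV v \<le> ereal T"
  shows "(\<integral>x. norm (conv_grad v \<rho> x) \<partial>lborel) \<le> T"
proof (rule test_fun_integral_dual[OF conv_grad_integrable[OF v \<rho>(1)]])
  fix \<psi> :: "'a \<Rightarrow> 'a" assume \<psi>: "test_fun \<psi>" "\<And>x. norm (\<psi> x) \<le> 1"
  let ?g = "divergence \<psi>"
  have g: "test_fun ?g" by (rule test_fun_divergence[OF \<psi>(1)])
  have [measurable]: "v \<in> borel_measurable borel" using v by auto
  have [measurable]: "\<rho> \<in> borel_measurable borel" "?g \<in> borel_measurable borel"
    by (intro test_fun_borel \<rho> g)+
  obtain B where B: "\<And>x. \<bar>?g x\<bar> \<le> B" by (rule test_fun_bounded[OF g]) auto
  have "integrable (lborel \<Otimes>\<^sub>M lborel) (\<lambda>p. (case p of (z, x) \<Rightarrow> \<rho> z * v (x - z)) * ?g (snd p))"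
    by (rule integrable_mult_bounded[OF conv_kernel_integrable[OF v \<rho>(1)], of _ B]) (use B in auto)
  then have I: "integrable (lborel \<Otimes>\<^sub>M lborel) (\<lambda>(z, x). \<rho> z * v (x - z) * ?g x)"
    by (simp add: case_prod_beta')
  have inner: "(\<integral>x. \<rho> z * v (x - z) * ?g x \<partial>lborel) = - (\<rho> z * dist_grad v (\<lambda>x. \<psi> (x + z)))" for z
  proof -
    have "(\<integral>x. v (x - z) * ?g x \<partial>lborel) = (\<integral>x. v x * ?g (x + z) \<partial>lborel)"
      using lborel_integral_shift[of "\<lambda>x. v (x - z) * ?g x" z] by simp
    also have "\<dots> = - dist_grad v (\<lambda>x. \<psi> (x + z))"
      by (simp add: dist_grad_lborel test_fun_shift \<psi> divergence_shift)
    finally show ?thesis by (simp add: mult.assoc)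
  qed
  have I': "integrable lborel (\<lambda>z. \<rho> z * dist_grad v (\<lambda>x. \<psi> (x + z)))"
    using lborel_pair.integrable_fst[OF I] unfolding inner by simp
  have "(\<integral>x. conv_grad v \<rho> x \<bullet> \<psi> x \<partial>lborel) = - (\<integral>x. conv v \<rho> x * ?g x \<partial>lborel)"
    by (subst integral_by_parts[OF conv_deriv_grad[OF v \<rho>(1)] _ \<psi>(1)])
      (auto intro!: continuous_intros conv_grad_continuous v \<rho>)
  also have "(\<integral>x. conv v \<rho> x * ?g x \<partial>lborel) = (\<integral>x. (\<integral>z. \<rho> z * v (x - z) * ?g x \<partial>lborel) \<partial>lborel)"
    using \<rho>(1) by (simp add: conv_alt)
  also have "\<dots> = (\<integral>z. (\<integral>x. \<rho> z * v (x - z) * ?g x \<partial>lborel) \<partial>lborel)"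
    by (rule lborel_pair.Fubini_integral[OF I])
  also have "- \<dots> = (\<integral>z. \<rho> z * dist_grad v (\<lambda>x. \<psi> (x + z)) \<partial>lborel)"
    unfolding inner by simp
  also have "\<dots> \<le> (\<integral>z. \<rho> z * T \<partial>lborel)"
  proof (rule integral_mono[OF I'])
    show "integrable lborel (\<lambda>z. \<rho> z * T)" using test_fun_integrable[OF \<rho>(1)] by simp
    fix z
    have "\<bar>dist_grad v (\<lambda>x. \<psi> (x + z))\<bar> \<le> 1 * T"
      by (rule dist_grad_bound[OF TV]) (auto intro: test_fun_shift \<psi>)
    then show "\<rho> z * dist_grad v (\<lambda>x. \<psi> (x + z)) \<le> \<rho> z * T"
      using \<rho>(2) by (intro mult_left_mono) auto
  qed
  also have "\<dots> = T" using \<rho> by simp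
  finally show "(\<integral>x. conv_grad v \<rho> x \<bullet> \<psi> x \<partial>lborel) \<le> T" .
qed

text \<open>The mollification is an average of translates, so the translation estimate applies.\<close>

lemma conv_L1_close:
  fixes v \<rho> :: "'a::euclidean_space \<Rightarrow> real"
  assumes v: "integrable lborel v" and \<rho>: "test_fun \<rho>" "\<And>x. \<rho> x \<ge> 0" "(\<integral>x. \<rho> x \<partial>lborel) = 1"
    and supp: "\<And>z. \<rho> z \<noteq> 0 \<Longrightarrow> norm z \<le> \<delta>"
    and TV: "TV v \<le> ereal T"
  shows "(\<integral>x. \<bar>conv v \<rho> x - v x\<bar> \<partial>lborel) \<le> \<delta> * T"
proof -
  have [measurable]: "v \<in> borel_measurable borel" using v by auto
  have [measurable]: "\<rho> \<in> borel_measurable borel" by (rule test_fun_borel[OF \<rho>(1)])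
  have \<rho>i: "integrable lborel \<rho>" by (rule test_fun_integrable[OF \<rho>(1)])
  have ci: "integrable lborel (conv v \<rho>)" by (rule conv_integrable_lborel[OF v \<rho>(1)])
  have "(0::ereal) \<le> ereal T" using TV_nonneg TV by (rule order_trans)
  then have T0: "T \<ge> 0" by simp
  have "\<exists>z. \<rho> z \<noteq> 0"
  proof (rule ccontr)
    assume "\<not> ?thesis" then have "\<rho> = (\<lambda>_. 0)" by auto
    then show False using \<rho>(3) by simp
  qed
  then have \<delta>: "\<delta> \<ge> 0" using supp norm_ge_zero order_trans by blast
  have AE: "AE x in lborel. integrable lborel (\<lambda>z. \<rho> z * v (x - z))"
    using lborel_pair.AE_integrable_snd[OF conv_kernel_integrable[OF v \<rho>(1)]] .
  have "ennreal (\<integral>x. \<bar>conv v \<rho> x - v x\<bar> \<partial>lborel) = (\<integral>\<^sup>+x. ennreal \<bar>conv v \<rho> x - v x\<bar> \<partial>lborel)"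
    using ci v by (intro nn_integral_eq_integral[symmetric]) auto
  also have "\<dots> \<le> (\<integral>\<^sup>+x. (\<integral>\<^sup>+z. ennreal (\<rho> z * \<bar>v (x - z) - v x\<bar>) \<partial>lborel) \<partial>lborel)"
  proof (rule nn_integral_mono_AE)
    show "AE x in lborel. ennreal \<bar>conv v \<rho> x - v x\<bar> \<le> (\<integral>\<^sup>+z. ennreal (\<rho> z * \<bar>v (x - z) - v x\<bar>) \<partial>lborel)"
      using AE
    proof eventually_elim
      case (elim x)
      have i: "integrable lborel (\<lambda>z. \<rho> z * v (x - z) - \<rho> z * v x)" using elim \<rho>i by simp
      have "conv v \<rho> x - v x = (\<integral>z. \<rho> z * v (x - z) - \<rho> z * v x \<partial>lborel)"
        using elim \<rho>i \<rho>(1,3) by (simp add: conv_alt)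
      then have "ennreal \<bar>conv v \<rho> x - v x\<bar> \<le> (\<integral>\<^sup>+z. ennreal (norm (\<rho> z * v (x - z) - \<rho> z * v x)) \<partial>lborel)"
        using integral_norm_bound_ennreal[OF i] by simp
      also have "\<dots> = (\<integral>\<^sup>+z. ennreal (\<rho> z * \<bar>v (x - z) - v x\<bar>) \<partial>lborel)"
        using \<rho>(2) by (intro nn_integral_cong) (simp add: abs_mult flip: right_diff_distrib)
      finally show ?case .
    qed
  qed
  also have "\<dots> = (\<integral>\<^sup>+z. (\<integral>\<^sup>+x. ennreal (\<rho> z * \<bar>v (x - z) - v x\<bar>) \<partial>lborel) \<partial>lborel)"
    by (rule lborel_pair.Fubini') measurable
  also have "\<dots> \<le> (\<integral>\<^sup>+z. ennreal (\<rho> z * (\<delta> * T)) \<partial>lborel)"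
  proof (rule nn_integral_mono)
    fix z
    show "(\<integral>\<^sup>+x. ennreal (\<rho> z * \<bar>v (x - z) - v x\<bar>) \<partial>lborel) \<le> ennreal (\<rho> z * (\<delta> * T))"
    proof (cases "\<rho> z = 0")
      case False
      have iz: "integrable lborel (\<lambda>x. v (x - z))" using lborel_integrable_shift[OF v, of "- z"] by simp
      have "(\<integral>\<^sup>+x. ennreal (\<rho> z * \<bar>v (x - z) - v x\<bar>) \<partial>lborel) = ennreal (\<integral>x. \<rho> z * \<bar>v (x - z) - v x\<bar> \<partial>lborel)"
        using iz v \<rho>(2) by (intro nn_integral_eq_integral) auto
      also have "\<dots> \<le> ennreal (\<rho> z * (\<delta> * T))"
      proof (rule ennreal_leI)
        have "(\<integral>x. \<bar>v (x + - z) - v x\<bar> \<partial>lborel) \<le> norm (- z) * T" by (rule translation_estimate[OF v TV])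
        also have "\<dots> \<le> \<delta> * T" using supp[OF False] T0 by (intro mult_right_mono) auto
        finally show "(\<integral>x. \<rho> z * \<bar>v (x - z) - v x\<bar> \<partial>lborel) \<le> \<rho> z * (\<delta> * T)"
          using \<rho>(2) by (simp add: mult_left_mono)
      qed
      finally show ?thesis .
    qed simp
  qed
  also have "\<dots> = ennreal (\<integral>z. \<rho> z * (\<delta> * T) \<partial>lborel)"
    using \<rho>i \<rho>(2) \<delta> T0 by (intro nn_integral_eq_integral) auto
  also have "\<dots> = ennreal (\<delta> * T)" using \<rho> by simp
  finally show ?thesis using \<delta> T0 by simp
qed

text \<open>A smooth probability density supported in the closed ball of radius \<open>1 / (n + 1)\<close>.\<close>

definition mollifier :: "nat \<Rightarrow> 'a::euclidean_space \<Rightarrow> real" where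
  "mollifier n x = bump (real (Suc n) *\<^sub>R x) / (\<integral>x. bump (real (Suc n) *\<^sub>R (x::'a)) \<partial>lborel)"

lemma mollifier:
  shows test_fun_mollifier: "test_fun (mollifier n :: 'a::euclidean_space \<Rightarrow> real)"
    and mollifier_nonneg: "mollifier n (x::'a) \<ge> 0"
    and mollifier_integral: "(\<integral>x. mollifier n (x::'a) \<partial>lborel) = 1"
    and mollifier_support: "mollifier n (x::'a) \<noteq> 0 \<Longrightarrow> norm x \<le> 1 / real (Suc n)"
proof -
  have tb: "test_fun (bump :: 'a \<Rightarrow> real)"
    by (rule test_funI[of _ "ball 0 1"]) (auto simp: smooth_bump bump_nz_iff)
  have t: "test_fun (\<lambda>x::'a. bump (real (Suc n) *\<^sub>R x) :: real)"
    using test_fun_affine[OF tb, of "real (Suc n)" 0] by simp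
  let ?I = "\<integral>x. bump (real (Suc n) *\<^sub>R (x::'a)) \<partial>lborel"
  have "?I \<noteq> 0"
  proof
    assume "?I = 0"
    then have "AE x::'a in lborel. bump (real (Suc n) *\<^sub>R x) = (0::real)"
      using integral_nonneg_eq_0_iff_AE[OF test_fun_integrable[OF t]] bump_nonneg by auto
    then have ae: "AE x::'a in lborel. x \<notin> ball 0 (1 / real (Suc n))"
    proof eventually_elim
      case (elim x)
      then have "\<not> norm (real (Suc n) *\<^sub>R x) < 1" using bump_nz_iff[of "real (Suc n) *\<^sub>R x"] by blast
      then have "\<not> real (Suc n) * norm x < 1" by (simp only: norm_scaleR abs_of_nat not_False_eq_True)
      then show ?case by (simp add: field_simps)
    qed
    have "emeasure lborel (ball (0::'a) (1 / real (Suc n))) = 0"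
      using ae by (subst (asm) AE_iff_measurable[OF _ refl]) (auto simp: ball_def)
    then show False using open_not_negligible[of "ball (0::'a) (1 / real (Suc n))"]
      by (simp add: negligible_iff_null_sets null_sets_def)
  qed
  moreover have "?I \<ge> 0" by (simp add: bump_nonneg)
  ultimately have I: "?I > 0" by simp
  have "mollifier n = (\<lambda>x::'a. (1 / ?I) *\<^sub>R bump (real (Suc n) *\<^sub>R x))" by (auto simp: mollifier_def)
  then show "test_fun (mollifier n :: 'a \<Rightarrow> real)" using test_fun_scaleR[OF t] by metis
  show "mollifier n x \<ge> 0" using I by (simp add: mollifier_def bump_nonneg)
  show "(\<integral>x. mollifier n (x::'a) \<partial>lborel) = 1" using I by (simp add: mollifier_def)
  assume "mollifier n x \<noteq> 0"
  then have "norm (real (Suc n) *\<^sub>R x) < 1" using bump_nz_iff[of "real (Suc n) *\<^sub>R x"] by (auto simp: mollifier_def)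
  then have "real (Suc n) * norm x < 1" by (simp only: norm_scaleR abs_of_nat)
  then show "norm x \<le> 1 / real (Suc n)" by (simp add: field_simps)
qed

section \<open>The coarea inequality\<close>

text \<open>Smooth increasing approximations of the Heaviside function with values between 0 and 1. They
steepen as \<open>n\<close> grows.\<close>

definition soft_step :: "nat \<Rightarrow> real \<Rightarrow> real" where
  "soft_step n s = 1/2 + arctan (real (Suc n) * s) / pi"

text \<open>The derivative of \<open>soft_step n\<close>, a probability density on the line.\<close>

definition soft_step' :: "nat \<Rightarrow> real \<Rightarrow> real" where
  "soft_step' n s = real (Suc n) / (pi * (1 + (real (Suc n) * s)\<^sup>2))"

lemma soft_step_deriv: "(soft_step n has_real_derivative soft_step' n s) (at s)"
  unfolding soft_step_def[abs_def] soft_step'_def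
  by (auto intro!: derivative_eq_intros simp: divide_simps) (auto simp: algebra_simps)

lemma soft_step'_pos: "soft_step' n s > 0"
  by (auto simp: soft_step'_def intro!: divide_pos_pos mult_pos_pos add_pos_nonneg)

lemma soft_step_bounds: "\<bar>soft_step n s\<bar> \<le> 1"
proof -
  have "\<bar>arctan (real (Suc n) * s)\<bar> \<le> pi / 2"
    using arctan_bounded[of "real (Suc n) * s"] by linarith
  then have "\<bar>arctan (real (Suc n) * s) / pi\<bar> \<le> 1/2" by (simp add: divide_le_eq)
  then show ?thesis unfolding soft_step_def by linarith
qed

lemma soft_step'_continuous: "continuous_on S (soft_step' n)"
proof -
  have "pi * (1 + (real (Suc n) * s)\<^sup>2) \<noteq> 0" for s by (simp add: add_nonneg_eq_0_iff)
  then show ?thesis unfolding soft_step'_def[abs_def] by (intro continuous_intros) auto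
qed

lemma soft_step_continuous: "continuous_on S (soft_step n)"
  unfolding soft_step_def[abs_def] by (intro continuous_intros) auto

lemma soft_step'_nn_integral: "(\<integral>\<^sup>+s. ennreal (soft_step' n (c - s)) \<partial>lborel) = 1"
proof -
  have F: "((\<lambda>s. - soft_step n (c - s)) has_real_derivative soft_step' n (c - s)) (at s)" for s
    by (auto intro!: derivative_eq_intros DERIV_chain2[OF soft_step_deriv])
  have lim: "((\<lambda>s. - soft_step n (c - s)) \<longlongrightarrow> - 1) at_bot" "((\<lambda>s. - soft_step n (c - s)) \<longlongrightarrow> 0) at_top"
  proof -
    have "filterlim (\<lambda>s. c + - s) at_top at_bot"
      by (rule filterlim_tendsto_add_at_top[OF tendsto_const filterlim_uminus_at_top_at_bot])
    then have a: "filterlim (\<lambda>s. real (Suc n) * (c - s)) at_top at_bot"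
      by (intro filterlim_tendsto_pos_mult_at_top[OF tendsto_const]) auto
    have "filterlim (\<lambda>s. - c + s) at_top at_top"
      by (rule filterlim_tendsto_add_at_top[OF tendsto_const filterlim_ident])
    then have "filterlim (\<lambda>s. c - s) at_bot at_top"
      by (simp add: filterlim_uminus_at_bot)
    then have b: "filterlim (\<lambda>s. real (Suc n) * (c - s)) at_bot at_top"
      by (intro filterlim_tendsto_pos_mult_at_bot[OF tendsto_const]) auto
    have "((\<lambda>s. - (1/2 + arctan (real (Suc n) * (c - s)) / pi)) \<longlongrightarrow> - (1/2 + (pi/2) / pi)) at_bot"
      by (intro tendsto_intros filterlim_compose[OF tendsto_arctan_at_top a]) auto
    then show "((\<lambda>s. - soft_step n (c - s)) \<longlongrightarrow> - 1) at_bot" by (simp add: soft_step_def)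
    have "((\<lambda>s. - (1/2 + arctan (real (Suc n) * (c - s)) / pi)) \<longlongrightarrow> - (1/2 + (- (pi/2)) / pi)) at_top"
      by (intro tendsto_intros filterlim_compose[OF tendsto_arctan_at_bot b]) auto
    then show "((\<lambda>s. - soft_step n (c - s)) \<longlongrightarrow> 0) at_top" by (simp add: soft_step_def)
  qed
  have cont: "isCont (\<lambda>s. soft_step' n (c - s)) s" for s
    using continuous_on_compose2[OF soft_step'_continuous[of UNIV n], of UNIV "\<lambda>s. c - s"]
    by (auto simp: continuous_on_eq_continuous_at intro: continuous_intros)
  have pos: "0 \<le> soft_step' n (c - s)" for s using soft_step'_pos[of n "c - s"] by simp
  note FTC = interval_integral_FTC_nonneg[of "-\<infinity>" "\<infinity>" "\<lambda>s. - soft_step n (c - s)" "\<lambda>s. soft_step' n (c - s)" "-1" 0,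
      OF _ F cont]
  have 1: "set_integrable lborel (einterval (-\<infinity>) \<infinity>) (\<lambda>s. soft_step' n (c - s))"
    by (rule FTC(1)) (use pos lim in \<open>auto simp: ereal_tendsto_simps\<close>)
  have 2: "(LBINT s=-\<infinity>..\<infinity>. soft_step' n (c - s)) = 0 - - 1"
    by (rule FTC(2)) (use pos lim in \<open>auto simp: ereal_tendsto_simps\<close>)
  have "einterval (-\<infinity>) \<infinity> = UNIV" by (auto simp: einterval_def)
  then have i: "integrable lborel (\<lambda>s. soft_step' n (c - s))" "(\<integral>s. soft_step' n (c - s) \<partial>lborel) = 1"
    using 1 2 by (simp_all add: set_integrable_def interval_lebesgue_integral_def set_lebesgue_integral_def)
  show ?thesis using nn_integral_eq_integral[OF i(1)] pos i(2) by simp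
qed

lemma soft_step_limit:
  assumes "a \<longlonglongrightarrow> l" "l \<noteq> 0" "strict_mono r"
  shows "(\<lambda>n. soft_step (r n) (a n)) \<longlonglongrightarrow> (if l > 0 then 1 else 0)"
proof -
  have r: "filterlim (\<lambda>n. real (Suc (r n))) at_top sequentially"
    by (rule filterlim_compose[OF filterlim_real_sequentially])
      (rule filterlim_compose[OF filterlim_Suc filterlim_subseq[OF assms(3)]])
  show ?thesis
  proof (cases "l > 0")
    case True
    have "filterlim (\<lambda>n. a n * real (Suc (r n))) at_top sequentially"
      by (rule filterlim_tendsto_pos_mult_at_top[OF assms(1) True r])
    then have "(\<lambda>n. 1/2 + arctan (real (Suc (r n)) * a n) / pi) \<longlonglongrightarrow> 1/2 + (pi/2) / pi"
      by (intro tendsto_intros filterlim_compose[OF tendsto_arctan_at_top]) (auto simp: mult.commute)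
    then show ?thesis using True by (simp add: soft_step_def)
  next
    case False
    then have "l < 0" using assms by simp
    then have "filterlim (\<lambda>n. a n * real (Suc (r n))) at_bot sequentially"
      by (rule filterlim_tendsto_neg_mult_at_bot[OF assms(1) _ r])
    then have "(\<lambda>n. 1/2 + arctan (real (Suc (r n)) * a n) / pi) \<longlonglongrightarrow> 1/2 + (- (pi/2)) / pi"
      by (intro tendsto_intros filterlim_compose[OF tendsto_arctan_at_bot]) (auto simp: mult.commute)
    then show ?thesis using False by (simp add: soft_step_def)
  qed
qed

lemma mollified_AE_subseq:
  fixes v :: "'a::euclidean_space \<Rightarrow> real"
  assumes v: "integrable lborel v" and TV: "TV v \<le> ereal T"
  obtains r :: "nat \<Rightarrow> nat" where "strict_mono r" "AE x in lborel. (\<lambda>n. conv v (mollifier (r n)) x) \<longlonglongrightarrow> v x"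
proof -
  let ?u = "\<lambda>n x. conv v (mollifier n) x - v x"
  have "(\<lambda>n. \<integral>x. norm (?u n x) \<partial>lborel) \<longlonglongrightarrow> 0"
  proof (rule tendsto_sandwich[OF _ _ tendsto_const])
    show "\<forall>\<^sub>F n in sequentially. (\<integral>x. norm (?u n x) \<partial>lborel) \<le> (1 / real (Suc n)) * T"
      using conv_L1_close[OF v test_fun_mollifier mollifier_nonneg mollifier_integral mollifier_support TV] by simp
    have "(\<lambda>n. inverse (real (Suc n)) * T) \<longlonglongrightarrow> 0 * T"
      by (intro tendsto_intros LIMSEQ_inverse_real_of_nat)
    then show "(\<lambda>n. (1 / real (Suc n)) * T) \<longlonglongrightarrow> 0" by (simp add: divide_inverse)
  qed auto
  then obtain r :: "nat \<Rightarrow> nat" where "strict_mono r" "AE x in lborel. (\<lambda>n. ?u (r n) x) \<longlonglongrightarrow> 0"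
    using tendsto_L1_AE_subseq[of lborel ?u] v conv_integrable_lborel[OF v test_fun_mollifier] by auto
  then show thesis by (intro that[of r]) (auto simp: LIM_zero_iff)
qed

text \<open>The difficult half of the coarea formula: the perimeters of the level sets integrate to at most the
total variation. The function \<open>f\<close> is a measurable upper bound for the perimeters; their own
measurability is not needed. Moreover a vanishing gradient on an open set is inherited by almost all
level sets.

For mollifications \<open>u n\<close> of \<open>v\<close>, integration by parts bounds the gradient of the softened indicator
\<open>soft_step (u n - t)\<close> by \<open>F n t = \<integral> soft_step' (u n - t) |Du n|\<close>, and Tonelli gives
\<open>\<integral> F n t dt = \<integral> |Du n| \<le> TV v\<close>. If \<open>u n\<close> tends to \<open>v\<close> almost everywhere and \<open>{v = t}\<close> is a null set,
the softened indicators tend to the indicator of \<open>{v > t}\<close>; Fatou's lemma concludes with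
\<open>f = liminf F n\<close>.\<close>

lemma coarea_le:
  fixes v :: "'a::euclidean_space \<Rightarrow> real"
  assumes v: "integrable lborel v" and TV: "TV v \<le> ereal T"
  obtains f :: "real \<Rightarrow> ennreal" where "f \<in> borel_measurable borel" "(\<integral>\<^sup>+t. f t \<partial>lborel) \<le> ennreal T"
    "AE t in lborel. TV (indicator {x. v x > t} :: 'a \<Rightarrow> real) \<le> enn2ereal (f t) \<and>
       (\<forall>U. open U \<longrightarrow> (\<forall>\<phi>\<in>test_fields U. dist_grad v \<phi> = 0) \<longrightarrow>
          (\<forall>\<phi>\<in>test_fields U. dist_grad (indicator {x. v x > t}) \<phi> = 0))"
proof -
  have [measurable]: "v \<in> borel_measurable borel" using v by auto
  obtain r :: "nat \<Rightarrow> nat" where r: "strict_mono r"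
    and ae: "AE x in lborel. (\<lambda>n. conv v (mollifier (r n)) x) \<longlonglongrightarrow> v x"
    using mollified_AE_subseq[OF v TV] by blast
  define u where "u n = conv v (mollifier (r n))" for n
  define Du where "Du n = conv_grad v (mollifier (r n))" for n
  have uc: "continuous_on S (u n)" for S n
    unfolding u_def by (intro conv_continuous v test_fun_mollifier)
  have Duc: "continuous_on S (Du n)" for S n
    unfolding Du_def by (intro conv_grad_continuous v test_fun_mollifier)
  have ud: "(u n has_derivative (\<lambda>h. Du n x \<bullet> h)) (at x)" for n x
    unfolding u_def Du_def by (intro conv_deriv_grad v test_fun_mollifier)
  have [measurable]: "u n \<in> borel_measurable borel" "Du n \<in> borel_measurable borel"
      "soft_step n \<in> borel_measurable borel" "soft_step' n \<in> borel_measurable borel" for n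
    by (auto intro!: borel_measurable_continuous_onI uc Duc soft_step_continuous soft_step'_continuous)
  define F where "F n t = (\<integral>\<^sup>+x. ennreal (soft_step' (r n) (u n x - t) * norm (Du n x)) \<partial>lborel)" for n t
  have [measurable]: "F n \<in> borel_measurable borel" for n
    unfolding F_def by measurable
  define f where "f t = liminf (\<lambda>n. F n t)" for t
  have fm: "f \<in> borel_measurable borel" unfolding f_def[abs_def] by measurable
  have F_int: "(\<integral>\<^sup>+t. F n t \<partial>lborel) \<le> ennreal T" for n
  proof -
    have "(\<integral>\<^sup>+t. F n t \<partial>lborel) = (\<integral>\<^sup>+x. (\<integral>\<^sup>+t. ennreal (soft_step' (r n) (u n x - t) * norm (Du n x)) \<partial>lborel) \<partial>lborel)"
      unfolding F_def by (rule lborel_pair.Fubini') measurable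
    also have "\<dots> = (\<integral>\<^sup>+x. ennreal (norm (Du n x)) \<partial>lborel)"
    proof (rule nn_integral_cong)
      fix x
      have "(\<integral>\<^sup>+t. ennreal (soft_step' (r n) (u n x - t) * norm (Du n x)) \<partial>lborel)
          = (\<integral>\<^sup>+t. ennreal (soft_step' (r n) (u n x - t)) * ennreal (norm (Du n x)) \<partial>lborel)"
        using less_imp_le[OF soft_step'_pos] by (simp add: ennreal_mult)
      also have "\<dots> = ennreal (norm (Du n x))"
        by (subst nn_integral_multc) (auto simp: soft_step'_nn_integral)
      finally show "(\<integral>\<^sup>+t. ennreal (soft_step' (r n) (u n x - t) * norm (Du n x)) \<partial>lborel) = ennreal (norm (Du n x))" .
    qed
    also have "\<dots> = ennreal (\<integral>x. norm (Du n x) \<partial>lborel)"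
      unfolding Du_def by (intro nn_integral_eq_integral integrable_norm conv_grad_integrable v test_fun_mollifier) auto
    also have "\<dots> \<le> ennreal T"
      unfolding Du_def
      by (intro ennreal_leI conv_grad_norm_le v TV test_fun_mollifier mollifier_nonneg mollifier_integral)
    finally show ?thesis .
  qed
  have f_int: "(\<integral>\<^sup>+t. f t \<partial>lborel) \<le> ennreal T"
  proof -
    have "(\<integral>\<^sup>+t. f t \<partial>lborel) \<le> liminf (\<lambda>n. \<integral>\<^sup>+t. F n t \<partial>lborel)"
      unfolding f_def by (rule nn_integral_liminf) measurable
    also have "\<dots> \<le> liminf (\<lambda>n. ennreal T)" by (rule Liminf_mono) (simp add: F_int)
    finally show ?thesis by (simp add: Liminf_const)
  qed
  have "AE x in lborel. AE t in lborel. v x \<noteq> t"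
    by (rule AE_I2) (auto intro: AE_mp[OF AE_lborel_singleton])
  then have "AE t in lborel. AE x in lborel. v x \<noteq> t"
    by (rule lborel_pair.AE_commute[THEN iffD1, rotated]) measurable
  then have "AE t in lborel. TV (indicator {x. v x > t} :: 'a \<Rightarrow> real) \<le> enn2ereal (f t) \<and>
       (\<forall>U. open U \<longrightarrow> (\<forall>\<phi>\<in>test_fields U. dist_grad v \<phi> = 0) \<longrightarrow>
          (\<forall>\<phi>\<in>test_fields U. dist_grad (indicator {x. v x > t}) \<phi> = 0))"
  proof eventually_elim
    case (elim t)
    let ?E = "{x. v x > t}"
    let ?w = "\<lambda>n x. soft_step (r n) (u n x - t)"
    have lim: "(\<lambda>n. - (\<integral>x. ?w n x * divergence \<phi> x \<partial>lborel)) \<longlonglongrightarrow> dist_grad (indicator ?E) \<phi>"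
      if \<phi>: "test_fun \<phi>" for \<phi>
    proof -
      have [measurable]: "divergence \<phi> \<in> borel_measurable borel"
        by (intro test_fun_borel test_fun_divergence \<phi>)
      have "(\<lambda>n. \<integral>x. ?w n x * divergence \<phi> x \<partial>lborel) \<longlonglongrightarrow> (\<integral>x. indicator ?E x * divergence \<phi> x \<partial>lborel)"
      proof (rule integral_dominated_convergence[where w="\<lambda>x. \<bar>divergence \<phi> x\<bar>"])
        show "AE x in lborel. (\<lambda>n. ?w n x * divergence \<phi> x) \<longlonglongrightarrow> indicator ?E x * divergence \<phi> x"
          using ae elim
        proof eventually_elim
          case (elim x)
          have "(\<lambda>n. u n x - t) \<longlonglongrightarrow> v x - t" unfolding u_def by (intro tendsto_intros elim)
          from soft_step_limit[OF this _ r] elim have "(\<lambda>n. ?w n x) \<longlonglongrightarrow> indicator ?E x"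
            by (auto simp: indicator_def)
          then show ?case by (intro tendsto_intros)
        qed
        show "AE x in lborel. norm (?w n x * divergence \<phi> x) \<le> \<bar>divergence \<phi> x\<bar>" for n
          using soft_step_bounds by (intro AE_I2) (auto simp: abs_mult intro: mult_left_le_one_le)
        show "integrable lborel (\<lambda>x. \<bar>divergence \<phi> x\<bar>)"
          by (intro integrable_abs test_fun_integrable test_fun_divergence \<phi>)
      qed measurable
      then show ?thesis using \<phi> by (subst dist_grad_lborel) (auto intro: tendsto_minus)
    qed
    have wd: "(?w n has_derivative (\<lambda>h. soft_step' (r n) (u n x - t) * (Du n x \<bullet> h))) (at x)" for n x
    proof -
      have "((\<lambda>x. u n x - t) has_derivative (\<lambda>h. Du n x \<bullet> h)) (at x)"
        using has_derivative_diff[OF ud has_derivative_const] by simp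
      from has_derivative_compose[OF this soft_step_deriv[unfolded has_field_derivative_def]]
      show ?thesis by simp
    qed
    have ibp: "- (\<integral>x. ?w n x * divergence \<phi> x \<partial>lborel) = (\<integral>x. soft_step' (r n) (u n x - t) * (Du n x \<bullet> \<phi> x) \<partial>lborel)"
      if "test_fun \<phi>" for \<phi> n
      by (subst integral_by_parts[OF wd _ that])
        (auto intro!: continuous_intros Duc continuous_on_compose2[OF soft_step'_continuous[of UNIV]] uc)
    have "TV (indicator ?E :: 'a \<Rightarrow> real) \<le> enn2ereal (f t)"
    proof (rule TV_leI)
      fix \<phi> :: "'a \<Rightarrow> 'a" assume \<phi>: "test_fun \<phi>" "\<And>x. norm (\<phi> x) \<le> 1"
      obtain K where K: "compact K" "\<And>x. x \<notin> K \<Longrightarrow> \<phi> x = 0" by (rule test_fun_support[OF \<phi>(1)]) blast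
      have le: "ennreal (- (\<integral>x. ?w n x * divergence \<phi> x \<partial>lborel)) \<le> F n t" for n
      proof -
        have c: "continuous_on UNIV (\<lambda>x. soft_step' (r n) (u n x - t) * (Du n x \<bullet> \<phi> x))"
          by (auto intro!: continuous_intros Duc continuous_on_compose2[OF soft_step'_continuous[of UNIV]] uc
              test_fun_continuous[OF \<phi>(1)])
        have i: "integrable lborel (\<lambda>x. soft_step' (r n) (u n x - t) * (Du n x \<bullet> \<phi> x))"
          by (rule compact_support_integrable[OF c K(1)]) (simp add: K)
        have "ennreal (\<integral>x. soft_step' (r n) (u n x - t) * (Du n x \<bullet> \<phi> x) \<partial>lborel)
            \<le> ennreal (norm (\<integral>x. soft_step' (r n) (u n x - t) * (Du n x \<bullet> \<phi> x) \<partial>lborel))"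
          by (intro ennreal_leI) simp
        also have "\<dots> \<le> (\<integral>\<^sup>+x. ennreal (norm (soft_step' (r n) (u n x - t) * (Du n x \<bullet> \<phi> x))) \<partial>lborel)"
          by (rule integral_norm_bound_ennreal[OF i])
        also have "\<dots> \<le> F n t"
          unfolding F_def
        proof (intro nn_integral_mono ennreal_leI)
          fix x
          have "\<bar>Du n x \<bullet> \<phi> x\<bar> \<le> norm (Du n x) * norm (\<phi> x)" by (rule Cauchy_Schwarz_ineq2)
          also have "\<dots> \<le> norm (Du n x) * 1" using \<phi>(2) by (intro mult_left_mono) auto
          finally show "norm (soft_step' (r n) (u n x - t) * (Du n x \<bullet> \<phi> x)) \<le> soft_step' (r n) (u n x - t) * norm (Du n x)"
            using less_imp_le[OF soft_step'_pos] by (simp add: abs_mult mult_left_mono)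
        qed
        finally show ?thesis using ibp[OF \<phi>(1)] by simp
      qed
      have "(\<lambda>n. ennreal (- (\<integral>x. ?w n x * divergence \<phi> x \<partial>lborel))) \<longlonglongrightarrow> ennreal (dist_grad (indicator ?E) \<phi>)"
        by (intro tendsto_ennrealI lim \<phi>)
      then have "ennreal (dist_grad (indicator ?E) \<phi>) = liminf (\<lambda>n. ennreal (- (\<integral>x. ?w n x * divergence \<phi> x \<partial>lborel)))"
        by (rule lim_imp_Liminf[OF sequentially_bot, symmetric])
      also have "\<dots> \<le> f t" unfolding f_def by (rule Liminf_mono) (simp add: le)
      finally have "enn2ereal (ennreal (dist_grad (indicator ?E) \<phi>)) \<le> enn2ereal (f t)"
        by (simp add: less_eq_ennreal.rep_eq)
      moreover have "ereal (dist_grad (indicator ?E) \<phi>) \<le> enn2ereal (ennreal (dist_grad (indicator ?E) \<phi>))"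
      proof (cases "dist_grad (indicator ?E) \<phi> \<ge> 0")
        case False
        then have "ereal (dist_grad (indicator ?E) \<phi>) \<le> 0" by simp
        then show ?thesis using enn2ereal_nonneg order_trans by blast
      qed (simp add: enn2ereal_ennreal)
      ultimately show "ereal (dist_grad (indicator ?E) \<phi>) \<le> enn2ereal (f t)" by (rule order_trans[rotated])
    qed
    moreover have "dist_grad (indicator ?E) \<phi> = 0"
      if U: "open U" and 0: "\<forall>\<phi>\<in>test_fields U. dist_grad v \<phi> = 0" and \<phi>: "\<phi> \<in> test_fields U" for U \<phi>
    proof -
      have t: "test_fun \<phi>" and sub: "closure {x. \<phi> x \<noteq> 0} \<subseteq> U" using \<phi> by (auto simp: test_fields_iff)
      have "compact (closure {x. \<phi> x \<noteq> 0})" using t by (simp add: test_fun_def)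
      then obtain e where e: "e > 0" "(\<Union>x\<in>closure {x. \<phi> x \<noteq> 0}. ball x e) \<subseteq> U"
        by (rule compact_subset_open_imp_ball_epsilon_subset[OF _ U sub])
      obtain N where N: "1 / real (Suc N) < e" using nat_approx_posE[OF e(1)] by blast
      \<comment> \<open>Near the support of \<open>\<phi>\<close> the kernels are supported in \<open>U\<close>, where \<open>v\<close> has no gradient.\<close>
      have z: "Du n x \<bullet> \<phi> x = 0" if n: "n \<ge> N" for n x
      proof (cases "\<phi> x = 0")
        case False
        then have x: "ball x e \<subseteq> U" using e(2) closure_subset[of "{x. \<phi> x \<noteq> 0}"] by blast
        have "1 / real (Suc (r n)) \<le> 1 / real (Suc N)"
          using n seq_suble[OF r, of n] by (intro divide_left_mono) auto
        then have small: "1 / real (Suc (r n)) < e" using N by simp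
        let ?\<psi> = "\<lambda>y. mollifier (r n) (x - y) *\<^sub>R \<phi> x"
        have "?\<psi> \<in> test_fields U"
          unfolding test_fields_iff
        proof
          show "test_fun ?\<psi>" by (intro test_fun_scaleR_const test_fun_reflect test_fun_mollifier)
          have "{y. ?\<psi> y \<noteq> 0} \<subseteq> cball x (1 / real (Suc (r n)))"
            using mollifier_support[of "r n" "x - y" for y] by (auto simp: dist_norm)
          then have "closure {y. ?\<psi> y \<noteq> 0} \<subseteq> cball x (1 / real (Suc (r n)))"
            by (rule closure_minimal) simp
          also have "\<dots> \<subseteq> ball x e" using small by auto
          finally show "closure {y. ?\<psi> y \<noteq> 0} \<subseteq> U" using x by blast
        qed
        then have "dist_grad v ?\<psi> = 0" using 0 by blast
        then show ?thesis
          unfolding Du_def by (simp add: conv_grad_inner v test_fun_mollifier conv_deriv_eq_dist_grad)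
      qed simp
      have "- (\<integral>x. ?w n x * divergence \<phi> x \<partial>lborel) = 0" if "n \<ge> N" for n
        using ibp[OF t] z[OF that] by simp
      then have "(\<lambda>n. - (\<integral>x. ?w n x * divergence \<phi> x \<partial>lborel)) \<longlonglongrightarrow> 0"
        by (intro tendsto_eventually eventually_sequentiallyI)
      with lim[OF t] show ?thesis by (rule LIMSEQ_unique)
    qed
    ultimately show ?case by blast
  qed
  with fm f_int show thesis by (rule that)
qed

section \<open>Compactness\<close>

text \<open>The limit is the pointwise limit of a subsequence whose increments are summable in \<open>L\<^sup>1\<close>. Fatou's
lemma then bounds the distance of each member of the sequence from it.\<close>

lemma L1_complete:
  fixes u :: "nat \<Rightarrow> 'a \<Rightarrow> real"
  assumes u: "\<And>n. integrable M (u n)"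
    and cauchy: "\<And>e. e > 0 \<Longrightarrow> \<exists>N. \<forall>m\<ge>N. \<forall>n\<ge>N. (\<integral>x. \<bar>u m x - u n x\<bar> \<partial>M) < e"
  obtains l where "integrable M l" "(\<lambda>n. \<integral>x. \<bar>u n x - l x\<bar> \<partial>M) \<longlonglongrightarrow> 0"
proof -
  have [measurable]: "u n \<in> borel_measurable M" for n using u by auto
  have "\<exists>N. \<forall>m\<ge>N. \<forall>n\<ge>N. (\<integral>x. \<bar>u m x - u n x\<bar> \<partial>M) < (1/2)^k" for k
    by (rule cauchy) simp
  then obtain N where N: "\<And>k m n. m \<ge> N k \<Longrightarrow> n \<ge> N k \<Longrightarrow> (\<integral>x. \<bar>u m x - u n x\<bar> \<partial>M) < (1/2)^k"
    by metis
  define s where "s k = Max (N ` {..k}) + k" for k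
  have sN: "s k \<ge> N k" for k by (auto simp: s_def intro!: trans_le_add1 Max_ge)
  have s_mono: "s k \<le> s (Suc k)" for k
    unfolding s_def by (intro add_mono Max_mono) auto
  have sk: "s k \<ge> k" for k by (simp add: s_def)
  define d where "d k x = u (s (Suc k)) x - u (s k) x" for k x
  have di: "integrable M (d k)" for k unfolding d_def[abs_def] using u by auto
  have [measurable]: "d k \<in> borel_measurable M" for k using di by auto
  have dk: "(\<integral>x. \<bar>d k x\<bar> \<partial>M) \<le> (1/2)^k" for k
    unfolding d_def using N[of k "s (Suc k)" "s k"] sN[of k] s_mono[of k] by simp
  have "(\<integral>\<^sup>+x. (\<Sum>k. ennreal \<bar>d k x\<bar>) \<partial>M) = (\<Sum>k. \<integral>\<^sup>+x. ennreal \<bar>d k x\<bar> \<partial>M)"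
    by (rule nn_integral_suminf) measurable
  also have "\<dots> \<le> (\<Sum>k. ennreal ((1/2)^k))"
  proof (rule suminf_le)
    fix k
    have "(\<integral>\<^sup>+x. ennreal \<bar>d k x\<bar> \<partial>M) = ennreal (\<integral>x. \<bar>d k x\<bar> \<partial>M)"
      using di by (intro nn_integral_eq_integral) auto
    then show "(\<integral>\<^sup>+x. ennreal \<bar>d k x\<bar> \<partial>M) \<le> ennreal ((1/2)^k)" using dk by (simp add: ennreal_leI)
  qed auto
  also have "\<dots> = ennreal (\<Sum>k. (1/2)^k)" by (rule suminf_ennreal2) auto
  also have "\<dots> < \<infinity>" by simp
  finally have "(\<integral>\<^sup>+x. (\<Sum>k. ennreal \<bar>d k x\<bar>) \<partial>M) \<noteq> \<infinity>" by simp
  then have "AE x in M. (\<Sum>k. ennreal \<bar>d k x\<bar>) \<noteq> \<infinity>"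
    by (intro nn_integral_PInf_AE) auto
  then have conv: "AE x in M. (\<lambda>k. u (s k) x) \<longlonglongrightarrow> lim (\<lambda>k. u (s k) x)"
  proof eventually_elim
    case (elim x)
    then have "summable (\<lambda>k. \<bar>d k x\<bar>)" by (intro summable_suminf_not_top) auto
    then have "summable (\<lambda>k. d k x)" by (rule summable_rabs_cancel)
    then have "(\<lambda>n. \<Sum>k<n. d k x) \<longlonglongrightarrow> (\<Sum>k. d k x)" by (rule summable_LIMSEQ)
    then have "(\<lambda>n. u (s n) x - u (s 0) x) \<longlonglongrightarrow> (\<Sum>k. d k x)"
      unfolding d_def sum_lessThan_telescope[of "\<lambda>k. u (s k) x"] .
    from tendsto_add[OF this tendsto_const[of "u (s 0) x"]] have "convergent (\<lambda>k. u (s k) x)"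
      by (auto simp: convergent_def)
    then show ?case by (simp add: convergent_LIMSEQ_iff)
  qed
  define l where "l x = lim (\<lambda>k. u (s k) x)" for x
  have [measurable]: "l \<in> borel_measurable M" unfolding l_def[abs_def] by measurable
  have key: "(\<integral>\<^sup>+x. ennreal \<bar>u n x - l x\<bar> \<partial>M) \<le> ennreal e"
    if "e > 0" and N: "\<forall>m\<ge>N. \<forall>n\<ge>N. (\<integral>x. \<bar>u m x - u n x\<bar> \<partial>M) < e" and n: "n \<ge> N" for e N n
  proof -
    have "(\<integral>\<^sup>+x. ennreal \<bar>u n x - l x\<bar> \<partial>M) = (\<integral>\<^sup>+x. liminf (\<lambda>k. ennreal \<bar>u n x - u (s k) x\<bar>) \<partial>M)"
    proof (rule nn_integral_cong_AE)
      show "AE x in M. ennreal \<bar>u n x - l x\<bar> = liminf (\<lambda>k. ennreal \<bar>u n x - u (s k) x\<bar>)"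
        using conv
      proof eventually_elim
        case (elim x)
        then have "(\<lambda>k. ennreal \<bar>u n x - u (s k) x\<bar>) \<longlonglongrightarrow> ennreal \<bar>u n x - l x\<bar>"
          unfolding l_def by (intro tendsto_ennrealI tendsto_intros)
        then show ?case by (rule lim_imp_Liminf[OF sequentially_bot, symmetric])
      qed
    qed
    also have "\<dots> \<le> liminf (\<lambda>k. \<integral>\<^sup>+x. ennreal \<bar>u n x - u (s k) x\<bar> \<partial>M)"
      by (rule nn_integral_liminf) measurable
    also have "\<dots> \<le> liminf (\<lambda>k. ennreal e)"
    proof (rule Liminf_mono, rule eventually_sequentiallyI[of N])
      fix k assume "k \<ge> N"
      then have "s k \<ge> N" using sk[of k] by simp
      then have "(\<integral>x. \<bar>u n x - u (s k) x\<bar> \<partial>M) < e" using N n by blast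
      moreover have "(\<integral>\<^sup>+x. ennreal \<bar>u n x - u (s k) x\<bar> \<partial>M) = ennreal (\<integral>x. \<bar>u n x - u (s k) x\<bar> \<partial>M)"
        using u by (intro nn_integral_eq_integral) auto
      ultimately show "(\<integral>\<^sup>+x. ennreal \<bar>u n x - u (s k) x\<bar> \<partial>M) \<le> ennreal e" by (simp add: ennreal_leI)
    qed
    finally show ?thesis by (simp add: Liminf_const)
  qed
  obtain N1 where N1: "\<forall>m\<ge>N1. \<forall>n\<ge>N1. (\<integral>x. \<bar>u m x - u n x\<bar> \<partial>M) < 1" using cauchy[of 1] by auto
  have "integrable M (\<lambda>x. u N1 x - l x)"
  proof (rule integrableI_bounded)
    show "(\<integral>\<^sup>+x. ennreal (norm (u N1 x - l x)) \<partial>M) < \<infinity>"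
      using key[OF _ N1, of N1] by (simp add: le_less_trans)
  qed measurable
  from Bochner_Integration.integrable_diff[OF u[of N1] this] have li: "integrable M l" by simp
  have "(\<lambda>n. \<integral>x. \<bar>u n x - l x\<bar> \<partial>M) \<longlonglongrightarrow> 0"
  proof (rule LIMSEQ_I)
    fix e :: real assume e: "e > 0"
    obtain N where N: "\<forall>m\<ge>N. \<forall>n\<ge>N. (\<integral>x. \<bar>u m x - u n x\<bar> \<partial>M) < e/2" using cauchy[of "e/2"] e by auto
    have "(\<integral>x. \<bar>u n x - l x\<bar> \<partial>M) < e" if n: "n \<ge> N" for n
    proof -
      have "ennreal (\<integral>x. \<bar>u n x - l x\<bar> \<partial>M) = (\<integral>\<^sup>+x. ennreal \<bar>u n x - l x\<bar> \<partial>M)"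
        using u li by (intro nn_integral_eq_integral[symmetric]) auto
      also have "\<dots> \<le> ennreal (e/2)" using key[OF _ N n] e by simp
      finally show ?thesis using e by simp
    qed
    then show "\<exists>no. \<forall>n\<ge>no. norm ((\<integral>x. \<bar>u n x - l x\<bar> \<partial>M) - 0) < e" by auto
  qed
  with li show thesis by (rule that)
qed

text \<open>Translating by more than the diameter of the support separates \<open>v\<close> from its translate.\<close>

lemma poincare:
  fixes v :: "'a::euclidean_space \<Rightarrow> real"
  assumes v: "integrable lborel v" and TV: "TV v \<le> ereal T" and R: "R \<ge> 0" "\<And>x. norm x > R \<Longrightarrow> v x = 0"
  shows "(\<integral>x. \<bar>v x\<bar> \<partial>lborel) \<le> (R + 1) * T"
proof -
  obtain b :: 'a where b: "b \<in> Basis" using nonempty_Basis by blast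
  define h where "h = (2 * (R + 1)) *\<^sub>R b"
  have nh: "norm h = 2 * (R + 1)" using b R by (simp add: h_def)
  have [measurable]: "v \<in> borel_measurable borel" using v by auto
  have vh: "integrable lborel (\<lambda>x. v (x + h))" by (rule lborel_integrable_shift[OF v])
  have eq: "\<bar>v (x + h) - v x\<bar> = \<bar>v (x + h)\<bar> + \<bar>v x\<bar>" for x
  proof (cases "norm x > R")
    case False
    then have "norm (x + h) > R" using norm_triangle_ineq2[of h "- x"] nh R by (simp add: add.commute)
    then show ?thesis using R by simp
  qed (use R in simp)
  have "2 * (\<integral>x. \<bar>v x\<bar> \<partial>lborel) = (\<integral>x. \<bar>v (x + h)\<bar> + \<bar>v x\<bar> \<partial>lborel)"
    using lborel_integral_shift[of "\<lambda>x. \<bar>v x\<bar>" h] v vh by simp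
  also have "\<dots> = (\<integral>x. \<bar>v (x + h) - v x\<bar> \<partial>lborel)" by (simp add: eq)
  also have "\<dots> \<le> 2 * (R + 1) * T" using translation_estimate[OF v TV, of h] nh by simp
  finally have "2 * (\<integral>x. \<bar>v x\<bar> \<partial>lborel) \<le> 2 * ((R + 1) * T)" by (simp only: mult.assoc)
  then show ?thesis by linarith
qed

lemma conv_bound:
  fixes v \<rho> :: "'a::euclidean_space \<Rightarrow> real"
  assumes v: "integrable lborel v" and \<rho>: "test_fun \<rho>" "\<And>x. \<bar>\<rho> x\<bar> \<le> B"
  shows "\<bar>conv v \<rho> x\<bar> \<le> (\<integral>x. \<bar>v x\<bar> \<partial>lborel) * B"
proof -
  have "\<bar>conv v \<rho> x\<bar> \<le> (\<integral>y. \<bar>v y * \<rho> (x - y)\<bar> \<partial>lborel)"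
    unfolding conv_def by (rule integral_abs_bound)
  also have "\<dots> \<le> (\<integral>y. \<bar>v y\<bar> * B \<partial>lborel)"
    using v \<rho>(2)
    by (intro integral_mono integrable_abs conv_integrable[OF v \<rho>(1)]) (auto simp: abs_mult intro!: mult_left_mono)
  finally show ?thesis by simp
qed

lemma conv_Lipschitz:
  fixes v \<rho> :: "'a::euclidean_space \<Rightarrow> real"
  assumes v: "integrable lborel v" and \<rho>: "test_fun \<rho>" "\<And>x y. \<bar>\<rho> x - \<rho> y\<bar> \<le> M * norm (x - y)"
  shows "\<bar>conv v \<rho> x - conv v \<rho> x'\<bar> \<le> (\<integral>x. \<bar>v x\<bar> \<partial>lborel) * (M * norm (x - x'))"
proof -
  have "conv v \<rho> x - conv v \<rho> x' = (\<integral>y. v y * (\<rho> (x - y) - \<rho> (x' - y)) \<partial>lborel)"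
    using conv_integrable[OF v \<rho>(1)] by (simp add: conv_def right_diff_distrib)
  also have "\<bar>\<dots>\<bar> \<le> (\<integral>y. \<bar>v y * (\<rho> (x - y) - \<rho> (x' - y))\<bar> \<partial>lborel)"
    by (rule integral_abs_bound)
  also have "\<dots> \<le> (\<integral>y. \<bar>v y\<bar> * (M * norm (x - x')) \<partial>lborel)"
  proof (rule integral_mono)
    show "integrable lborel (\<lambda>y. \<bar>v y * (\<rho> (x - y) - \<rho> (x' - y))\<bar>)"
      using conv_integrable[OF v \<rho>(1)] by (simp add: right_diff_distrib)
    show "\<bar>v y * (\<rho> (x - y) - \<rho> (x' - y))\<bar> \<le> \<bar>v y\<bar> * (M * norm (x - x'))" for y
      using \<rho>(2)[of "x - y" "x' - y"] by (simp add: abs_mult mult_left_mono)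
  qed (use v in auto)
  finally show ?thesis by simp
qed

text \<open>Rellich's theorem for functions of bounded variation with common bounded support. For each kernel the
mollified functions \<open>w k n\<close> are uniformly bounded and equicontinuous in \<open>n\<close>. A diagonal subsequence makes
all of them converge at the points of a countable dense set, hence everywhere, hence in \<open>L\<^sup>1\<close>. Since
the mollifications are uniformly close to \<open>v n\<close>, that subsequence of \<open>v n\<close> is a Cauchy sequence.\<close>

lemma BV_compactness:
  fixes v :: "nat \<Rightarrow> 'a::euclidean_space \<Rightarrow> real"
  assumes v: "\<And>n. integrable lborel (v n)" and TV: "\<And>n. TV (v n) \<le> ereal T"
    and R: "R \<ge> 0" "\<And>n x. norm x > R \<Longrightarrow> v n x = 0"
  obtains r :: "nat \<Rightarrow> nat" and l where "strict_mono r" "integrable lborel l"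
    "(\<lambda>n. \<integral>x. \<bar>v (r n) x - l x\<bar> \<partial>lborel) \<longlonglongrightarrow> 0"
proof -
  have "(0::ereal) \<le> ereal T" using TV_nonneg TV order_trans by blast
  then have T: "T \<ge> 0" by simp
  define C where "C = (R + 1) * T"
  have C0: "C \<ge> 0" using R T by (simp add: C_def)
  have C: "(\<integral>x. \<bar>v n x\<bar> \<partial>lborel) \<le> C" for n unfolding C_def by (rule poincare[OF v TV R])
  define w where "w k n = conv (v n) (mollifier k)" for k n
  have "\<exists>B>0. \<forall>x. \<bar>mollifier k (x::'a)\<bar> \<le> B" for k
  proof -
    obtain B where B: "B \<ge> 0" "\<And>x. norm (mollifier k (x::'a) :: real) \<le> B"
      by (rule test_fun_bounded[OF test_fun_mollifier]) blast
    then show ?thesis by (intro exI[of _ "B + 1"]) (auto intro: order_trans[of _ B])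
  qed
  then obtain B where B: "\<And>k. B k > 0" "\<And>k x. \<bar>mollifier k (x::'a)\<bar> \<le> B k" by metis
  have "\<exists>M\<ge>0. \<forall>x y. \<bar>mollifier k (x::'a) - mollifier k y\<bar> \<le> M * norm (x - y)" for k
    by (rule test_fun_deriv_bound[OF test_fun_mollifier[of k]]) auto
  then obtain L where L: "\<And>k. L k \<ge> 0" "\<And>k x y. \<bar>mollifier k (x::'a) - mollifier k y\<bar> \<le> L k * norm (x - y)"
    by metis
  have wB: "\<bar>w k n x\<bar> \<le> C * B k" for k n x
  proof -
    have "\<bar>w k n x\<bar> \<le> (\<integral>x. \<bar>v n x\<bar> \<partial>lborel) * B k"
      unfolding w_def by (rule conv_bound[OF v test_fun_mollifier B(2)])
    also have "\<dots> \<le> C * B k" using C B(1)[of k] by (intro mult_right_mono) auto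
    finally show ?thesis .
  qed
  have wL: "\<bar>w k n x - w k n y\<bar> \<le> C * L k * norm (x - y)" for k n x y
  proof -
    have "\<bar>w k n x - w k n y\<bar> \<le> (\<integral>x. \<bar>v n x\<bar> \<partial>lborel) * (L k * norm (x - y))"
      unfolding w_def by (rule conv_Lipschitz[OF v test_fun_mollifier L(2)])
    also have "\<dots> \<le> C * (L k * norm (x - y))" using C L(1)[of k] by (intro mult_right_mono) auto
    finally show ?thesis by (simp only: mult.assoc)
  qed
  obtain D :: "'a set" where D: "countable D" "\<And>X. open X \<Longrightarrow> X \<noteq> {} \<Longrightarrow> \<exists>d\<in>D. d \<in> X"
    by (rule countable_dense_setE) blast
  \<comment> \<open>Scaled so that one bound serves all kernels.\<close>
  define f where "f n p = w (fst p) n (snd p) / (C * B (fst p) + 1)" for n and p :: "nat \<times> 'a"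
  have pos: "C * B k + 1 > 0" for k using C0 B(1)[of k] by (simp add: add_nonneg_pos)
  have f1: "norm (f n p) \<le> 1" for n p
  proof -
    have "\<bar>w (fst p) n (snd p)\<bar> \<le> C * B (fst p) + 1" using wB[of "fst p" n "snd p"] by simp
    then show ?thesis using pos[of "fst p"] by (simp add: f_def abs_divide divide_le_eq)
  qed
  have cS: "countable ((UNIV :: nat set) \<times> D)" using D(1) by simp
  obtain r :: "nat \<Rightarrow> nat" where r: "strict_mono r"
    and conv: "\<And>p. p \<in> UNIV \<times> D \<Longrightarrow> \<exists>l. (\<lambda>n. f (r n) p) \<longlonglongrightarrow> l"
    using function_convergent_subsequence[OF cS, of f 1] f1 by blast
  have convD: "convergent (\<lambda>n. w k (r n) q)" if qD: "q \<in> D" for k q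
  proof -
    obtain l where "(\<lambda>n. f (r n) (k, q)) \<longlonglongrightarrow> l" using conv[of "(k, q)"] qD by auto
    then have "(\<lambda>n. (C * B k + 1) * f (r n) (k, q)) \<longlonglongrightarrow> (C * B k + 1) * l" by (intro tendsto_intros)
    then show ?thesis using pos[of k] by (auto simp: f_def convergent_def)
  qed
  have convx: "convergent (\<lambda>n. w k (r n) x)" for k x
  proof (rule real_Cauchy_convergent, rule metric_CauchyI)
    fix e :: real assume e: "e > 0"
    define \<delta> where "\<delta> = e / (4 * (C * L k + 1))"
    have CL: "C * L k + 1 > 0" using C0 L(1)[of k] by (simp add: add_nonneg_pos)
    then have \<delta>: "\<delta> > 0" using e by (simp add: \<delta>_def)
    have "\<exists>d\<in>D. d \<in> ball x \<delta>" using \<delta> by (intro D(2)) auto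
    then obtain q where q: "q \<in> D" "norm (x - q) < \<delta>" by (auto simp: dist_norm)
    have close: "\<bar>w k n x - w k n q\<bar> \<le> e/4" for n
    proof -
      have "\<bar>w k n x - w k n q\<bar> \<le> C * L k * norm (x - q)" by (rule wL)
      also have "\<dots> \<le> (C * L k + 1) * \<delta>" using q C0 L(1)[of k] by (intro mult_mono) auto
      also have "\<dots> = e/4" using CL unfolding \<delta>_def by (simp only: times_divide_eq_right mult_divide_mult_cancel_left_if mult.commute[of 4]) simp
      finally show ?thesis .
    qed
    have "Cauchy (\<lambda>n. w k (r n) q)" using convD[OF q(1)] by (rule convergent_Cauchy)
    from metric_CauchyD[OF this, of "e/4"] e
    obtain N where N: "\<forall>m\<ge>N. \<forall>n\<ge>N. dist (w k (r m) q) (w k (r n) q) < e/4" by auto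
    have "dist (w k (r m) x) (w k (r n) x) < e" if "m \<ge> N" "n \<ge> N" for m n
    proof -
      have "dist (w k (r m) q) (w k (r n) q) < e/4" using N that by blast
      then show ?thesis using close[of "r m"] close[of "r n"] e unfolding dist_real_def by linarith
    qed
    then show "\<exists>N. \<forall>m\<ge>N. \<forall>n\<ge>N. dist (w k (r m) x) (w k (r n) x) < e" by blast
  qed
  define W where "W k x = lim (\<lambda>n. w k (r n) x)" for k x
  have Wlim: "(\<lambda>n. w k (r n) x) \<longlonglongrightarrow> W k x" for k x
    using convx[of k x] by (simp add: W_def convergent_LIMSEQ_iff)
  have wi: "integrable lborel (w k n)" for k n
    unfolding w_def by (intro conv_integrable_lborel v test_fun_mollifier)
  have [measurable]: "w k n \<in> borel_measurable borel" for k n using wi[of k n] by auto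
  have [measurable]: "W k \<in> borel_measurable borel" for k
    unfolding W_def[abs_def] by measurable
  have w0: "w k n x = 0" if "norm x > R + 1" for k n x
  proof -
    have z: "v n y * mollifier k (x - y) = 0" for y
    proof (cases "norm y > R")
      case False
      then have "norm (x - y) > 1" using norm_triangle_ineq2[of x y] that by simp
      moreover have "1 / real (Suc k) \<le> 1" by simp
      ultimately have "mollifier k (x - y) = 0" using mollifier_support[of k "x - y"] by linarith
      then show ?thesis by simp
    qed (use R in simp)
    show ?thesis unfolding w_def conv_def z by simp
  qed
  have dom: "integrable lborel (\<lambda>x::'a. indicator (cball 0 (R + 1)) x * (2 * (C * B k)))" for k
    using borel_integrable_compact[of "cball (0::'a) (R + 1)" "\<lambda>x. 2 * (C * B k)"] by simp
  have WB: "\<bar>W k x\<bar> \<le> C * B k" for k x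
    using tendsto_rabs[OF Wlim[of k x]] by (rule LIMSEQ_le_const2) (auto intro: wB)
  have W0: "W k x = 0" if "norm x > R + 1" for k x
    using Wlim[of k x] w0[OF that] by (simp add: LIMSEQ_const_iff)
  have bd: "\<bar>w k n x - W k x\<bar> \<le> indicator (cball 0 (R + 1)) x * (2 * (C * B k))" for k n x
  proof (cases "x \<in> cball 0 (R + 1)")
    case True
    then show ?thesis using wB[of k n x] WB[of k x] by simp
  next
    case False
    then show ?thesis using w0 W0 by simp
  qed
  have W1: "(\<lambda>n. \<integral>x. \<bar>w k (r n) x - W k x\<bar> \<partial>lborel) \<longlonglongrightarrow> 0" for k
  proof -
    have "(\<lambda>n. \<integral>x. \<bar>w k (r n) x - W k x\<bar> \<partial>lborel) \<longlonglongrightarrow> (\<integral>x. 0 \<partial>(lborel :: 'a measure))"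
    proof (rule integral_dominated_convergence[OF _ _ dom[of k]])
      show "AE x in lborel. (\<lambda>n. \<bar>w k (r n) x - W k x\<bar>) \<longlonglongrightarrow> 0"
      proof (rule AE_I2)
        fix x
        have "(\<lambda>n. \<bar>w k (r n) x - W k x\<bar>) \<longlonglongrightarrow> \<bar>W k x - W k x\<bar>" by (intro tendsto_intros Wlim)
        then show "(\<lambda>n. \<bar>w k (r n) x - W k x\<bar>) \<longlonglongrightarrow> 0" by simp
      qed
    qed (use bd in auto)
    then show ?thesis by simp
  qed
  have dwW: "integrable lborel (\<lambda>x. w k n x - W k x)" for k n
  proof (rule Bochner_Integration.integrable_bound[OF dom[of k]])
    show "AE x in lborel. norm (w k n x - W k x) \<le> norm (indicator (cball 0 (R + 1)) x * (2 * (C * B k)))"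
      unfolding real_norm_def by (intro AE_I2 order_trans[OF bd abs_ge_self])
  qed measurable
  have vw: "(\<integral>x. \<bar>w k n x - v n x\<bar> \<partial>lborel) \<le> 1 / real (Suc k) * T" for k n
    unfolding w_def
    by (rule conv_L1_close[OF v test_fun_mollifier mollifier_nonneg mollifier_integral mollifier_support TV])
  have "\<exists>N. \<forall>m\<ge>N. \<forall>n\<ge>N. (\<integral>x. \<bar>v (r m) x - v (r n) x\<bar> \<partial>lborel) < e" if e: "e > 0" for e
  proof -
    have "e / (4 * (T + 1)) > 0" using e T by simp
    then obtain k where k: "1 / real (Suc k) < e / (4 * (T + 1))" using nat_approx_posE by blast
    have "1 / real (Suc k) * T \<le> e / (4 * (T + 1)) * (T + 1)" using k T e by (intro mult_mono) auto
    also have "\<dots> = e / 4"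
    proof -
      have "e / (4 * c) * c = e / 4" if "c \<noteq> 0" for c :: real using that by simp
      from this[of "T + 1"] show ?thesis using T by (simp del: times_divide_eq_left)
    qed
    finally have kT: "1 / real (Suc k) * T \<le> e / 4" .
    obtain N where N: "\<And>n. n \<ge> N \<Longrightarrow> (\<integral>x. \<bar>w k (r n) x - W k x\<bar> \<partial>lborel) < e/4"
      using order_tendstoD(2)[OF W1[of k], of "e/4"] e by (auto simp: eventually_sequentially)
    have "(\<integral>x. \<bar>v (r m) x - v (r n) x\<bar> \<partial>lborel) < e" if "m \<ge> N" "n \<ge> N" for m n
    proof -
      have i: "integrable lborel (\<lambda>x. \<bar>w k (r j) x - v (r j) x\<bar>)" "integrable lborel (\<lambda>x. \<bar>w k (r j) x - W k x\<bar>)" for j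
        using wi v dwW by auto
      have "(\<integral>x. \<bar>v (r m) x - v (r n) x\<bar> \<partial>lborel) \<le>
        (\<integral>x. (\<bar>w k (r m) x - v (r m) x\<bar> + \<bar>w k (r m) x - W k x\<bar>) + (\<bar>w k (r n) x - W k x\<bar> + \<bar>w k (r n) x - v (r n) x\<bar>) \<partial>lborel)"
        using v i by (intro integral_mono) auto
      also have "\<dots> = ((\<integral>x. \<bar>w k (r m) x - v (r m) x\<bar> \<partial>lborel) + (\<integral>x. \<bar>w k (r m) x - W k x\<bar> \<partial>lborel))
          + ((\<integral>x. \<bar>w k (r n) x - W k x\<bar> \<partial>lborel) + (\<integral>x. \<bar>w k (r n) x - v (r n) x\<bar> \<partial>lborel))"
        using i by simp
      also have "\<dots> < e" using vw[of k "r m"] vw[of k "r n"] N[OF that(1)] N[OF that(2)] kT by linarith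
      finally show ?thesis .
    qed
    then show ?thesis by blast
  qed
  then obtain l where "integrable lborel l" "(\<lambda>n. \<integral>x. \<bar>v (r n) x - l x\<bar> \<partial>lborel) \<longlonglongrightarrow> 0"
    by (rule L1_complete[of lborel "\<lambda>n. v (r n)", OF v]) blast
  with r show thesis by (rule that)
qed

lemma dist_grad_tendsto:
  fixes v :: "nat \<Rightarrow> 'a::euclidean_space \<Rightarrow> real"
  assumes v: "\<And>n. integrable lborel (v n)" "integrable lborel l"
    and lim: "(\<lambda>n. \<integral>x. \<bar>v n x - l x\<bar> \<partial>lborel) \<longlonglongrightarrow> 0" and \<phi>: "test_fun \<phi>"
  shows "(\<lambda>n. dist_grad (v n) \<phi>) \<longlonglongrightarrow> dist_grad l \<phi>"
proof -
  have g: "test_fun (divergence \<phi>)" by (rule test_fun_divergence[OF \<phi>])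
  obtain B where B: "B \<ge> 0" "\<And>x. norm (divergence \<phi> x) \<le> B" by (rule test_fun_bounded[OF g]) blast
  have m: "v n \<in> borel_measurable borel" "l \<in> borel_measurable borel" for n using v by auto
  have "\<bar>dist_grad (v n) \<phi> - dist_grad l \<phi>\<bar> \<le> (\<integral>x. \<bar>v n x - l x\<bar> \<partial>lborel) * B" for n
  proof -
    have "dist_grad (v n) \<phi> - dist_grad l \<phi> = - (\<integral>x. (v n x - l x) * divergence \<phi> x \<partial>lborel)"
      using integrable_mult_test[OF v(1)[of n] g] integrable_mult_test[OF v(2) g] m \<phi>
      by (simp add: dist_grad_lborel left_diff_distrib)
    also have "\<bar>\<dots>\<bar> \<le> (\<integral>x. \<bar>(v n x - l x) * divergence \<phi> x\<bar> \<partial>lborel)"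
      unfolding abs_minus_cancel by (rule integral_abs_bound)
    also have "\<dots> \<le> (\<integral>x. \<bar>v n x - l x\<bar> * B \<partial>lborel)"
    proof (rule integral_mono)
      show "integrable lborel (\<lambda>x. \<bar>(v n x - l x) * divergence \<phi> x\<bar>)"
        by (intro integrable_abs integrable_mult_test g Bochner_Integration.integrable_diff v)
      show "\<bar>(v n x - l x) * divergence \<phi> x\<bar> \<le> \<bar>v n x - l x\<bar> * B" for x
        using B(2)[of x] by (simp add: abs_mult mult_left_mono)
    qed (use v in auto)
    finally show ?thesis by simp
  qed
  note le = this
  have "(\<lambda>n. dist_grad (v n) \<phi> - dist_grad l \<phi>) \<longlonglongrightarrow> 0"
  proof (rule Lim_null_comparison)
    show "\<forall>\<^sub>F n in sequentially. norm (dist_grad (v n) \<phi> - dist_grad l \<phi>) \<le> (\<integral>x. \<bar>v n x - l x\<bar> \<partial>lborel) * B"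
      unfolding real_norm_def by (rule always_eventually, rule allI, rule le)
    show "(\<lambda>n. (\<integral>x. \<bar>v n x - l x\<bar> \<partial>lborel) * B) \<longlonglongrightarrow> 0"
      using tendsto_mult_left_zero[OF lim] .
  qed
  then show ?thesis by (simp add: LIM_zero_iff)
qed

lemma TV_lower_semicontinuous:
  fixes v :: "nat \<Rightarrow> 'a::euclidean_space \<Rightarrow> real"
  assumes v: "\<And>n. integrable lborel (v n)" "integrable lborel l"
    and lim: "(\<lambda>n. \<integral>x. \<bar>v n x - l x\<bar> \<partial>lborel) \<longlonglongrightarrow> 0"
    and TV: "\<And>n. TV (v n) \<le> ereal (c n)" and c: "c \<longlonglongrightarrow> m"
  shows "TV l \<le> ereal m"
proof (rule TV_leI)
  fix \<phi> :: "'a \<Rightarrow> 'a" assume \<phi>: "test_fun \<phi>" "\<And>x. norm (\<phi> x) \<le> 1"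
  have "dist_grad (v n) \<phi> \<le> c n" for n
    using order_trans[OF dist_grad_le_TV[OF \<phi>] TV[of n]] by simp
  then have "dist_grad l \<phi> \<le> m"
    using LIMSEQ_le[OF dist_grad_tendsto[OF v lim \<phi>(1)] c] by blast
  then show "ereal (dist_grad l \<phi>) \<le> ereal m" by simp
qed

lemma TV_cmult:
  assumes "TV v \<le> ereal T" shows "TV (\<lambda>x. c * v x) \<le> ereal (\<bar>c\<bar> * T)"
proof (rule TV_leI)
  fix \<phi> :: "'a \<Rightarrow> 'a" assume \<phi>: "test_fun \<phi>" "\<And>x. norm (\<phi> x) \<le> 1"
  have "\<bar>dist_grad v \<phi>\<bar> \<le> 1 * T" using \<phi> by (intro dist_grad_bound[OF assms]) auto
  then have "\<bar>c * dist_grad v \<phi>\<bar> \<le> \<bar>c\<bar> * T" by (simp add: abs_mult mult_left_mono)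
  then show "ereal (dist_grad (\<lambda>x. c * v x) \<phi>) \<le> ereal (\<bar>c\<bar> * T)" by (simp add: dist_grad_cmult)
qed

lemma TV_add:
  assumes "integrable lebesgue v" "integrable lebesgue w" "TV v \<le> ereal S" "TV w \<le> ereal T"
  shows "TV (\<lambda>x. v x + w x) \<le> ereal (S + T)"
proof (rule TV_leI)
  fix \<phi> :: "'a \<Rightarrow> 'a" assume \<phi>: "test_fun \<phi>" "\<And>x. norm (\<phi> x) \<le> 1"
  have "\<bar>dist_grad v \<phi>\<bar> \<le> 1 * S" "\<bar>dist_grad w \<phi>\<bar> \<le> 1 * T"
    using \<phi> assms by (intro dist_grad_bound; auto)+
  then show "ereal (dist_grad (\<lambda>x. v x + w x) \<phi>) \<le> ereal (S + T)" using \<phi> assms by (simp add: dist_grad_add)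
qed

lemma integrable_lebesgueI: "integrable lborel (f :: 'a::euclidean_space \<Rightarrow> real) \<Longrightarrow> integrable lebesgue f"
  using integrable_completion[of f lborel] borel_measurable_integrable[of lborel f] by blast

lemma integral_lebesgue_eq: "(f :: 'a::euclidean_space \<Rightarrow> real) \<in> borel_measurable borel \<Longrightarrow> integral\<^sup>L lebesgue f = integral\<^sup>L lborel f"
  by (intro integral_completion) simp

lemma TV_conv_le:
  fixes v \<rho> :: "'a::euclidean_space \<Rightarrow> real"
  assumes v: "integrable lborel v" and \<rho>: "test_fun \<rho>"
  shows "TV (conv v \<rho>) \<le> ereal (\<integral>x. norm (conv_grad v \<rho> x) \<partial>lborel)"
proof (rule TV_leI)
  fix \<phi> :: "'a \<Rightarrow> 'a" assume \<phi>: "test_fun \<phi>" "\<And>x. norm (\<phi> x) \<le> 1"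
  have [measurable]: "conv v \<rho> \<in> borel_measurable borel"
    by (intro borel_measurable_continuous_onI conv_continuous v \<rho>)
  have i: "integrable lborel (\<lambda>x. norm (conv_grad v \<rho> x))" by (intro integrable_norm conv_grad_integrable v \<rho>)
  have le: "\<bar>conv_grad v \<rho> x \<bullet> \<phi> x\<bar> \<le> norm (conv_grad v \<rho> x)" for x
    using order_trans[OF Cauchy_Schwarz_ineq2 mult_left_mono[OF \<phi>(2) norm_ge_zero]] by simp
  have "dist_grad (conv v \<rho>) \<phi> = (\<integral>x. conv_grad v \<rho> x \<bullet> \<phi> x \<partial>lborel)"
    using integral_by_parts[OF conv_deriv_grad[OF v \<rho>] _ \<phi>(1)] \<phi>(1)
    by (simp add: dist_grad_lborel continuous_intros conv_grad_continuous v \<rho>)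
  also have "\<dots> \<le> (\<integral>x. norm (conv_grad v \<rho> x) \<partial>lborel)"
  proof (rule integral_mono[OF _ i])
    have [measurable]: "conv_grad v \<rho> \<in> borel_measurable borel" "\<phi> \<in> borel_measurable borel"
      by (intro borel_measurable_continuous_onI conv_grad_continuous v \<rho> test_fun_borel \<phi>)+
    show "integrable lborel (\<lambda>x. conv_grad v \<rho> x \<bullet> \<phi> x)"
      by (rule Bochner_Integration.integrable_bound[OF i]) (use le in auto)
    show "conv_grad v \<rho> x \<bullet> \<phi> x \<le> norm (conv_grad v \<rho> x)" for x using le[of x] by simp
  qed
  finally show "ereal (dist_grad (conv v \<rho>) \<phi>) \<le> ereal (\<integral>x. norm (conv_grad v \<rho> x) \<partial>lborel)" by simp
qed

text \<open>Cut-off functions of bounded variation: mollified indicators of neighbourhoods of \<open>K\<close>.\<close>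

lemma BV_cutoff:
  fixes K U :: "'a::euclidean_space set"
  assumes K: "compact K" and U: "open U" "K \<subseteq> U"
  obtains w T where "integrable lborel w" "TV w \<le> ereal T" "\<And>x. 0 \<le> w x" "\<And>x. x \<in> K \<Longrightarrow> w x = 1"
    "\<And>x. x \<notin> U \<Longrightarrow> w x = 0"
proof -
  obtain e where e: "e > 0" "(\<Union>x\<in>K. ball x e) \<subseteq> U"
    by (rule compact_subset_open_imp_ball_epsilon_subset[OF K U])
  define N where "N = (\<Union>x\<in>K. ball x (e/2))"
  have "open N" unfolding N_def by auto
  then have [measurable]: "N \<in> sets borel" by simp
  have "bounded (\<Union>x\<in>K. ball x (e/2))"
  proof -
    obtain r where r: "\<And>x. x \<in> K \<Longrightarrow> norm x \<le> r" using compact_imp_bounded[OF K] by (auto simp: bounded_iff)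
    show ?thesis unfolding bounded_iff
    proof (intro exI[of _ "r + e/2"] ballI)
      fix y assume "y \<in> (\<Union>x\<in>K. ball x (e/2))"
      then obtain x where "x \<in> K" "norm (x - y) < e/2" by (auto simp: dist_norm)
      then show "norm y \<le> r + e/2" using r[of x] norm_triangle_ineq4[of x "x - y"] by simp
    qed
  qed
  then have "emeasure lborel N < \<infinity>" unfolding N_def[symmetric] by (rule emeasure_bounded_finite)
  then have v: "integrable lborel (indicator N :: 'a \<Rightarrow> real)" by (simp add: integrable_indicator_iff)
  obtain k where k: "1 / real (Suc k) < e/2" using nat_approx_posE[of "e/2"] e by auto
  let ?\<rho> = "mollifier k :: 'a \<Rightarrow> real"
  have supp: "?\<rho> z = 0" if "norm z \<ge> e/2" for z using mollifier_support[of k z] that k by force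
  have [measurable]: "?\<rho> \<in> borel_measurable borel" by (rule test_fun_borel[OF test_fun_mollifier])
  show thesis
  proof (rule that)
    show "integrable lborel (conv (indicator N) ?\<rho>)" by (intro conv_integrable_lborel v test_fun_mollifier)
    show "TV (conv (indicator N) ?\<rho>) \<le> ereal (\<integral>x. norm (conv_grad (indicator N) ?\<rho> x) \<partial>lborel)"
      by (intro TV_conv_le v test_fun_mollifier)
    show "0 \<le> conv (indicator N) ?\<rho> x" for x unfolding conv_def by (simp add: mollifier_nonneg)
    show "conv (indicator N) ?\<rho> x = 1" if x: "x \<in> K" for x
    proof -
      have "indicator N y * ?\<rho> (x - y) = ?\<rho> (x - y)" for y
        using x supp[of "x - y"] by (auto simp: N_def indicator_def dist_norm not_less)
      then have "conv (indicator N) ?\<rho> x = (\<integral>y. ?\<rho> (x - y) \<partial>lborel)" by (simp only: conv_def)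
      then show ?thesis by (simp add: lborel_integral_reflect mollifier_integral)
    qed
    show "conv (indicator N) ?\<rho> x = 0" if x: "x \<notin> U" for x
    proof -
      have "indicator N y * ?\<rho> (x - y) = 0" for y
      proof (cases "y \<in> N \<and> norm (x - y) < e/2")
        case True
        then obtain z where z: "z \<in> K" "dist z y < e/2" by (auto simp: N_def)
        then have "dist z x < e" using True dist_triangle[of z x y] by (simp add: dist_norm norm_minus_commute[of y x])
        then have "x \<in> U" using e(2) z(1) by (auto simp: subset_eq)
        then show ?thesis using x by blast
      next
        case False
        then show ?thesis using supp[of "x - y"] by (auto simp: indicator_def not_less)
      qed
      then show ?thesis by (simp only: conv_def Bochner_Integration.integral_zero)
    qed
  qed
qed

lemma divergence_outside_support:
  assumes "x \<notin> closure {x. \<phi> x \<noteq> 0}" shows "divergence \<phi> x = 0"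
proof -
  let ?S = "closure {x. \<phi> x \<noteq> 0}"
  have z: "\<phi> y = 0" if "y \<in> - ?S" for y
    using that closure_subset[of "{x. \<phi> x \<noteq> 0}"] by (metis (mono_tags) ComplD mem_Collect_eq subsetD)
  have "(\<phi> has_derivative (\<lambda>h. 0)) (at x)"
  proof (rule has_derivative_transform_within_open[OF has_derivative_const])
    show "open (- ?S)" by (rule open_Compl[OF closed_closure])
    show "x \<in> - ?S" using assms by simp
    show "0 = \<phi> y" if "y \<in> - ?S" for y using z[OF that] by (rule sym)
  qed
  then have "frechet_derivative \<phi> (at x) = (\<lambda>h. 0)" by (rule frechet_derivative_at[symmetric])
  then show ?thesis unfolding divergence_def by simp
qed

lemma dist_grad_eq_0_if_constant:
  assumes v: "\<And>x. x \<in> U \<Longrightarrow> v x = c" and \<phi>: "\<phi> \<in> test_fields U"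
  shows "dist_grad v \<phi> = 0"
proof -
  have t: "test_fun \<phi>" and s: "closure {x. \<phi> x \<noteq> 0} \<subseteq> U" using \<phi> by (auto simp: test_fields_iff)
  have "v x * divergence \<phi> x = c * divergence \<phi> x" for x
    using v[of x] divergence_outside_support[of x \<phi>] s by auto
  then have "dist_grad v \<phi> = dist_grad (\<lambda>_. c) \<phi>" by (simp only: dist_grad_def)
  also have "\<dots> = 0" using t integral_divergence_eq_0[OF t] by (simp add: dist_grad_lborel)
  finally show ?thesis .
qed

section \<open>Existence of a minimizer\<close>

text \<open>The distributional gradient of \<open>v\<close> vanishes on \<open>U\<close>, which is meant to be open.\<close>

definition gradient_free :: "('a::euclidean_space \<Rightarrow> real) \<Rightarrow> 'a set \<Rightarrow> bool" where
  "gradient_free v U \<longleftrightarrow> (\<forall>\<phi>\<in>test_fields U. dist_grad v \<phi> = 0)"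

lemma measure_pos_open:
  fixes S :: "'a::euclidean_space set"
  assumes "open S" "bounded S" "S \<noteq> {}"
  shows "measure lborel S > 0"
proof -
  have "emeasure lborel S < \<infinity>" by (rule emeasure_bounded_finite[OF assms(2)])
  moreover have "emeasure lborel S \<noteq> 0"
    using open_not_negligible[OF assms(1,3)] assms(1) by (auto simp: negligible_iff_null_sets null_sets_def)
  ultimately show ?thesis by (simp add: measure_def enn2real_positive_iff zero_less_iff_neq_zero)
qed

text \<open>The constraints for functions that vanish everywhere, not just almost everywhere, outside \<open>\<Omega>\<close>.\<close>

lemma BV_diamond_iff:
  fixes v :: "real^2 \<Rightarrow> real"
  assumes v: "integrable lborel v" "\<And>x. x \<notin> \<Omega> \<Longrightarrow> v x = 0"
    and O: "open \<Omega>" "open \<Omega>s" "bounded \<Omega>s" "\<Omega>s \<noteq> {}"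
  shows "v \<in> BV_diamond \<Omega> \<Omega>s \<longleftrightarrow> TV v < \<infinity> \<and> (\<integral>x. v x \<partial>lborel) = 0 \<and>
    (\<integral>x. indicator \<Omega>s x * v x \<partial>lborel) = measure lborel \<Omega>s \<and> gradient_free v \<Omega>s"
proof -
  have [measurable]: "v \<in> borel_measurable borel" "\<Omega> \<in> sets borel" "\<Omega>s \<in> sets borel" using v O by auto
  have "(\<lambda>x. indicator \<Omega> x *\<^sub>R v x) = v" using v(2) by (intro ext) (auto simp: indicator_def)
  then have 1: "(LINT x:\<Omega>|lebesgue. v x) = (\<integral>x. v x \<partial>lborel)"
    by (simp add: set_lebesgue_integral_def integral_lebesgue_eq)
  have 2: "(LINT x:\<Omega>s|lebesgue. v x) = (\<integral>x. indicator \<Omega>s x * v x \<partial>lborel)"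
    by (simp add: set_lebesgue_integral_def integral_lebesgue_eq)
  have 3: "measure lebesgue \<Omega>s = measure lborel \<Omega>s" by simp
  have "measure lborel \<Omega>s > 0" by (intro measure_pos_open O)
  then show ?thesis
    unfolding BV_diamond_def BV_def gradient_free_def mem_Collect_eq 1 2 3
    using v integrable_lebesgueI[OF v(1)] by (auto simp: field_simps)
qed

lemma BV_diamond_borel:
  fixes v :: "real^2 \<Rightarrow> real"
  assumes v: "v \<in> BV_diamond \<Omega> \<Omega>s" and O: "open \<Omega>" "open \<Omega>s"
  obtains w where "w \<in> BV_diamond \<Omega> \<Omega>s" "integrable lborel w" "\<And>x. x \<notin> \<Omega> \<Longrightarrow> w x = 0" "TV w = TV v"
proof -
  have vi: "integrable lebesgue v" and v0: "AE x in lebesgue. x \<notin> \<Omega> \<longrightarrow> v x = 0"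
    using v by (auto simp: BV_diamond_def BV_def)
  have vm[measurable]: "v \<in> borel_measurable lebesgue" using vi by auto
  obtain g where g: "g \<in> borel_measurable lborel" "AE x in lborel. v x = g x"
    using completion_ex_borel_measurable_real[OF vm] by blast
  have [measurable]: "g \<in> borel_measurable borel" "\<Omega> \<in> sets borel" "\<Omega>s \<in> sets borel" using g O by auto
  define w where "w x = indicator \<Omega> x * g x" for x
  have wm[measurable]: "w \<in> borel_measurable borel" unfolding w_def[abs_def] by measurable
  have wm'[measurable]: "w \<in> borel_measurable lebesgue" by (intro measurable_completion) simp
  have "AE x in lebesgue. v x = g x" by (rule AE_completion[OF g(2)])
  then have ae: "AE x in lebesgue. v x = w x"
    using v0 by eventually_elim (auto simp: w_def indicator_def)
  have "integrable lebesgue w" using vi by (rule integrable_cong_AE_imp) (use ae in \<open>auto elim: eventually_mono\<close>)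
  then have wi: "integrable lborel w" using integrable_completion[of w lborel] wm by simp
  have w0: "w x = 0" if "x \<notin> \<Omega>" for x using that by (simp add: w_def)
  have TV: "TV w = TV v" by (rule TV_cong_AE[OF ae vm wm', symmetric])
  have "w \<in> BV_diamond \<Omega> \<Omega>s"
  proof -
    have "(LINT x:A|lebesgue. w x) = (LINT x:A|lebesgue. v x)" if [measurable]: "A \<in> sets borel" for A
    proof -
      have [measurable]: "A \<in> sets lebesgue" by simp
      show ?thesis unfolding set_lebesgue_integral_def
        by (rule integral_cong_AE) (measurable, use ae in \<open>auto elim: eventually_mono\<close>)
    qed
    moreover have "dist_grad w \<phi> = dist_grad v \<phi>" if "\<phi> \<in> test_fields \<Omega>s" for \<phi>
      using that by (intro dist_grad_cong_AE[OF ae vm wm', symmetric]) (simp add: test_fields_iff)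
    ultimately show ?thesis
      using v \<open>integrable lebesgue w\<close> w0 TV by (simp add: BV_diamond_def BV_def)
  qed
  with wi w0 TV show thesis by (intro that)
qed

text \<open>The boundaries being disjoint, the closure of \<open>\<Omega>s\<close> lies in \<open>\<Omega>\<close> and leaves room for a ball in the
difference. A cut-off function that is 1 on \<open>\<Omega>s\<close> is corrected by a multiple of one supported off
\<open>\<Omega>s\<close> to have integral zero.\<close>

lemma BV_diamond_nonempty:
  fixes \<Omega> \<Omega>s :: "(real^2) set"
  assumes O: "open \<Omega>" "bounded \<Omega>" "open \<Omega>s" "\<Omega>s \<noteq> {}" "\<Omega>s \<subseteq> \<Omega>" "frontier \<Omega>s \<inter> frontier \<Omega> = {}"
  shows "BV_diamond \<Omega> \<Omega>s \<noteq> {}"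
proof -
  have bs: "bounded \<Omega>s" using O bounded_subset by blast
  let ?K = "closure \<Omega>s"
  have K: "compact ?K" using bs by (rule compact_closure[THEN iffD2])
  have sub: "?K \<subseteq> \<Omega>"
  proof
    fix x assume x: "x \<in> ?K"
    show "x \<in> \<Omega>"
    proof (rule ccontr)
      assume n: "x \<notin> \<Omega>"
      then have "x \<notin> \<Omega>s" using O by blast
      then have "x \<in> frontier \<Omega>s" using x O(3) by (simp add: frontier_def interior_open)
      moreover have "x \<in> frontier \<Omega>" using x closure_mono[OF O(5)] n O(1) by (auto simp: frontier_def interior_open)
      ultimately show False using O(6) by blast
    qed
  qed
  have "?K \<noteq> \<Omega>"
  proof
    assume "?K = \<Omega>"
    then have "closed \<Omega>" by (metis closed_closure)
    then have "\<Omega> = {} \<or> \<Omega> = UNIV" using O(1) clopen by blast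
    then show False using O(2,4,5) not_bounded_UNIV by auto
  qed
  then obtain p where p: "p \<in> \<Omega> - ?K" using sub by blast
  have op: "open (\<Omega> - ?K)" using O by auto
  then obtain \<delta> where \<delta>: "\<delta> > 0" "cball p \<delta> \<subseteq> \<Omega> - ?K" using p open_contains_cball by blast
  obtain w1 T1 where w1: "integrable lborel w1" "TV w1 \<le> ereal T1" "\<And>x. 0 \<le> w1 x" "\<And>x. x \<in> ?K \<Longrightarrow> w1 x = 1"
    "\<And>x. x \<notin> \<Omega> \<Longrightarrow> w1 x = 0"
    by (rule BV_cutoff[OF K O(1) sub]) blast
  obtain w2 T2 where w2: "integrable lborel w2" "TV w2 \<le> ereal T2" "\<And>x. 0 \<le> w2 x" "\<And>x. x \<in> cball p \<delta> \<Longrightarrow> w2 x = 1"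
    "\<And>x. x \<notin> \<Omega> - ?K \<Longrightarrow> w2 x = 0"
    by (rule BV_cutoff[OF compact_cball op \<delta>(2)]) blast
  have pos: "(\<integral>x. w2 x \<partial>lborel) > 0"
  proof -
    have i: "integrable lborel (indicator (ball p \<delta>) :: real^2 \<Rightarrow> real)"
      using emeasure_bounded_finite[of "ball p \<delta>"] by (simp add: integrable_indicator_iff)
    have "0 < measure lborel (ball p \<delta>)" using \<delta> by (intro measure_pos_open) auto
    also have "\<dots> = (\<integral>x. indicator (ball p \<delta>) x \<partial>lborel)" by simp
    also have "\<dots> \<le> (\<integral>x. w2 x \<partial>lborel)"
    proof (rule integral_mono[OF i w2(1)])
      show "indicator (ball p \<delta>) x \<le> w2 x" for x
        using w2(3)[of x] w2(4)[of x] by (auto simp: indicator_def)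
    qed
    finally show ?thesis .
  qed
  define c where "c = - (\<integral>x. w1 x \<partial>lborel) / (\<integral>x. w2 x \<partial>lborel)"
  define v where "v x = w1 x + c * w2 x" for x
  have vi: "integrable lborel v" unfolding v_def[abs_def] using w1(1) w2(1) by simp
  have v1: "v x = 1" if "x \<in> \<Omega>s" for x
    using that w1(4)[of x] w2(5)[of x] closure_subset[of \<Omega>s] by (auto simp: v_def)
  have "TV v \<le> ereal (T1 + \<bar>c\<bar> * T2)"
    unfolding v_def[abs_def]
    using w1 w2 by (intro TV_add TV_cmult integrable_lebesgueI integrable_mult_right) auto
  then have "TV v < \<infinity>" by (rule le_less_trans) simp
  moreover have "(\<integral>x. v x \<partial>lborel) = 0" using w1(1) w2(1) pos by (simp add: v_def c_def)
  moreover have "(\<integral>x. indicator \<Omega>s x * v x \<partial>lborel) = measure lborel \<Omega>s"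
  proof -
    have "indicator \<Omega>s x * v x = indicator \<Omega>s x" for x using v1[of x] by (auto simp: indicator_def)
    then have "(\<integral>x. indicator \<Omega>s x * v x \<partial>lborel) = (\<integral>x. indicator \<Omega>s x \<partial>lborel)" by (simp only:)
    then show ?thesis using O by simp
  qed
  moreover have "gradient_free v \<Omega>s"
    unfolding gradient_free_def using dist_grad_eq_0_if_constant[of \<Omega>s v 1] v1 by blast
  moreover have "v x = 0" if "x \<notin> \<Omega>" for x using that w1(5) w2(5) by (simp add: v_def)
  ultimately have "v \<in> BV_diamond \<Omega> \<Omega>s" using BV_diamond_iff[OF vi _ O(1,3) bs O(4)] by blast
  then show ?thesis by blast
qed

lemma integral_tendsto_L1:
  fixes v :: "nat \<Rightarrow> 'a \<Rightarrow> real"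
  assumes v: "\<And>n. integrable M (v n)" "integrable M l"
    and lim: "(\<lambda>n. \<integral>x. \<bar>v n x - l x\<bar> \<partial>M) \<longlonglongrightarrow> 0" and A: "A \<in> sets M"
  shows "(\<lambda>n. \<integral>x. indicator A x * v n x \<partial>M) \<longlonglongrightarrow> (\<integral>x. indicator A x * l x \<partial>M)"
proof -
  have i: "integrable M (\<lambda>x. indicator A x * f x)" if "integrable M f" for f :: "'a \<Rightarrow> real"
    using integrable_real_mult_indicator[OF A that] by (simp add: mult.commute)
  have le: "\<bar>(\<integral>x. indicator A x * v n x \<partial>M) - (\<integral>x. indicator A x * l x \<partial>M)\<bar> \<le> (\<integral>x. \<bar>v n x - l x\<bar> \<partial>M)" for n
  proof -
    have "(\<integral>x. indicator A x * v n x \<partial>M) - (\<integral>x. indicator A x * l x \<partial>M) = (\<integral>x. indicator A x * (v n x - l x) \<partial>M)"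
      using i[OF v(1)] i[OF v(2)] by (simp add: right_diff_distrib)
    also have "\<bar>\<dots>\<bar> \<le> (\<integral>x. \<bar>indicator A x * (v n x - l x)\<bar> \<partial>M)" by (rule integral_abs_bound)
    also have "\<dots> \<le> (\<integral>x. \<bar>v n x - l x\<bar> \<partial>M)"
      using v by (intro integral_mono integrable_abs i) (auto simp: indicator_def)
    finally show ?thesis .
  qed
  have "(\<lambda>n. (\<integral>x. indicator A x * v n x \<partial>M) - (\<integral>x. indicator A x * l x \<partial>M)) \<longlonglongrightarrow> 0"
    by (rule Lim_null_comparison[OF _ lim]) (simp add: le)
  then show ?thesis by (simp add: LIM_zero_iff)
qed

lemma BV_diamond_minimizer:
  fixes \<Omega> \<Omega>s :: "(real^2) set"
  assumes O: "open \<Omega>" "bounded \<Omega>" "open \<Omega>s" "\<Omega>s \<noteq> {}" "\<Omega>s \<subseteq> \<Omega>" "frontier \<Omega>s \<inter> frontier \<Omega> = {}"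
  obtains u where "u \<in> BV_diamond \<Omega> \<Omega>s" "integrable lborel u" "\<And>x. x \<notin> \<Omega> \<Longrightarrow> u x = 0"
    "\<And>v. v \<in> BV_diamond \<Omega> \<Omega>s \<Longrightarrow> TV u \<le> TV v"
proof -
  have bs: "bounded \<Omega>s" using O bounded_subset by blast
  let ?X = "BV_diamond \<Omega> \<Omega>s"
  have ne: "?X \<noteq> {}" by (rule BV_diamond_nonempty[OF O])
  define m where "m = (INF v\<in>?X. TV v)"
  have m0: "m \<ge> 0" unfolding m_def by (intro INF_greatest TV_nonneg)
  obtain v0 where v0: "v0 \<in> ?X" using ne by blast
  then have "TV v0 < \<infinity>" by (simp add: BV_diamond_def BV_def)
  moreover have "m \<le> TV v0" unfolding m_def by (rule INF_lower[OF v0])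
  ultimately have "m < \<infinity>" by (rule le_less_trans[rotated])
  with m0 obtain mr where mr: "m = ereal mr" by (cases m) auto
  have "\<exists>v\<in>?X. TV v < ereal (mr + 1 / real (Suc n))" for n
  proof -
    have "m < ereal (mr + 1 / real (Suc n))" by (simp add: mr)
    then show ?thesis unfolding m_def by (simp add: INF_less_iff)
  qed
  then obtain v' where v': "\<And>n. v' n \<in> ?X" "\<And>n. TV (v' n) < ereal (mr + 1 / real (Suc n))" by metis
  have "\<exists>w. w \<in> ?X \<and> integrable lborel w \<and> (\<forall>x. x \<notin> \<Omega> \<longrightarrow> w x = 0) \<and> TV w = TV (v' n)" for n
    by (rule BV_diamond_borel[OF v'(1)[of n] O(1,3)]) blast
  then obtain v where v: "\<And>n. v n \<in> ?X" "\<And>n. integrable lborel (v n)" "\<And>n x. x \<notin> \<Omega> \<Longrightarrow> v n x = 0"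
    "\<And>n. TV (v n) = TV (v' n)" by metis
  have TVn: "TV (v n) \<le> ereal (mr + 1 / real (Suc n))" for n using v'(2)[of n] v(4)[of n] by simp
  have TV1: "TV (v n) \<le> ereal (mr + 1)" for n by (rule order_trans[OF TVn]) simp
  obtain R where R: "R > 0" "\<And>x. x \<in> \<Omega> \<Longrightarrow> norm x \<le> R" using O(2) by (auto simp: bounded_pos)
  have vR: "v n x = 0" if "norm x > R" for n x using R(2)[of x] v(3)[of x n] that by force
  obtain r l' where r: "strict_mono (r :: nat \<Rightarrow> nat)" and l': "integrable lborel l'"
    "(\<lambda>n. \<integral>x. \<bar>v (r n) x - l' x\<bar> \<partial>lborel) \<longlonglongrightarrow> 0"
    by (rule BV_compactness[of v "mr + 1" R]) (use v(2) TV1 R vR in auto)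
  have [measurable]: "\<Omega> \<in> sets borel" "\<Omega>s \<in> sets borel" using O by auto
  define u where "u x = indicator \<Omega> x * l' x" for x
  have ui: "integrable lborel u"
    unfolding u_def[abs_def] using integrable_real_mult_indicator[of \<Omega> lborel l'] l'(1) by (simp add: mult.commute)
  have u0: "u x = 0" if "x \<notin> \<Omega>" for x using that by (simp add: u_def)
  have lim: "(\<lambda>n. \<integral>x. \<bar>v (r n) x - u x\<bar> \<partial>lborel) \<longlonglongrightarrow> 0"
  proof (rule tendsto_sandwich[OF _ _ tendsto_const l'(2)])
    have "(\<integral>x. \<bar>v (r n) x - u x\<bar> \<partial>lborel) \<le> (\<integral>x. \<bar>v (r n) x - l' x\<bar> \<partial>lborel)" for n
    proof (rule integral_mono)
      show "\<bar>v (r n) x - u x\<bar> \<le> \<bar>v (r n) x - l' x\<bar>" for x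
        using v(3)[of x "r n"] by (cases "x \<in> \<Omega>") (auto simp: u_def)
    qed (use v(2) ui l'(1) in auto)
    then show "\<forall>\<^sub>F n in sequentially. (\<integral>x. \<bar>v (r n) x - u x\<bar> \<partial>lborel) \<le> (\<integral>x. \<bar>v (r n) x - l' x\<bar> \<partial>lborel)"
      by simp
  qed auto
  have vX: "(\<integral>x. v n x \<partial>lborel) = 0" "(\<integral>x. indicator \<Omega>s x * v n x \<partial>lborel) = measure lborel \<Omega>s"
    "gradient_free (v n) \<Omega>s" for n
    using v(1)[of n] BV_diamond_iff[OF v(2,3) O(1,3) bs O(4)] by auto
  have "(\<lambda>n. mr + 1 / real (Suc (r n))) \<longlonglongrightarrow> mr + 0"
    using LIMSEQ_subseq_LIMSEQ[OF LIMSEQ_inverse_real_of_nat r] by (intro tendsto_intros) (simp add: o_def inverse_eq_divide)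
  then have "TV u \<le> ereal (mr + 0)"
    by (rule TV_lower_semicontinuous[OF v(2) ui lim TVn])
  then have TVu: "TV u \<le> m" by (simp add: mr)
  moreover have "TV u < \<infinity>" using TVu mr by (auto intro: le_less_trans)
  moreover have "(\<integral>x. u x \<partial>lborel) = 0"
    using integral_tendsto_L1[OF v(2) ui lim, of UNIV] vX(1) by (simp add: LIMSEQ_const_iff)
  moreover have "(\<integral>x. indicator \<Omega>s x * u x \<partial>lborel) = measure lborel \<Omega>s"
    using integral_tendsto_L1[OF v(2) ui lim, of \<Omega>s] vX(2) by (simp add: LIMSEQ_const_iff)
  moreover have "gradient_free u \<Omega>s"
    unfolding gradient_free_def
  proof
    fix \<phi> assume \<phi>: "\<phi> \<in> test_fields \<Omega>s"
    then have "(\<lambda>n. dist_grad (v (r n)) \<phi>) \<longlonglongrightarrow> dist_grad u \<phi>"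
      by (intro dist_grad_tendsto v ui lim) (simp add: test_fields_iff)
    then show "dist_grad u \<phi> = 0" using vX(3) \<phi> by (simp add: gradient_free_def LIMSEQ_const_iff)
  qed
  ultimately have "u \<in> ?X" using BV_diamond_iff[OF ui u0 O(1,3) bs O(4)] by blast
  moreover have "TV u \<le> TV w" if "w \<in> ?X" for w
    by (rule order_trans[OF TVu]) (auto simp: m_def intro: INF_lower that)
  ultimately show thesis using ui u0 by (intro that)
qed

section \<open>Sets of finite perimeter\<close>

lemma lborel_nn_integral_shift:
  fixes f :: "'a::euclidean_space \<Rightarrow> ennreal"
  assumes [measurable]: "f \<in> borel_measurable borel"
  shows "(\<integral>\<^sup>+x. f (a + x) \<partial>lborel) = (\<integral>\<^sup>+x. f x \<partial>lborel)"
proof -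
  have "(\<integral>\<^sup>+x. f x \<partial>lborel) = (\<integral>\<^sup>+x. f x \<partial>distr lborel borel ((+) a))" by (simp add: lborel_distr_plus)
  also have "\<dots> = (\<integral>\<^sup>+x. f (a + x) \<partial>lborel)" by (rule nn_integral_distr) auto
  finally show ?thesis by simp
qed

lemma borel_version:
  fixes E :: "'a::euclidean_space set"
  assumes E: "E \<in> lmeasurable"
  obtains E' where "E' \<in> sets borel" "AE x in lebesgue. x \<in> E \<longleftrightarrow> x \<in> E'" "emeasure lborel E' < \<infinity>"
    "measure lborel E' = measure lebesgue E" "Per E' = Per E"
proof -
  have [measurable]: "E \<in> sets lebesgue" using E by (rule fmeasurableD)
  have im: "(indicator E :: 'a \<Rightarrow> real) \<in> borel_measurable lebesgue" by measurable
  obtain g :: "'a \<Rightarrow> real" where g: "g \<in> borel_measurable lborel" "AE x in lborel. indicator E x = g x"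
    using completion_ex_borel_measurable_real[OF im] by blast
  have [measurable]: "g \<in> borel_measurable borel" using g by simp
  define E' where "E' = {x. g x = 1}"
  have E'[measurable]: "E' \<in> sets borel" unfolding E'_def by measurable
  have E'l: "E' \<in> sets lebesgue" by simp
  have ae: "AE x in lebesgue. x \<in> E \<longleftrightarrow> x \<in> E'"
    using AE_completion[OF g(2)] by eventually_elim (auto simp: E'_def indicator_def split: if_splits)
  have em: "emeasure lebesgue E' = emeasure lebesgue E"
    by (rule emeasure_eq_AE) (use ae E'l in \<open>auto elim: eventually_mono\<close>)
  then have em': "emeasure lborel E' = emeasure lebesgue E" by simp
  have ae': "AE x in lebesgue. (indicator E' x :: real) = indicator E x"
    using ae by eventually_elim (auto simp: indicator_def)
  have P: "Per E' = Per E" unfolding Per_def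
    by (rule TV_cong_AE[OF ae' _ im]) (use E'l in measurable)
  show thesis
  proof (rule that[OF E' ae])
    show "emeasure lborel E' < \<infinity>" using E em' by (simp add: fmeasurable_def)
    show "measure lborel E' = measure lebesgue E" using em' by (simp add: measure_def)
    show "Per E' = Per E" by (rule P)
  qed
qed

text \<open>A set whose perimeter is small compared with its measure has large measure. By the translation
estimate \<open>E\<close> overlaps each translate \<open>E - h\<close> with \<open>|h| < 1 / K\<close> in at least half of its measure,
whereas the overlaps integrate over all \<open>h\<close> to the square of the measure of \<open>E\<close>.\<close>

lemma measure_lower_bound_borel:
  fixes E :: "'a::euclidean_space set"
  assumes E[measurable]: "E \<in> sets borel" and fin: "emeasure lborel E < \<infinity>" and K: "K > 0"
    and P: "Per E \<le> ereal (K * measure lborel E)" and pos: "measure lborel E > 0"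
  shows "measure lborel (ball (0::'a) (1 / K)) / 2 \<le> measure lborel E"
proof -
  let ?\<mu> = "measure lborel E" and ?B = "ball (0::'a) (1 / K)"
  have eE: "emeasure lborel E = ennreal ?\<mu>" using fin by (intro emeasure_eq_ennreal_measure) auto
  have eB: "emeasure lborel ?B = ennreal (measure lborel ?B)"
    using emeasure_bounded_finite[of ?B] by (intro emeasure_eq_ennreal_measure) auto
  have Ei: "integrable lborel (indicator E :: 'a \<Rightarrow> real)" using fin by (simp add: integrable_indicator_iff)
  have overlap: "ennreal (?\<mu> / 2) \<le> (\<integral>\<^sup>+x. indicator E x * indicator E (x + h) \<partial>lborel)" if h: "h \<in> ?B" for h
  proof -
    let ?f = "\<lambda>x. indicator E x * (indicator E (x + h) :: real)"
    have fi: "integrable lborel ?f"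
      by (rule Bochner_Integration.integrable_bound[OF Ei]) (auto simp: indicator_def)
    have si: "integrable lborel (\<lambda>x. indicator E (x + h) :: real)" by (rule lborel_integrable_shift[OF Ei])
    have "(\<integral>x. \<bar>indicator E (x + h) - indicator E x :: real\<bar> \<partial>lborel) \<le> norm h * (K * ?\<mu>)"
      using P by (intro translation_estimate Ei) (simp add: Per_def)
    also have "\<dots> \<le> (1 / K) * (K * ?\<mu>)" using h K pos by (intro mult_right_mono) auto
    also have "\<dots> = ?\<mu>" using K by simp
    finally have "(\<integral>x. \<bar>indicator E (x + h) - indicator E x :: real\<bar> \<partial>lborel) \<le> ?\<mu>" .
    moreover have "\<bar>indicator E (x + h) - indicator E x :: real\<bar> = indicator E (x + h) + indicator E x - 2 * ?f x" for x
      by (auto simp: indicator_def)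
    ultimately have "(\<integral>x. indicator E (x + h) + indicator E x - 2 * ?f x \<partial>lborel) \<le> ?\<mu>" by simp
    also have "(\<integral>x. indicator E (x + h) + indicator E x - 2 * ?f x \<partial>lborel)
        = (\<integral>x. indicator E (x + h) \<partial>lborel) + (\<integral>x. indicator E x \<partial>lborel) - 2 * (\<integral>x. ?f x \<partial>lborel)"
      using fi si Ei by simp
    also have "(\<integral>x. indicator E (x + h) \<partial>lborel) = ?\<mu>"
      using lborel_integral_shift[of "indicator E :: 'a \<Rightarrow> real" h] by simp
    finally have "?\<mu> / 2 \<le> (\<integral>x. ?f x \<partial>lborel)" by simp
    then have "ennreal (?\<mu> / 2) \<le> ennreal (\<integral>x. ?f x \<partial>lborel)" by (rule ennreal_leI)
    also have "\<dots> = (\<integral>\<^sup>+x. ennreal (?f x) \<partial>lborel)" using fi by (intro nn_integral_eq_integral[symmetric]) auto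
    also have "\<dots> = (\<integral>\<^sup>+x. indicator E x * indicator E (x + h) \<partial>lborel)"
      by (intro nn_integral_cong) (auto simp: indicator_def)
    finally show ?thesis .
  qed
  have "ennreal (?\<mu> / 2) * ennreal (measure lborel ?B) = (\<integral>\<^sup>+h. ennreal (?\<mu> / 2) * indicator ?B h \<partial>lborel)"
    by (subst nn_integral_cmult_indicator) (auto simp: eB)
  also have "\<dots> \<le> (\<integral>\<^sup>+h. (\<integral>\<^sup>+x. indicator E x * indicator E (x + h) \<partial>lborel) \<partial>lborel)"
    by (rule nn_integral_mono) (use overlap in \<open>auto simp: indicator_def\<close>)
  also have "\<dots> = (\<integral>\<^sup>+x. (\<integral>\<^sup>+h. indicator E x * indicator E (x + h) \<partial>lborel) \<partial>lborel)"
    by (rule lborel_pair.Fubini') measurable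
  also have "\<dots> = (\<integral>\<^sup>+x. indicator E x * ennreal ?\<mu> \<partial>lborel)"
  proof (rule nn_integral_cong)
    fix x
    have "(\<integral>\<^sup>+h. indicator E (x + h) \<partial>lborel) = ennreal ?\<mu>"
      using lborel_nn_integral_shift[of "indicator E" x] eE by simp
    then show "(\<integral>\<^sup>+h. indicator E x * indicator E (x + h) \<partial>lborel) = indicator E x * ennreal ?\<mu>"
      by (simp add: nn_integral_cmult)
  qed
  also have "\<dots> = ennreal ?\<mu> * ennreal ?\<mu>" by (simp add: nn_integral_multc eE)
  finally have "?\<mu> / 2 * measure lborel ?B \<le> ?\<mu> * ?\<mu>"
    by (simp add: ennreal_mult[symmetric] ennreal_le_iff)
  then have "?\<mu> * (measure lborel ?B / 2) \<le> ?\<mu> * ?\<mu>" by (simp add: mult.commute)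
  then show ?thesis using pos by (simp only: mult_le_cancel_left_pos)
qed

lemma measure_lower_bound:
  fixes E :: "'a::euclidean_space set"
  assumes E: "E \<in> lmeasurable" and K: "K > 0"
    and P: "Per E \<le> ereal (K * measure lebesgue E)" and pos: "measure lebesgue E > 0"
  shows "measure lborel (ball (0::'a) (1 / K)) / 2 \<le> measure lebesgue E"
proof -
  obtain E' where E': "E' \<in> sets borel" "AE x in lebesgue. x \<in> E \<longleftrightarrow> x \<in> E'" "emeasure lborel E' < \<infinity>"
    "measure lborel E' = measure lebesgue E" "Per E' = Per E"
    by (rule borel_version[OF E])
  show ?thesis using measure_lower_bound_borel[OF E'(1,3) K] P pos E'(4,5) by simp
qed

lemma Per_pos:
  fixes E :: "'a::euclidean_space set"
  assumes E: "E \<in> lmeasurable" "bounded E" and pos: "measure lebesgue E > 0"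
  shows "Per E > 0"
proof (rule ccontr)
  assume "\<not> Per E > 0"
  then have P0: "Per E \<le> ereal 0" by (simp add: zero_ereal_def)
  obtain R where R: "R > 0" "\<And>x. x \<in> E \<Longrightarrow> norm x \<le> R" using E(2) by (auto simp: bounded_pos)
  obtain E' where E': "E' \<in> sets borel" "AE x in lebesgue. x \<in> E \<longleftrightarrow> x \<in> E'" "emeasure lborel E' < \<infinity>"
    "measure lborel E' = measure lebesgue E" "Per E' = Per E"
    by (rule borel_version[OF E(1)])
  let ?F = "E' \<inter> cball 0 R"
  have F: "?F \<in> sets borel" using E'(1) by auto
  have ae: "AE x in lebesgue. (indicator ?F x :: real) = indicator E' x"
    using E'(2) by eventually_elim (use R in \<open>auto simp: indicator_def\<close>)
  have [measurable]: "E' \<in> sets lebesgue" "?F \<in> sets lebesgue" using E'(1) F by simp_all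
  have "Per ?F = Per E'" unfolding Per_def by (rule TV_cong_AE[OF ae]) measurable
  then have TV: "TV (indicator ?F :: 'a \<Rightarrow> real) \<le> ereal 0" using E'(5) P0 by (simp add: Per_def)
  have "emeasure lborel ?F \<le> emeasure lborel E'" by (rule emeasure_mono) (use E' in auto)
  then have i: "integrable lborel (indicator ?F :: 'a \<Rightarrow> real)"
    using F E'(3) by (simp add: integrable_indicator_iff)
  have "(\<integral>x. \<bar>indicator ?F x :: real\<bar> \<partial>lborel) \<le> (R + 1) * 0"
    by (rule poincare[OF i TV]) (use R in auto)
  then have "measure lborel ?F \<le> 0" using F by simp
  moreover have "measure lebesgue ?F = measure lebesgue E'"
    unfolding measure_def
    by (rule arg_cong[where f=enn2real], rule emeasure_eq_AE)
      (use E'(2) R in \<open>auto elim!: eventually_mono\<close>)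
  ultimately show False using pos E' F by simp
qed

lemma nonpos_if_le_small_multiples:
  assumes "\<And>\<epsilon>. \<epsilon> > 0 \<Longrightarrow> (d::real) \<le> \<epsilon> * S" shows "d \<le> 0"
proof -
  have "((\<lambda>\<epsilon>. \<epsilon> * S) \<longlongrightarrow> 0 * S) (at_right 0)" by (intro tendsto_intros)
  then show ?thesis
    by (intro tendsto_lowerbound[of "\<lambda>\<epsilon>. \<epsilon> * S" 0 "at_right 0" d])
      (use assms in \<open>auto simp: eventually_at_right_less eventually_at_filter\<close>)
qed

text \<open>If the total variation is additive on \<open>v + w\<close>, then gradients do not cancel: where \<open>v + w\<close> has no
gradient, neither has \<open>v\<close>. Let \<open>\<psi>\<close> be an almost optimal field for \<open>v + w\<close>, hence also for \<open>v\<close> and \<open>w\<close>, and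
\<open>\<phi>\<close> a field supported in \<open>U\<close>. Replacing \<open>\<psi>\<close> by \<open>(1 - |\<phi>|\<^sup>2) \<psi>\<close> changes nothing for \<open>v + w\<close>. Adding \<open>\<epsilon> \<phi>\<close>
increases the norm of the field only to \<open>1 + \<epsilon>\<^sup>2 / 4\<close>, so the gain in \<open>v\<close>, which is linear in \<open>\<epsilon>\<close>, cannot
be positive.\<close>

lemma gradient_free_summand:
  fixes v w :: "'a::euclidean_space \<Rightarrow> real"
  assumes v: "integrable lebesgue v" and w: "integrable lebesgue w"
    and S: "TV v = ereal S" and T: "TV w = ereal T" and ST: "TV (\<lambda>x. v x + w x) = ereal (S + T)"
    and gf: "gradient_free (\<lambda>x. v x + w x) U"
  shows "gradient_free v U"
proof -
  have key: "dist_grad v \<phi> \<le> 0" if \<phi>: "\<phi> \<in> test_fields U" and \<phi>1: "\<And>x. norm (\<phi> x) \<le> 1" for \<phi>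
  proof (rule nonpos_if_le_small_multiples)
    fix \<epsilon> :: real assume \<epsilon>: "\<epsilon> > 0"
    have t: "test_fun \<phi>" and sub: "closure {x. \<phi> x \<noteq> 0} \<subseteq> U" using \<phi> by (auto simp: test_fields_iff)
    have "\<epsilon> * dist_grad v \<phi> \<le> \<epsilon>\<^sup>2 / 4 * S + e" if e: "e > 0" for e
    proof -
      have "ereal (S + T - e) < TV (\<lambda>x. v x + w x)" using e by (simp add: ST)
      then obtain \<psi> where \<psi>: "\<psi> \<in> test_fields UNIV" "\<And>x. norm (\<psi> x) \<le> 1"
        "S + T - e < dist_grad (\<lambda>x. v x + w x) \<psi>"
        unfolding TV_def total_mass_def less_SUP_iff by auto
      have t\<psi>: "test_fun \<psi>" using \<psi>(1) by (simp add: test_fields_iff)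
      define a where "a x = (\<phi> x \<bullet> \<phi> x) *\<^sub>R \<psi> x" for x
      have ta: "test_fun a"
        unfolding a_def[abs_def]
        by (rule test_fun_subset[OF t]) (intro smooth_scaleR smooth_inner test_fun_smooth t t\<psi>, simp)
      have "{x. a x \<noteq> 0} \<subseteq> {x. \<phi> x \<noteq> 0}" by (auto simp: a_def)
      then have "closure {x. a x \<noteq> 0} \<subseteq> U" using closure_mono sub by blast
      then have a0: "dist_grad (\<lambda>x. v x + w x) a = 0" using gf ta by (simp add: gradient_free_def test_fields_iff)
      define \<eta> where "\<eta> x = \<psi> x + - a x" for x
      have t\<eta>: "test_fun \<eta>" unfolding \<eta>_def by (intro test_fun_add test_fun_minus t\<psi> ta)
      have n\<eta>: "norm (\<eta> x) \<le> 1 - (norm (\<phi> x))\<^sup>2" for x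
      proof -
        have "(norm (\<phi> x))\<^sup>2 \<le> 1" using \<phi>1[of x] by (simp add: power_le_one)
        moreover have "\<eta> x = (1 - (norm (\<phi> x))\<^sup>2) *\<^sub>R \<psi> x"
          by (simp add: \<eta>_def a_def algebra_simps dot_square_norm)
        ultimately show ?thesis using \<psi>(2)[of x] by (simp add: mult_left_le)
      qed
      have "dist_grad (\<lambda>x. v x + w x) \<eta> = dist_grad (\<lambda>x. v x + w x) \<psi>"
        unfolding \<eta>_def using v w t\<psi> ta a0
        by (subst dist_grad_add_field) (auto intro: test_fun_minus simp: dist_grad_minus)
      then have 1: "S + T - e < dist_grad v \<eta> + dist_grad w \<eta>" using \<psi>(3) dist_grad_add[OF v w t\<eta>] by simp
      have "norm (\<eta> x) \<le> 1" for x using n\<eta>[of x] by (smt (verit) zero_le_power2)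
      then have 2: "dist_grad w \<eta> \<le> T" using dist_grad_le_TV[OF t\<eta>, of w] T by simp
      define \<xi> where "\<xi> x = \<eta> x + \<epsilon> *\<^sub>R \<phi> x" for x
      have t\<xi>: "test_fun \<xi>" unfolding \<xi>_def by (intro test_fun_add test_fun_scaleR t\<eta> t)
      have n\<xi>: "norm (\<xi> x) \<le> 1 + \<epsilon>\<^sup>2 / 4" for x
      proof -
        have "norm (\<xi> x) \<le> norm (\<eta> x) + \<epsilon> * norm (\<phi> x)"
          unfolding \<xi>_def using norm_triangle_ineq[of "\<eta> x" "\<epsilon> *\<^sub>R \<phi> x"] \<epsilon> by simp
        also have "\<dots> \<le> 1 - (norm (\<phi> x))\<^sup>2 + \<epsilon> * norm (\<phi> x)" using n\<eta>[of x] by simp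
        also have "\<dots> = 1 + \<epsilon>\<^sup>2 / 4 - (norm (\<phi> x) - \<epsilon> / 2)\<^sup>2" by (simp add: power2_eq_square algebra_simps)
        also have "\<dots> \<le> 1 + \<epsilon>\<^sup>2 / 4" by simp
        finally show ?thesis .
      qed
      have "\<bar>dist_grad v \<xi>\<bar> \<le> (1 + \<epsilon>\<^sup>2 / 4) * S"
        using S by (intro dist_grad_bound t\<xi> n\<xi>) auto
      moreover have "dist_grad v \<xi> = dist_grad v \<eta> + \<epsilon> * dist_grad v \<phi>"
        unfolding \<xi>_def using v t\<eta> t by (simp add: dist_grad_add_field test_fun_scaleR dist_grad_scaleR)
      ultimately show ?thesis using 1 2 by (simp add: algebra_simps)
    qed
    then have "\<epsilon> * dist_grad v \<phi> \<le> \<epsilon>\<^sup>2 / 4 * S" by (rule field_le_epsilon)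
    then have "\<epsilon> * dist_grad v \<phi> \<le> \<epsilon> * (\<epsilon> * (S / 4))" by (simp add: power2_eq_square)
    then show "dist_grad v \<phi> \<le> \<epsilon> * (S / 4)" using \<epsilon> by (simp only: mult_le_cancel_left_pos)
  qed
  show ?thesis
    unfolding gradient_free_def
  proof
    fix \<phi> assume \<phi>: "\<phi> \<in> test_fields U"
    then have t: "test_fun \<phi>" and sub: "closure {x. \<phi> x \<noteq> 0} \<subseteq> U" by (auto simp: test_fields_iff)
    obtain B where B: "B \<ge> 0" "\<And>x. norm (\<phi> x) \<le> B" by (rule test_fun_bounded[OF t]) blast
    have *: "c * dist_grad v \<phi> \<le> 0" if c: "\<bar>c\<bar> = 1 / (B + 1)" for c
    proof -
      have "dist_grad v (\<lambda>x. c *\<^sub>R \<phi> x) \<le> 0"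
      proof (rule key)
        have "c \<noteq> 0" using c B(1) by auto
        then show "(\<lambda>x. c *\<^sub>R \<phi> x) \<in> test_fields U"
          using sub by (simp add: test_fields_iff test_fun_scaleR t)
        show "norm (c *\<^sub>R \<phi> x) \<le> 1" for x
          using B(2)[of x] B(1) c by (simp add: divide_le_eq)
      qed
      then show ?thesis using t by (simp add: dist_grad_scaleR)
    qed
    from *[of "1 / (B + 1)"] *[of "- (1 / (B + 1))"] B(1) show "dist_grad v \<phi> = 0"
      by (simp add: divide_le_0_iff zero_le_divide_iff)
  qed
qed

text \<open>Let \<open>\<kappa>\<close> be additive, at most a multiple of the measure, and at most the perimeter on those subsets of
\<open>E0\<close> whose indicator has no gradient on \<open>U\<close>. If \<open>\<kappa>\<close> equals the perimeter on \<open>E0\<close>, then some indecomposable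
subset has the same property: the subsets with this property have measure bounded below by a positive
constant, and one of measure less than twice the infimum cannot split into two others.\<close>

lemma indecomposable_subset:
  fixes E0 U :: "'a::euclidean_space set" and \<kappa> :: "'a set \<Rightarrow> real"
  assumes add: "\<And>B C. B \<in> lmeasurable \<Longrightarrow> C \<in> lmeasurable \<Longrightarrow> B \<inter> C = {} \<Longrightarrow> \<kappa> (B \<union> C) = \<kappa> B + \<kappa> C"
    and K: "K > 0" "\<And>E. E \<in> lmeasurable \<Longrightarrow> \<kappa> E \<le> K * measure lebesgue E"
    and ge: "\<And>E. E \<subseteq> E0 \<Longrightarrow> finite_perimeter E \<Longrightarrow> gradient_free (indicator E) U \<Longrightarrow> measure lebesgue E > 0 \<Longrightarrow> ereal (\<kappa> E) \<le> Per E"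
    and E0: "finite_perimeter E0" "gradient_free (indicator E0) U" "measure lebesgue E0 > 0" "Per E0 = ereal (\<kappa> E0)"
  obtains E where "E \<subseteq> E0" "indecomposable E" "gradient_free (indicator E) U" "measure lebesgue E > 0" "Per E = ereal (\<kappa> E)"
proof -
  define S where "S = {E. E \<subseteq> E0 \<and> finite_perimeter E \<and> gradient_free (indicator E) U \<and> measure lebesgue E > 0 \<and> Per E = ereal (\<kappa> E)}"
  define \<mu>0 where "\<mu>0 = measure lborel (ball (0::'a) (1 / K)) / 2"
  have \<mu>0: "\<mu>0 > 0" unfolding \<mu>0_def using measure_pos_open[of "ball (0::'a) (1 / K)"] K(1) by simp
  have low: "\<mu>0 \<le> measure lebesgue E" if "E \<in> S" for E
    unfolding \<mu>0_def using that K by (intro measure_lower_bound) (auto simp: S_def finite_perimeter_def)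
  have ne: "measure lebesgue ` S \<noteq> {}" using E0 by (auto simp: S_def)
  define \<mu> where "\<mu> = Inf (measure lebesgue ` S)"
  have bd: "bdd_below (measure lebesgue ` S)" using low by (intro bdd_belowI2[of _ \<mu>0]) auto
  have "\<mu>0 \<le> \<mu>" unfolding \<mu>_def by (rule cInf_greatest[OF ne]) (use low in auto)
  then have \<mu>: "\<mu> > 0" using \<mu>0 by simp
  then have "\<mu> < 2 * \<mu>" by simp
  then have "\<exists>x\<in>measure lebesgue ` S. x < 2 * \<mu>"
    using cInf_lessD[OF ne, of "2 * \<mu>"] unfolding \<mu>_def[symmetric] by blast
  then obtain E where E: "E \<in> S" "measure lebesgue E < 2 * \<mu>" by blast
  have ge\<mu>: "\<mu> \<le> measure lebesgue B" if "B \<in> S" for B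
    unfolding \<mu>_def by (rule cInf_lower[OF _ bd]) (use that in auto)
  have "indecomposable E"
    unfolding indecomposable_def
  proof (intro conjI notI)
    show "finite_perimeter E" using E by (simp add: S_def)
    assume "\<exists>B C. finite_perimeter B \<and> finite_perimeter C \<and> B \<inter> C = {} \<and>
           measure lebesgue B > 0 \<and> measure lebesgue C > 0 \<and> E = B \<union> C \<and> Per E = Per B + Per C"
    then obtain B C where B: "finite_perimeter B" "measure lebesgue B > 0" and C: "finite_perimeter C" "measure lebesgue C > 0"
      and BC: "B \<inter> C = {}" "E = B \<union> C" "Per E = Per B + Per C" by blast
    have m: "B \<in> lmeasurable" "C \<in> lmeasurable" using B C by (auto simp: finite_perimeter_def)
    have "Per B \<ge> 0" "Per C \<ge> 0" unfolding Per_def by (rule TV_nonneg)+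
    then obtain b c where bc: "Per B = ereal b" "Per C = ereal c"
      using B(1) C(1) unfolding finite_perimeter_def by (cases "Per B"; cases "Per C") auto
    have i: "integrable lebesgue (indicator B :: 'a \<Rightarrow> real)" "integrable lebesgue (indicator C :: 'a \<Rightarrow> real)"
      using m by (auto simp: integrable_indicator_iff fmeasurable_def)
    have ind: "(indicator E :: 'a \<Rightarrow> real) = (\<lambda>x. indicator B x + indicator C x)"
      "(indicator E :: 'a \<Rightarrow> real) = (\<lambda>x. indicator C x + indicator B x)"
      using BC(1,2) by (intro ext; auto simp: indicator_def)+
    have gE: "gradient_free (indicator E) U" using E by (simp add: S_def)
    have PE: "TV (indicator E :: 'a \<Rightarrow> real) = ereal (b + c)" using BC(3) bc by (simp add: Per_def)
    have gB: "gradient_free (indicator B) U"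
      by (rule gradient_free_summand[OF i(1,2), of b c]) (use bc PE gE ind(1) in \<open>auto simp: Per_def\<close>)
    have gC: "gradient_free (indicator C) U"
      by (rule gradient_free_summand[OF i(2,1), of c b]) (use bc PE gE ind(2) in \<open>auto simp: Per_def add.commute\<close>)
    have sub: "B \<subseteq> E0" "C \<subseteq> E0" using E BC by (auto simp: S_def)
    have "\<kappa> B \<le> b" "\<kappa> C \<le> c" using ge[OF sub(1) B(1) gB B(2)] ge[OF sub(2) C(1) gC C(2)] bc by auto
    moreover have "\<kappa> B + \<kappa> C = b + c" using E(1) PE add[OF m BC(1)] BC(2) by (simp add: S_def Per_def)
    ultimately have "\<kappa> B = b" "\<kappa> C = c" by auto
    then have "B \<in> S" "C \<in> S" using sub B C gB gC bc by (auto simp: S_def)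
    then have "2 * \<mu> \<le> measure lebesgue B + measure lebesgue C" using ge\<mu>[of B] ge\<mu>[of C] by simp
    also have "\<dots> = measure lebesgue E" using m BC by (simp add: measure_Un2 Diff_triv Int_commute)
    finally show False using E(2) by simp
  qed
  then show thesis using E(1) by (intro that[of E]) (auto simp: S_def)
qed

section \<open>Combinations of two sets\<close>

text \<open>The perimeter as a real number; it is meaningful for sets of finite perimeter only.\<close>

definition per :: "'a::euclidean_space set \<Rightarrow> real" where
  "per E = real_of_ereal (Per E)"

text \<open>The sets whose indicator functions serve as building blocks of competitors.\<close>

definition admissible :: "(real^2) set \<Rightarrow> (real^2) set \<Rightarrow> (real^2) set \<Rightarrow> bool" where
  "admissible \<Omega> \<Omega>s E \<longleftrightarrow> E \<subseteq> \<Omega> \<and> finite_perimeter E \<and> gradient_free (indicator E) \<Omega>s \<and> measure lebesgue E > 0"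

lemma Per_eq_per: "finite_perimeter E \<Longrightarrow> Per E = ereal (per E)"
  using TV_nonneg[of "indicator E"] unfolding finite_perimeter_def per_def Per_def
  by (cases "TV (indicator E :: 'a \<Rightarrow> real)") auto

text \<open>The function \<open>a 1\<^sub>E - b 1\<^sub>F\<close>.\<close>

definition two_level :: "real \<Rightarrow> 'a set \<Rightarrow> real \<Rightarrow> 'a set \<Rightarrow> 'a \<Rightarrow> real" where
  "two_level a E b F x = a * indicator E x + (- b) * indicator F x"

text \<open>The coefficients are forced by the two integral constraints. The condition \<open>D > 0\<close> says that \<open>E\<close> meets
\<open>\<Omega>s\<close> in a larger proportion than \<open>F\<close> does.\<close>

lemma two_level_BV_diamond:
  assumes O: "open \<Omega>s" "bounded \<Omega>s" "\<Omega>s \<noteq> {}"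
    and E: "admissible \<Omega> \<Omega>s E" and F: "admissible \<Omega> \<Omega>s F" and O': "open \<Omega>"
    and D: "D = measure lebesgue (E \<inter> \<Omega>s) / measure lebesgue \<Omega>s / measure lebesgue E
        - measure lebesgue (F \<inter> \<Omega>s) / measure lebesgue \<Omega>s / measure lebesgue F" "D > 0"
  shows "two_level (1 / (D * measure lebesgue E)) E (1 / (D * measure lebesgue F)) F \<in> BV_diamond \<Omega> \<Omega>s"
    and "TV (two_level (1 / (D * measure lebesgue E)) E (1 / (D * measure lebesgue F)) F)
        \<le> ereal ((per E / measure lebesgue E + per F / measure lebesgue F) / D)"
proof -
  let ?e = "measure lebesgue E" and ?f = "measure lebesgue F" and ?s = "measure lebesgue \<Omega>s"
  define a b where "a = 1 / (D * ?e)" and "b = 1 / (D * ?f)"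
  let ?v = "two_level a E b F"
  have EF: "E \<subseteq> \<Omega>" "F \<subseteq> \<Omega>" "finite_perimeter E" "finite_perimeter F" "?e > 0" "?f > 0"
    using E F by (auto simp: admissible_def)
  have m: "E \<in> lmeasurable" "F \<in> lmeasurable" using EF by (auto simp: finite_perimeter_def)
  have ms: "\<Omega>s \<in> lmeasurable" using O by (simp add: bounded_set_imp_lmeasurable)
  have mO: "\<Omega> \<in> sets lebesgue" using O' by simp
  have s: "?s > 0" using measure_pos_open[OF O] O by simp
  have iE: "integrable lebesgue (indicator E :: real^2 \<Rightarrow> real)" and iF: "integrable lebesgue (indicator F :: real^2 \<Rightarrow> real)"
    using m by (auto simp: integrable_indicator_iff fmeasurable_def)
  have veq: "?v = (\<lambda>x. a * indicator E x + (- b) * indicator F x)" by (simp add: two_level_def[abs_def])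
  have vi: "integrable lebesgue ?v" unfolding veq using iE iF by simp
  have PE: "TV (indicator E :: real^2 \<Rightarrow> real) \<le> ereal (per E)" "TV (indicator F :: real^2 \<Rightarrow> real) \<le> ereal (per F)"
    using Per_eq_per[OF EF(3)] Per_eq_per[OF EF(4)] by (simp_all add: Per_def)
  have ab: "a > 0" "b > 0" using D(2) EF by (auto simp: a_def b_def)
  have "TV ?v \<le> ereal (\<bar>a\<bar> * per E + \<bar>- b\<bar> * per F)"
    unfolding veq using iE iF by (intro TV_add TV_cmult PE) auto
  also have "\<bar>a\<bar> * per E + \<bar>- b\<bar> * per F = (per E / ?e + per F / ?f) / D"
    using ab by (simp add: a_def b_def add_divide_distrib mult.commute)
  finally have TV: "TV ?v \<le> ereal ((per E / ?e + per F / ?f) / D)" .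
  then show "TV (two_level (1 / (D * ?e)) E (1 / (D * ?f)) F) \<le> ereal ((per E / ?e + per F / ?f) / D)"
    by (simp add: a_def b_def)
  have int: "(LINT x:A|lebesgue. ?v x) = a * measure lebesgue (E \<inter> A) - b * measure lebesgue (F \<inter> A)"
    if A: "A \<in> sets lebesgue" for A
  proof -
    have mA: "E \<inter> A \<in> lmeasurable" "F \<inter> A \<in> lmeasurable" using m A by (auto intro: fmeasurable_Int_fmeasurable)
    have "indicator A x *\<^sub>R ?v x = a * indicator (E \<inter> A) x - b * indicator (F \<inter> A) x" for x
      by (auto simp: two_level_def indicator_def)
    moreover have "integrable lebesgue (indicator (E \<inter> A) :: real^2 \<Rightarrow> real)"
      "integrable lebesgue (indicator (F \<inter> A) :: real^2 \<Rightarrow> real)"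
      using mA by (auto simp: integrable_indicator_iff fmeasurable_def)
    ultimately show ?thesis using mA by (simp add: set_lebesgue_integral_def fmeasurableD)
  qed
  have "E \<inter> \<Omega> = E" "F \<inter> \<Omega> = F" using EF by auto
  then have 1: "(LINT x:\<Omega>|lebesgue. ?v x) = 0" using EF D(2) unfolding int[OF mO] by (simp add: a_def b_def)
  have 2: "1 / ?s * (LINT x:\<Omega>s|lebesgue. ?v x) = 1"
  proof -
    have "1 / ?s * (LINT x:\<Omega>s|lebesgue. ?v x) = (measure lebesgue (E \<inter> \<Omega>s) / ?s / ?e - measure lebesgue (F \<inter> \<Omega>s) / ?s / ?f) / D"
      unfolding int[OF fmeasurableD[OF ms]] using EF(5,6) s D(2) by (simp add: a_def b_def field_simps)
    then show ?thesis using D by simp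
  qed
  have 3: "dist_grad ?v \<phi> = 0" if "\<phi> \<in> test_fields \<Omega>s" for \<phi>
  proof -
    have t: "test_fun \<phi>" using that by (simp add: test_fields_iff)
    have "dist_grad ?v \<phi> = a * dist_grad (indicator E) \<phi> + (- b) * dist_grad (indicator F) \<phi>"
      unfolding veq
      by (subst dist_grad_add[OF integrable_mult_right[OF iE] integrable_mult_right[OF iF] t])
        (simp only: dist_grad_cmult)
    then show ?thesis using E F that by (simp add: admissible_def gradient_free_def)
  qed
  have "?v x = 0" if "x \<notin> \<Omega>" for x using that EF by (auto simp: two_level_def indicator_def)
  moreover have "TV ?v < \<infinity>" using TV by (rule le_less_trans) simp
  ultimately show "two_level (1 / (D * ?e)) E (1 / (D * ?f)) F \<in> BV_diamond \<Omega> \<Omega>s"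
    using vi 1 2 3 by (simp add: BV_diamond_def BV_def a_def b_def)
qed

lemma dist_grad_Compl:
  fixes E :: "'a::euclidean_space set"
  assumes E: "E \<in> sets borel" and \<phi>: "test_fun \<phi>"
  shows "dist_grad (indicator (- E)) \<phi> = - dist_grad (indicator E) \<phi>"
proof -
  have [measurable]: "E \<in> sets borel" "- E \<in> sets borel" using E by auto
  have d: "integrable lborel (divergence \<phi>)" by (intro test_fun_integrable test_fun_divergence \<phi>)
  have i: "integrable lborel (\<lambda>x. indicator E x * divergence \<phi> x)"
    by (rule Bochner_Integration.integrable_bound[OF d]) (use d in \<open>auto simp: indicator_def\<close>)
  have "(\<integral>x. indicator (- E) x * divergence \<phi> x \<partial>lborel) = (\<integral>x. divergence \<phi> x - indicator E x * divergence \<phi> x \<partial>lborel)"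
    by (intro Bochner_Integration.integral_cong) (auto simp: indicator_def)
  also have "\<dots> = - (\<integral>x. indicator E x * divergence \<phi> x \<partial>lborel)"
    using d i integral_divergence_eq_0[OF \<phi>] by simp
  finally show ?thesis using \<phi> by (simp add: dist_grad_lborel)
qed

lemma Per_Compl_le:
  fixes E :: "'a::euclidean_space set"
  assumes E: "E \<in> sets borel"
  shows "Per (- E) \<le> Per E"
  unfolding Per_def
proof (rule TV_leI)
  fix \<phi> :: "'a \<Rightarrow> 'a" assume \<phi>: "test_fun \<phi>" "\<And>x. norm (\<phi> x) \<le> 1"
  have "dist_grad (indicator (- E)) \<phi> = dist_grad (indicator E) (\<lambda>x. - \<phi> x)"
    using \<phi> E by (simp add: dist_grad_Compl dist_grad_minus)
  also have "ereal \<dots> \<le> TV (indicator E :: 'a \<Rightarrow> real)"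
    using \<phi> by (intro dist_grad_le_TV test_fun_minus) auto
  finally show "ereal (dist_grad (indicator (- E)) \<phi>) \<le> TV (indicator E :: 'a \<Rightarrow> real)" .
qed

lemma gradient_free_Compl:
  assumes "E \<in> sets borel" "gradient_free (indicator E) U" shows "gradient_free (indicator (- E)) U"
  using assms by (simp add: gradient_free_def dist_grad_Compl test_fields_iff)

lemma AE_lborel_interval:
  fixes a b :: real
  assumes "AE t in lborel. P t" "a < b" obtains t where "a < t" "t < b" "P t"
proof -
  have "\<exists>t. a < t \<and> t < b \<and> P t"
  proof (rule ccontr)
    assume "\<not> ?thesis"
    then have "AE t in lborel. t \<notin> {a<..<b}" using assms(1) by (auto elim!: eventually_mono)
    then have "emeasure lborel {a<..<b} = 0"
      by (subst (asm) AE_iff_measurable[OF _ refl]) (auto simp: greaterThanLessThan_def Int_def greaterThan_def lessThan_def)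
    then show False using assms(2) by simp
  qed
  then show thesis using that by blast
qed

lemma levelset_pos:
  fixes u :: "'a::euclidean_space \<Rightarrow> real"
  assumes [measurable]: "u \<in> borel_measurable borel" and "\<not> (AE x in lborel. u x \<le> 0)"
  obtains \<delta> where "\<delta> > 0" "emeasure lborel {x. u x > \<delta>} > 0"
proof -
  have "\<exists>n. emeasure lborel {x. u x > 1 / real (Suc n)} > 0"
  proof (rule ccontr)
    assume "\<not> ?thesis"
    then have z: "emeasure lborel {x. u x > 1 / real (Suc n)} = 0" for n by (auto simp: zero_less_iff_neq_zero)
    have "AE x in lborel. u x \<le> 1 / real (Suc n)" for n
      by (subst AE_iff_measurable[OF _ refl]) (use z[of n] in \<open>auto simp: not_le\<close>)
    then have "AE x in lborel. \<forall>n. u x \<le> 1 / real (Suc n)" by (simp add: AE_all_countable)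
    then have "AE x in lborel. u x \<le> 0"
    proof eventually_elim
      case (elim x)
      show ?case
      proof (rule ccontr)
        assume "\<not> u x \<le> 0"
        then obtain n where "1 / real (Suc n) < u x" using nat_approx_posE[of "u x"] by auto
        then show False using elim[rule_format, of n] by linarith
      qed
    qed
    then show False using assms(2) by blast
  qed
  then obtain n where "emeasure lborel {x. u x > 1 / real (Suc n)} > 0" by blast
  then show thesis by (intro that[of "1 / real (Suc n)"]) auto
qed

lemma signed_indicator_integral:
  fixes a :: real
  shows "integrable lborel (\<lambda>t. indicator {0<..<a} t - indicator {a..<0} t :: real)"
    and "(\<integral>t. indicator {0<..<a} t - indicator {a..<0} t \<partial>lborel) = a"
    and "(\<integral>t. \<bar>indicator {0<..<a} t - indicator {a..<0} t\<bar> \<partial>lborel) = \<bar>a\<bar>"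
proof -
  have i: "integrable lborel (indicator {0<..<a} :: real \<Rightarrow> real)" "integrable lborel (indicator {a..<0} :: real \<Rightarrow> real)"
  proof -
    have "emeasure lborel {0<..<a} < \<infinity>" "emeasure lborel {a..<0} < \<infinity>" by (cases "0 \<le> a"; simp)+
    then show "integrable lborel (indicator {0<..<a} :: real \<Rightarrow> real)" "integrable lborel (indicator {a..<0} :: real \<Rightarrow> real)"
      by (simp_all add: integrable_indicator_iff)
  qed
  then show "integrable lborel (\<lambda>t. indicator {0<..<a} t - indicator {a..<0} t :: real)" by simp
  show "(\<integral>t. indicator {0<..<a} t - indicator {a..<0} t \<partial>lborel) = a"
    using i by (cases "a \<ge> 0") auto
  have "\<bar>indicator {0<..<a} t - indicator {a..<0} t :: real\<bar> = indicator {0<..<a} t + indicator {a..<0} t" for t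
    by (auto simp: indicator_def)
  then show "(\<integral>t. \<bar>indicator {0<..<a} t - indicator {a..<0} t\<bar> \<partial>lborel) = \<bar>a\<bar>"
    using i by (cases "a \<ge> 0") auto
qed

section \<open>Three-valued minimizers\<close>

theorem theorem6:
  fixes \<Omega> \<Omega>\<^sub>s :: "(real^2) set"
  assumes "open \<Omega>" and "bounded \<Omega>" and "strongly_Lipschitz \<Omega>"
    and "open \<Omega>\<^sub>s" and "bounded \<Omega>\<^sub>s" and "strongly_Lipschitz \<Omega>\<^sub>s"
    and "\<Omega>\<^sub>s \<noteq> {}" and "\<Omega>\<^sub>s \<subseteq> \<Omega>" and "frontier \<Omega>\<^sub>s \<inter> frontier \<Omega> = {}"
    and "finite (components \<Omega>\<^sub>s)"
  shows "\<exists>u\<in>BV_diamond \<Omega> \<Omega>\<^sub>s.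
           (\<forall>v\<in>BV_diamond \<Omega> \<Omega>\<^sub>s. TV u \<le> TV v) \<and>
           card (range u) = 3 \<and> 0 \<in> range u \<and>
           (\<forall>c\<in>range u. emeasure lebesgue {x. u x = c} > 0) \<and>
           (\<forall>c\<in>range u - {0}. indecomposable {x. u x = c})"
proof -
  note O = assms(1,2,4,7,8,9) and bs = assms(5)
  obtain u where uX: "u \<in> BV_diamond \<Omega> \<Omega>\<^sub>s" and ui: "integrable lborel u" and u0: "\<And>x. x \<notin> \<Omega> \<Longrightarrow> u x = 0"
    and umin: "\<And>v. v \<in> BV_diamond \<Omega> \<Omega>\<^sub>s \<Longrightarrow> TV u \<le> TV v"
    using BV_diamond_minimizer[OF O] by blast
  have [measurable]: "u \<in> borel_measurable borel" "\<Omega> \<in> sets borel" "\<Omega>\<^sub>s \<in> sets borel" using ui O by auto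
  have uB: "TV u < \<infinity>" "(\<integral>x. u x \<partial>lborel) = 0" "(\<integral>x. indicator \<Omega>\<^sub>s x * u x \<partial>lborel) = measure lborel \<Omega>\<^sub>s"
    "gradient_free u \<Omega>\<^sub>s"
    using uX BV_diamond_iff[OF ui u0 O(1,3) bs O(4)] by auto
  define s where "s = measure lebesgue \<Omega>\<^sub>s"
  have s_lb: "s = measure lborel \<Omega>\<^sub>s" by (simp add: s_def)
  have s: "s > 0" unfolding s_lb by (intro measure_pos_open O bs)
  obtain m where m: "TV u = ereal m" using uB(1) TV_nonneg[of u] by (cases "TV u") auto
  obtain R where R: "R > 0" "\<And>x. x \<in> \<Omega> \<Longrightarrow> norm x \<le> R" using O(2) by (auto simp: bounded_pos)
  have us_le: "s \<le> (\<integral>x. \<bar>u x\<bar> \<partial>lborel)"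
  proof -
    have "s = (\<integral>x. indicator \<Omega>\<^sub>s x * u x \<partial>lborel)" using uB(3) s_lb by simp
    also have "\<dots> \<le> (\<integral>x. \<bar>u x\<bar> \<partial>lborel)"
    proof (rule integral_mono)
      show "integrable lborel (\<lambda>x. indicator \<Omega>\<^sub>s x * u x)"
        using integrable_real_mult_indicator[of \<Omega>\<^sub>s lborel u] ui by (simp add: mult.commute)
      show "indicator \<Omega>\<^sub>s x * u x \<le> \<bar>u x\<bar>" for x by (auto simp: indicator_def)
    qed (use ui in auto)
    finally show ?thesis .
  qed
  have mpos: "m > 0"
  proof -
    have uR: "u x = 0" if "norm x > R" for x using R(2)[of x] u0[of x] that by force
    have "(\<integral>x. \<bar>u x\<bar> \<partial>lborel) \<le> (R + 1) * m" by (rule poincare[OF ui]) (use m R uR in auto)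
    then have "0 < (R + 1) * m" using us_le s by linarith
    then show ?thesis using R(1) by (simp add: zero_less_mult_iff)
  qed
  define g where "g E = measure lebesgue (E \<inter> \<Omega>\<^sub>s) / s" for E
  have pair: "m * (g E / measure lebesgue E - g F / measure lebesgue F)
      \<le> per E / measure lebesgue E + per F / measure lebesgue F"
    if E: "admissible \<Omega> \<Omega>\<^sub>s E" and F: "admissible \<Omega> \<Omega>\<^sub>s F" for E F
  proof -
    define D where "D = g E / measure lebesgue E - g F / measure lebesgue F"
    have nn: "per E \<ge> 0" "per F \<ge> 0" unfolding per_def Per_def by (intro real_of_ereal_pos TV_nonneg)+
    show ?thesis
    proof (cases "D > 0")
      case True
      note L = two_level_BV_diamond[OF O(3) bs O(4) E F O(1) D_def[unfolded g_def s_def] True]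
      have "ereal m \<le> ereal ((per E / measure lebesgue E + per F / measure lebesgue F) / D)"
        using order_trans[OF umin[OF L(1)] L(2)] m by simp
      then show ?thesis using True unfolding D_def[symmetric] by (simp add: pos_le_divide_eq)
    next
      case False
      then have "m * D \<le> 0" using mpos by (simp add: mult_le_0_iff)
      also have "0 \<le> per E / measure lebesgue E + per F / measure lebesgue F" using nn by simp
      finally show ?thesis unfolding D_def .
    qed
  qed
  \<comment> \<open>For negative levels, the complement \<open>- Et t\<close> is the set of finite measure.\<close>
  define Et where "Et t = {x. u x > t}" for t
  have Et_m[measurable]: "Et t \<in> sets borel" for t unfolding Et_def by measurable
  have Et_sub: "Et t \<subseteq> \<Omega>" if "t > 0" for t using that u0 by (force simp: Et_def)
  have Ft_sub: "- Et t \<subseteq> \<Omega>" if "t < 0" for t using that u0 by (force simp: Et_def)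
  have lm: "E \<in> lmeasurable" if "E \<in> sets borel" "E \<subseteq> \<Omega>" for E
    using that O(2) by (intro bounded_set_imp_lmeasurable) (auto intro: bounded_subset)
  have TVm: "TV u \<le> ereal m" using m by simp
  obtain f :: "real \<Rightarrow> ennreal" where fm[measurable]: "f \<in> borel_measurable borel"
    and f_int: "(\<integral>\<^sup>+t. f t \<partial>lborel) \<le> ennreal m"
    and fAE: "AE t in lborel. TV (indicator {x. u x > t} :: real^2 \<Rightarrow> real) \<le> enn2ereal (f t) \<and>
       (\<forall>U. open U \<longrightarrow> (\<forall>\<phi>\<in>test_fields U. dist_grad u \<phi> = 0) \<longrightarrow>
          (\<forall>\<phi>\<in>test_fields U. dist_grad (indicator {x. u x > t}) \<phi> = 0))"
    by (rule coarea_le[OF ui TVm])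
  \<comment> \<open>The levels at which the conclusions of the coarea inequality are available.\<close>
  define good where "good t \<longleftrightarrow> f t \<noteq> \<infinity> \<and> Per (Et t) \<le> ereal (enn2real (f t)) \<and> gradient_free (indicator (Et t)) \<Omega>\<^sub>s" for t
  have fin: "AE t in lborel. f t \<noteq> \<infinity>"
    using f_int by (intro nn_integral_PInf_AE) (auto simp: top_unique)
  have good: "AE t in lborel. good t"
    using fAE fin
  proof eventually_elim
    case (elim t)
    have "enn2ereal (f t) = ereal (enn2real (f t))"
      using elim(2) by (cases "f t") (auto simp: enn2ereal_ennreal)
    moreover have "gradient_free (indicator (Et t)) \<Omega>\<^sub>s"
      using elim(1) O(3) uB(4) unfolding gradient_free_def Et_def by blast
    ultimately show ?case using elim by (simp add: good_def Per_def Et_def)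
  qed
  have admE: "admissible \<Omega> \<Omega>\<^sub>s (Et t)" if "good t" "t > 0" "measure lebesgue (Et t) > 0" for t
    using that lm[OF Et_m Et_sub] Et_sub
    by (auto simp: admissible_def good_def finite_perimeter_def intro: le_less_trans)
  have admF: "admissible \<Omega> \<Omega>\<^sub>s (- Et t)" if "good t" "t < 0" "measure lebesgue (- Et t) > 0" for t
    using that lm[OF _ Ft_sub, of t] Ft_sub[of t] gradient_free_Compl[OF Et_m, of t] Per_Compl_le[OF Et_m, of t]
    by (auto simp: admissible_def good_def finite_perimeter_def intro: le_less_trans)
  have perE: "per (Et t) \<le> enn2real (f t)" if "good t" "t > 0" "measure lebesgue (Et t) > 0" for t
    using Per_eq_per[of "Et t"] admE[OF that] that by (auto simp: admissible_def good_def)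
  have perF: "per (- Et t) \<le> enn2real (f t)" if "good t" "t < 0" "measure lebesgue (- Et t) > 0" for t
  proof -
    have "ereal (per (- Et t)) = Per (- Et t)"
      using Per_eq_per[of "- Et t"] admF[OF that] by (simp add: admissible_def)
    also have "\<dots> \<le> Per (Et t)" by (rule Per_Compl_le[OF Et_m])
    also have "\<dots> \<le> ereal (enn2real (f t))" using that(1) by (simp add: good_def)
    finally show ?thesis by simp
  qed
  have mpos_iff: "measure lebesgue A > 0" if A: "A \<in> sets borel" "A \<subseteq> \<Omega>" "emeasure lborel B > 0" "B \<subseteq> A" for A B
  proof -
    have "emeasure lborel A > 0" using less_le_trans[OF A(3) emeasure_mono[OF A(4)]] A(1) by simp
    moreover have "emeasure lborel A < \<infinity>" by (rule emeasure_bounded_finite) (use O(2) A(2) in \<open>auto intro: bounded_subset\<close>)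
    ultimately show ?thesis using A(1) by (simp add: measure_def enn2real_positive_iff)
  qed
  have not_AE0: "\<not> (AE x in lborel. u x = 0)"
  proof
    assume "AE x in lborel. u x = 0"
    then have "(\<integral>x. \<bar>u x\<bar> \<partial>lborel) = (\<integral>x. 0 \<partial>(lborel :: (real^2) measure))"
      by (intro integral_cong_AE) (auto elim: eventually_mono)
    then show False using us_le s by simp
  qed
  have "\<not> (AE x in lborel. u x \<le> 0)"
  proof
    assume ae: "AE x in lborel. u x \<le> 0"
    have "AE x in lborel. - u x = 0"
      using ae uB(2) ui by (subst integral_nonneg_eq_0_iff_AE[symmetric]) auto
    then show False using not_AE0 by simp
  qed
  then obtain \<delta>1 where \<delta>1: "\<delta>1 > 0" "emeasure lborel {x. u x > \<delta>1} > 0"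
    by (rule levelset_pos[rotated]) auto
  have posE: "measure lebesgue (Et t) > 0" if "0 < t" "t < \<delta>1" for t
    by (rule mpos_iff[OF Et_m Et_sub[OF that(1)] \<delta>1(2)]) (use that in \<open>auto simp: Et_def\<close>)
  have "\<not> (AE x in lborel. - u x \<le> 0)"
  proof
    assume ae: "AE x in lborel. - u x \<le> 0"
    have "AE x in lborel. u x = 0"
      using ae uB(2) ui by (subst integral_nonneg_eq_0_iff_AE[symmetric]) auto
    then show False using not_AE0 by simp
  qed
  then obtain \<delta>2 where \<delta>2: "\<delta>2 > 0" "emeasure lborel {x. - u x > \<delta>2} > 0"
    by (rule levelset_pos[rotated]) auto
  have posF: "measure lebesgue (- Et t) > 0" if "- \<delta>2 < t" "t < 0" for t
    by (rule mpos_iff[OF _ Ft_sub[OF that(2)] \<delta>2(2)]) (use that in \<open>auto simp: Et_def\<close>)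
  obtain t1 where "0 < t1" "t1 < \<delta>1" "good t1" by (rule AE_lborel_interval[OF good \<delta>1(1)])
  then have adm1: "admissible \<Omega> \<Omega>\<^sub>s (Et t1)" using admE posE by blast
  have "- \<delta>2 < 0" using \<delta>2(1) by simp
  then obtain t2 where "- \<delta>2 < t2" "t2 < 0" "good t2" by (rule AE_lborel_interval[OF good])
  then have adm2: "admissible \<Omega> \<Omega>\<^sub>s (- Et t2)" using admF posF by blast
  \<comment> \<open>The multiplier for the constraint of mean zero.\<close>
  define Q where "Q E = (per E - m * g E) / measure lebesgue E" for E
  define \<alpha> where "\<alpha> = Inf (Q ` Collect (admissible \<Omega> \<Omega>\<^sub>s))"
  have pairQ: "- ((per F + m * g F) / measure lebesgue F) \<le> Q E"
    if "admissible \<Omega> \<Omega>\<^sub>s E" "admissible \<Omega> \<Omega>\<^sub>s F" for E F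
    using pair[OF that] by (simp add: Q_def add_divide_distrib diff_divide_distrib right_diff_distrib)
  have bdd: "bdd_below (Q ` Collect (admissible \<Omega> \<Omega>\<^sub>s))"
    using pairQ adm2 by (intro bdd_belowI2) auto
  define \<kappa> where "\<kappa> E = m * g E + \<alpha> * measure lebesgue E" for E
  have keyE: "\<kappa> E \<le> per E" if E: "admissible \<Omega> \<Omega>\<^sub>s E" for E
  proof -
    have "\<alpha> \<le> Q E" unfolding \<alpha>_def by (rule cInf_lower[OF _ bdd]) (use E in auto)
    moreover have "measure lebesgue E > 0" using E by (simp add: admissible_def)
    ultimately show ?thesis by (simp add: Q_def \<kappa>_def pos_le_divide_eq)
  qed
  have keyF: "- \<kappa> F \<le> per F" if F: "admissible \<Omega> \<Omega>\<^sub>s F" for F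
  proof -
    have "- ((per F + m * g F) / measure lebesgue F) \<le> \<alpha>"
      unfolding \<alpha>_def by (rule cInf_greatest) (use adm1 pairQ[OF _ F] in auto)
    moreover have "measure lebesgue F > 0" using F by (simp add: admissible_def)
    ultimately show ?thesis by (simp add: \<kappa>_def minus_divide_left pos_divide_le_eq)
  qed
  \<comment> \<open>The density of \<open>\<kappa>\<close> on subsets of \<open>\<Omega>\<close>.\<close>
  define k where "k x = m / s * indicator \<Omega>\<^sub>s x + \<alpha> * indicator \<Omega> x" for x :: "real^2"
  have [measurable]: "k \<in> borel_measurable borel" unfolding k_def[abs_def] by measurable
  have \<kappa>_int: "(\<integral>x. k x * indicator A x \<partial>lborel) = \<kappa> A" if A: "A \<in> sets borel" "A \<subseteq> \<Omega>" for A
  proof -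
    have bA: "bounded A" using O(2) A(2) by (rule bounded_subset)
    have fin: "emeasure lborel A < \<infinity>" "emeasure lborel (A \<inter> \<Omega>\<^sub>s) < \<infinity>"
      by (rule emeasure_bounded_finite, simp add: bounded_Int bA)+
    have "k x * indicator A x = m / s * indicator (A \<inter> \<Omega>\<^sub>s) x + \<alpha> * indicator A x" for x
      using A(2) by (auto simp: k_def indicator_def)
    moreover have "integrable lborel (indicator (A \<inter> \<Omega>\<^sub>s) :: real^2 \<Rightarrow> real)" "integrable lborel (indicator A :: real^2 \<Rightarrow> real)"
      using A fin by (auto simp: integrable_indicator_iff)
    ultimately show ?thesis using A by (simp add: \<kappa>_def g_def)
  qed
  \<comment> \<open>The layer cake integrand: integrating it over \<open>t\<close> gives \<open>u x\<close>.\<close>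
  define layer where "layer x t = (if 0 < t \<and> t < u x then 1 else 0) - (if u x \<le> t \<and> t < 0 then 1 else 0 :: real)" for x t
  have layer_ind: "layer x t = indicator {0<..<u x} t - indicator {u x..<0} t" for x t
    by (auto simp: layer_def indicator_def)
  have kB: "\<bar>k x\<bar> \<le> m / s + \<bar>\<alpha>\<bar>" for x
    using mpos s by (auto simp: k_def indicator_def intro: order_trans[OF abs_triangle_ineq])
  have ku: "integrable lborel (\<lambda>x. u x * k x)"
    by (rule integrable_mult_bounded[OF ui _ kB]) measurable
  have H: "integrable (lborel \<Otimes>\<^sub>M lborel) (\<lambda>(x, t). k x * layer x t)"
  proof (rule lborel_pair.Fubini_integrable)
    show "(\<lambda>(x, t). k x * layer x t) \<in> borel_measurable (lborel \<Otimes>\<^sub>M lborel)"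
      unfolding layer_def by measurable
    have "(\<integral>t. norm (case (x, t) of (x, t) \<Rightarrow> k x * layer x t) \<partial>lborel) = \<bar>u x * k x\<bar>" for x
      using signed_indicator_integral(3)[of "u x"] by (simp add: layer_ind abs_mult mult.commute)
    then show "integrable lborel (\<lambda>x. \<integral>t. norm (case (x, t) of (x, t) \<Rightarrow> k x * layer x t) \<partial>lborel)"
      using ku by simp
    show "AE x in lborel. integrable lborel (\<lambda>t. case (x, t) of (x, t) \<Rightarrow> k x * layer x t)"
      using signed_indicator_integral(1) by (simp add: layer_ind)
  qed
  define q where "q t = (\<integral>x. k x * layer x t \<partial>lborel)" for t
  have qi: "integrable lborel q" unfolding q_def by (rule lborel_pair.integrable_snd[OF H])
  have q_int: "(\<integral>t. q t \<partial>lborel) = m"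
  proof -
    have "(\<integral>t. q t \<partial>lborel) = (\<integral>x. (\<integral>t. k x * layer x t \<partial>lborel) \<partial>lborel)"
      unfolding q_def by (rule lborel_pair.Fubini_integral[OF H])
    also have "\<dots> = (\<integral>x. m / s * (indicator \<Omega>\<^sub>s x * u x) + \<alpha> * u x \<partial>lborel)"
    proof (rule Bochner_Integration.integral_cong[OF refl])
      fix x
      have "(\<integral>t. k x * layer x t \<partial>lborel) = k x * u x" using signed_indicator_integral(2)[of "u x"] by (simp add: layer_ind)
      also have "\<dots> = m / s * (indicator \<Omega>\<^sub>s x * u x) + \<alpha> * u x"
        using u0[of x] by (cases "x \<in> \<Omega>") (auto simp: k_def algebra_simps)
      finally show "(\<integral>t. k x * layer x t \<partial>lborel) = m / s * (indicator \<Omega>\<^sub>s x * u x) + \<alpha> * u x" .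
    qed
    also have "\<dots> = m / s * (\<integral>x. indicator \<Omega>\<^sub>s x * u x \<partial>lborel) + \<alpha> * (\<integral>x. u x \<partial>lborel)"
      using ui integrable_real_mult_indicator[of \<Omega>\<^sub>s lborel u] by (simp add: mult.commute)
    also have "\<dots> = m" using uB(2,3) s s_lb by simp
    finally show ?thesis .
  qed
  have qE: "q t = \<kappa> (Et t)" if "t > 0" for t
  proof -
    have "k x * layer x t = k x * indicator (Et t) x" for x using that by (auto simp: layer_def Et_def)
    then show ?thesis using \<kappa>_int[OF Et_m Et_sub[OF that]] by (simp only: q_def)
  qed
  have qF: "q t = - \<kappa> (- Et t)" if "t < 0" for t
  proof -
    have "k x * layer x t = - (k x * indicator (- Et t) x)" for x using that by (auto simp: layer_def Et_def)
    moreover have "(\<integral>x. k x * indicator (- Et t) x \<partial>lborel) = \<kappa> (- Et t)"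
      by (rule \<kappa>_int[OF _ Ft_sub[OF that]]) measurable
    ultimately show ?thesis by (simp only: q_def Bochner_Integration.integral_minus)
  qed
  have null: "\<kappa> A = 0" if "\<not> measure lebesgue A > 0" "A \<in> sets borel" "A \<subseteq> \<Omega>" for A
  proof -
    have "A \<inter> \<Omega>\<^sub>s \<in> sets borel" using that(2) by measurable
    then have "A \<inter> \<Omega>\<^sub>s \<in> sets lebesgue" by simp
    then have "measure lebesgue (A \<inter> \<Omega>\<^sub>s) \<le> measure lebesgue A"
      by (rule measure_mono_fmeasurable[OF Int_lower1 _ lm[OF that(2,3)]])
    then have "measure lebesgue A = 0" "measure lebesgue (A \<inter> \<Omega>\<^sub>s) = 0"
      using that(1) measure_nonneg[of lebesgue A] measure_nonneg[of lebesgue "A \<inter> \<Omega>\<^sub>s"] by linarith+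
    then show ?thesis by (simp add: \<kappa>_def g_def)
  qed
  \<comment> \<open>Almost everywhere \<open>q \<le> f\<close> by the bounds on \<open>\<kappa>\<close>, but the integral of \<open>f\<close> is at most that of \<open>q\<close>.\<close>
  have q_le: "AE t in lborel. q t \<le> enn2real (f t)"
    using good AE_lborel_singleton[of 0]
  proof eventually_elim
    case (elim t)
    consider "t > 0" | "t < 0" using elim(2) by linarith
    then show ?case
    proof cases
      case 1
      show ?thesis
      proof (cases "measure lebesgue (Et t) > 0")
        case True
        show ?thesis using keyE[OF admE[OF elim(1) 1 True]] perE[OF elim(1) 1 True] qE[OF 1] by simp
      qed (use null[OF _ Et_m Et_sub[OF 1]] qE[OF 1] in simp)
    next
      case 2
      show ?thesis
      proof (cases "measure lebesgue (- Et t) > 0")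
        case True
        show ?thesis using keyF[OF admF[OF elim(1) 2 True]] perF[OF elim(1) 2 True] qF[OF 2] by simp
      qed (use null[of "- Et t"] Ft_sub[OF 2] qF[OF 2] in simp)
    qed
  qed
  have f'nn: "(\<integral>\<^sup>+t. ennreal (enn2real (f t)) \<partial>lborel) \<le> ennreal m"
  proof -
    have "(\<integral>\<^sup>+t. ennreal (enn2real (f t)) \<partial>lborel) = (\<integral>\<^sup>+t. f t \<partial>lborel)"
      using fin by (intro nn_integral_cong_AE) (auto elim!: eventually_mono simp: less_top)
    then show ?thesis using f_int by simp
  qed
  have f'i: "integrable lborel (\<lambda>t. enn2real (f t))"
    by (rule integrableI_bounded) (use f'nn in \<open>auto intro: le_less_trans\<close>)
  have "ennreal (\<integral>t. enn2real (f t) \<partial>lborel) \<le> ennreal m"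
    using f'nn nn_integral_eq_integral[OF f'i] by simp
  then have f'_int: "(\<integral>t. enn2real (f t) \<partial>lborel) \<le> m" using mpos by (simp add: ennreal_le_iff)
  have eq: "AE t in lborel. enn2real (f t) - q t = 0"
  proof -
    have di: "integrable lborel (\<lambda>t. enn2real (f t) - q t)" using f'i qi by simp
    have nn: "AE t in lborel. 0 \<le> enn2real (f t) - q t" using q_le by eventually_elim simp
    have "(\<integral>t. enn2real (f t) - q t \<partial>lborel) \<le> 0" using f'i qi f'_int q_int by simp
    then have "(\<integral>t. enn2real (f t) - q t \<partial>lborel) = 0" using integral_nonneg_AE[OF nn] by linarith
    then show ?thesis using integral_nonneg_eq_0_iff_AE[OF di nn] by simp
  qed
  have both: "AE t in lborel. good t \<and> enn2real (f t) = q t" using good eq by eventually_elim simp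
  \<comment> \<open>Levels on both sides of zero at which the bounds on \<open>\<kappa>\<close> are attained.\<close>
  obtain t where t: "0 < t" "t < \<delta>1" "good t" "enn2real (f t) = q t"
    by (rule AE_lborel_interval[OF both \<delta>1(1)]) blast
  obtain r where r: "- \<delta>2 < r" "r < 0" "good r" "enn2real (f r) = q r"
    by (rule AE_lborel_interval[OF both \<open>- \<delta>2 < 0\<close>]) blast
  have E0: "admissible \<Omega> \<Omega>\<^sub>s (Et t)" "per (Et t) = \<kappa> (Et t)"
    using admE[OF t(3,1) posE[OF t(1,2)]] keyE[OF admE[OF t(3,1) posE[OF t(1,2)]]]
      perE[OF t(3,1) posE[OF t(1,2)]] qE[OF t(1)] t(4) by auto
  have F0: "admissible \<Omega> \<Omega>\<^sub>s (- Et r)" "per (- Et r) = - \<kappa> (- Et r)"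
    using admF[OF r(3,2) posF[OF r(1,2)]] keyF[OF admF[OF r(3,2) posF[OF r(1,2)]]]
      perF[OF r(3,2) posF[OF r(1,2)]] qF[OF r(2)] r(4) by auto
  have disj0: "Et t \<inter> - Et r = {}" using t r by (auto simp: Et_def)
  have lms: "E \<inter> \<Omega>\<^sub>s \<in> lmeasurable" if "E \<in> lmeasurable" for E
    using that by (rule fmeasurable_Int_fmeasurable) simp
  have \<kappa>_add: "\<kappa> (B \<union> C) = \<kappa> B + \<kappa> C" if B: "B \<in> lmeasurable" and C: "C \<in> lmeasurable" and BC: "B \<inter> C = {}" for B C
  proof -
    have "measure lebesgue (B \<union> C) = measure lebesgue B + measure lebesgue C"
      using B C BC by (simp add: measure_Un2 Diff_triv Int_commute)
    moreover have "measure lebesgue ((B \<union> C) \<inter> \<Omega>\<^sub>s) = measure lebesgue (B \<inter> \<Omega>\<^sub>s) + measure lebesgue (C \<inter> \<Omega>\<^sub>s)"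
    proof -
      have "(C \<inter> \<Omega>\<^sub>s) - (B \<inter> \<Omega>\<^sub>s) = C \<inter> \<Omega>\<^sub>s" using BC by blast
      then show ?thesis using measure_Un2[OF lms[OF B] lms[OF C]] by (simp add: Int_Un_distrib2)
    qed
    ultimately show ?thesis by (simp add: \<kappa>_def g_def add_divide_distrib distrib_left)
  qed
  define K where "K = m / s + \<bar>\<alpha>\<bar>"
  have Kpos: "K > 0" using mpos s by (simp add: K_def add_pos_nonneg)
  have \<kappa>_le: "\<bar>\<kappa> E\<bar> \<le> K * measure lebesgue E" if "E \<in> lmeasurable" for E
  proof -
    have "measure lebesgue (E \<inter> \<Omega>\<^sub>s) \<le> measure lebesgue E"
      by (rule measure_mono_fmeasurable[OF Int_lower1 fmeasurableD[OF lms[OF that]] that])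
    then have "m * g E \<le> m / s * measure lebesgue E" using mpos s by (simp add: g_def divide_right_mono)
    moreover have "m * g E \<ge> 0" using mpos s by (simp add: g_def)
    moreover have "\<bar>\<alpha> * measure lebesgue E\<bar> = \<bar>\<alpha>\<bar> * measure lebesgue E" by (simp add: abs_mult)
    ultimately show ?thesis unfolding \<kappa>_def K_def distrib_right by linarith
  qed
  have adm_sub: "admissible \<Omega> \<Omega>\<^sub>s E" if "E \<subseteq> E'" "admissible \<Omega> \<Omega>\<^sub>s E'" "finite_perimeter E"
     "gradient_free (indicator E) \<Omega>\<^sub>s" "measure lebesgue E > 0" for E E'
    using that by (auto simp: admissible_def)
  obtain E where E: "E \<subseteq> Et t" "indecomposable E" "gradient_free (indicator E) \<Omega>\<^sub>s" "measure lebesgue E > 0" "Per E = ereal (\<kappa> E)"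
  proof (rule indecomposable_subset[of \<kappa> K "Et t" \<Omega>\<^sub>s])
    show "\<kappa> A \<le> K * measure lebesgue A" if "A \<in> lmeasurable" for A using \<kappa>_le[OF that] by simp
    show "ereal (\<kappa> A) \<le> Per A" if "A \<subseteq> Et t" "finite_perimeter A" "gradient_free (indicator A) \<Omega>\<^sub>s" "measure lebesgue A > 0" for A
      using keyE[OF adm_sub[OF that(1) E0(1) that(2-4)]] Per_eq_per[OF that(2)] by simp
    show "Per (Et t) = ereal (\<kappa> (Et t))" using E0 Per_eq_per[of "Et t"] by (simp add: admissible_def)
  qed (use \<kappa>_add Kpos E0 in \<open>auto simp: admissible_def\<close>)
  obtain F where F: "F \<subseteq> - Et r" "indecomposable F" "gradient_free (indicator F) \<Omega>\<^sub>s" "measure lebesgue F > 0" "Per F = ereal (- \<kappa> F)"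
  proof (rule indecomposable_subset[of "\<lambda>A. - \<kappa> A" K "- Et r" \<Omega>\<^sub>s])
    show "- \<kappa> A \<le> K * measure lebesgue A" if "A \<in> lmeasurable" for A using \<kappa>_le[OF that] by simp
    show "ereal (- \<kappa> A) \<le> Per A" if "A \<subseteq> - Et r" "finite_perimeter A" "gradient_free (indicator A) \<Omega>\<^sub>s" "measure lebesgue A > 0" for A
      using keyF[OF adm_sub[OF that(1) F0(1) that(2-4)]] Per_eq_per[OF that(2)] by simp
    show "Per (- Et r) = ereal (- \<kappa> (- Et r))" using F0 Per_eq_per[of "- Et r"] by (simp add: admissible_def)
  qed (use \<kappa>_add Kpos F0 in \<open>auto simp: admissible_def\<close>)
  have fpE: "finite_perimeter E" and fpF: "finite_perimeter F" using E F by (auto simp: indecomposable_def)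
  have aE: "admissible \<Omega> \<Omega>\<^sub>s E" by (rule adm_sub[OF E(1) E0(1) fpE E(3,4)])
  have aF: "admissible \<Omega> \<Omega>\<^sub>s F" by (rule adm_sub[OF F(1) F0(1) fpF F(3,4)])
  have sub\<Omega>: "E \<subseteq> \<Omega>" "F \<subseteq> \<Omega>" using aE aF by (auto simp: admissible_def)
  have disj: "E \<inter> F = {}" using E(1) F(1) disj0 by blast
  let ?e = "measure lebesgue E" and ?f = "measure lebesgue F"
  define D where "D = g E / ?e - g F / ?f"
  have pE: "per E = \<kappa> E" and pF: "per F = - \<kappa> F" using E(5) F(5) by (simp_all add: per_def)
  \<comment> \<open>The terms with \<open>\<alpha>\<close> cancel.\<close>
  have sum: "per E / ?e + per F / ?f = m * D"
    using E(4) F(4) by (simp add: pE pF \<kappa>_def D_def add_divide_distrib diff_divide_distrib right_diff_distrib)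
  have "Per E > 0" "Per F > 0"
    using E(4) F(4) fpE fpF sub\<Omega> O(2) by (auto intro!: Per_pos simp: finite_perimeter_def intro: bounded_subset)
  then have "per E > 0" "per F > 0" using Per_eq_per[OF fpE] Per_eq_per[OF fpF] by auto
  then have "m * D > 0" using sum[symmetric] E(4) F(4) by (simp add: add_pos_pos)
  then have D: "D > 0" using mpos by (simp add: zero_less_mult_iff)
  define a b where "a = 1 / (D * ?e)" and "b = 1 / (D * ?f)"
  have ab: "a > 0" "b > 0" using D E(4) F(4) by (auto simp: a_def b_def)
  note L = two_level_BV_diamond[OF O(3) bs O(4) aE aF O(1) D_def[unfolded g_def s_def] D, folded a_def b_def]
  let ?w = "two_level a E b F"
  have TVw: "TV ?w \<le> ereal m" using L(2) sum D by simp
  have wE: "{x. ?w x = a} = E" using ab disj by (auto simp: two_level_def indicator_def split: if_splits)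
  have wF: "{x. ?w x = - b} = F" using ab disj by (auto simp: two_level_def indicator_def split: if_splits)
  have w0: "{x. ?w x = 0} = - (E \<union> F)" using ab disj by (auto simp: two_level_def indicator_def split: if_splits)
  have posE': "emeasure lebesgue E > 0" and posF': "emeasure lebesgue F > 0"
    using E(4) F(4) by (auto simp: measure_def zero_less_iff_neq_zero)
  have pos0: "emeasure lebesgue (- (E \<union> F)) > 0"
  proof -
    obtain y :: "real^2" where y: "norm y = R + 1" using vector_choose_size[of "R + 1"] R(1) by auto
    have "ball y 1 \<subseteq> - (E \<union> F)"
    proof
      fix x assume "x \<in> ball y 1"
      then have "norm (y - x) < 1" by (simp add: dist_norm)
      then have "norm x > R" using y norm_triangle_ineq2[of y x] by linarith
      then show "x \<in> - (E \<union> F)" using R(2)[of x] sub\<Omega> by force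
    qed
    moreover have "- (E \<union> F) \<in> sets lebesgue" using fpE fpF by (auto simp: finite_perimeter_def fmeasurableD Compl_in_sets_lebesgue)
    ultimately have "emeasure lebesgue (ball y 1) \<le> emeasure lebesgue (- (E \<union> F))" by (rule emeasure_mono)
    moreover have "emeasure lebesgue (ball y 1) > 0"
      using measure_pos_open[of "ball y 1"] by (auto simp: measure_def zero_less_iff_neq_zero)
    ultimately show ?thesis by simp
  qed
  have ne: "E \<noteq> {}" "F \<noteq> {}" "- (E \<union> F) \<noteq> {}" using posE' posF' pos0 by (metis emeasure_empty less_irrefl)+
  have "range ?w \<subseteq> {a, 0, - b}" using disj by (auto simp: two_level_def indicator_def)
  moreover have "{a, 0, - b} \<subseteq> range ?w"
  proof -
    have "\<exists>x. ?w x = a" "\<exists>x. ?w x = - b" "\<exists>x. ?w x = 0" using ne wE wF w0 by blast+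
    then show ?thesis by (auto simp: image_iff) metis+
  qed
  ultimately have rng: "range ?w = {a, 0, - b}" by (rule antisym)
  show ?thesis
  proof (rule bexI[OF _ L(1)], intro conjI ballI)
    show "TV ?w \<le> TV v" if "v \<in> BV_diamond \<Omega> \<Omega>\<^sub>s" for v
      using order_trans[OF TVw] umin[OF that] m by simp
    show "card (range ?w) = 3" using rng ab by simp
    show "0 \<in> range ?w" using rng by simp
    show "emeasure lebesgue {x. ?w x = c} > 0" if "c \<in> range ?w" for c
      using that rng wE wF w0 posE' posF' pos0 by auto
    show "indecomposable {x. ?w x = c}" if "c \<in> range ?w - {0}" for c
      using that rng wE wF E(2) F(2) by auto
  qed
qed

end
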